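(* Let $F$ be a field of characteristic $\neq2$. Let $\mathcal S_{\mathfrak c_3}=\{\emptyset,\{1,2\},\{2,3\},\{1,3\}\}$, $\mathfrak t_2=\{(\alpha_0,\alpha_1,\alpha_2)\in F^3:\alpha_0+\alpha_1+\alpha_2=0\}$ (abelian Lie algebra), $E=Fe^+\oplus Fe^-$ a two-dimensional vector space. Then the split Lie algebra $\mathfrak a_5$ of type $A_5$, realized as $\mathfrak g(S_4,S_2)$, a subalgebra of $\mathfrak g(S_8,S_2)$, is described as $$\mathfrak a_5=\bigoplus_{\sigma\in\mathcal S_{\mathfrak c_3}}\hat V(\sigma),\qquad \hat V(\emptyset)=\mathfrak{sp}(V)^3\oplus\mathfrak t_2,\qquad \hat V(\sigma)=V(\sigma)\otimes E\ \ (\sigma\ne\emptyset),$$ with multiplication given by $$[x_\sigma,y_\tau]=\epsilon_{\mathfrak a_5}(\sigma,\tau)\,\tilde\varphi_{\sigma,\tau}(x_\sigma,y_\tau)\qquad(\sigma,\tau\in\mathcal S_{\mathfrak c_3},\ x_\sigma\in\hat V(\sigma),\ y_\tau\in\hat V(\tau)),$$ where $\epsilon_{\mathfrak a_5}(\sigma,\tau)=\frac12\epsilon_{\mathfrak c_3}(\sigma,\tau)$ if $\sigma=\tau\neq\emptyset$ and $\epsilon_{\mathfrak a_5}(\sigma,\tau)=\epsilon_{\mathfrak c_3}(\sigma,\tau)$ otherwise, with $\epsilon_{\mathfrak c_3}(\sigma,\tau)=-2$ if $\sigma=\tau\ne\emptyset$ and $\epsilon_{\mathfrak c_3}(\sigma,\tau)=1$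 otherwise (so $\epsilon_{\mathfrak a_5}(\sigma,\tau)=-1$ if $\sigma=\tau\ne\emptyset$, and $1$ otherwise), and the maps $\tilde\varphi_{\sigma,\tau}$ are those defined in the context. That is, with this multiplication the vector space above is a Lie algebra isomorphic to $\mathfrak g(S_4,S_2)$, which is split simple of type $A_5$ if the characteristic of $F$ is $\neq2,3$.
   Context: $V$ is a two-dimensional $F$-vector space with a nonzero skew-symmetric bilinear form $\langle\cdot|\cdot\rangle$; $\mathfrak{sp}(V)=\mathfrak{sl}(V)$ is spanned by $\gamma_{a,b}=\langle a|\cdot\rangle b+\langle b|\cdot\rangle a$. Maps $\varphi_{\sigma,\tau}$ (here $n=3$). $\nu_i:\mathfrak{sp}(V)\to\mathfrak{sp}(V)^n$ is the inclusion as $i$-th component, and $V_i$ is the $\mathfrak{sp}(V)^n$-module $V$ on which only the $i$-th component acts. For $\sigma\subseteq\{1,\dots,n\}$ put $V(\emptyset)=\mathfrak{sp}(V)^n$ and $V(\sigma)=V_{i_1}\otimes\cdots\otimes V_{i_r}$ if $\sigma=\{i_1<\dots<i_r\}$; $\sigma+\tau$ is the symmetric difference. For $\sigma\ne\tau$ both nonempty, $\varphi_{\sigma,\tau}:V(\sigma)\times V(\tau)\to V(\sigma+\tau)$ is contraction by $\langle\cdot|\cdot\rangle$ (argument from $V(\sigma)$ on the left) in all indices of $\sigma\cap\tau$, the remaining factors being put in increasing order of index; and $\varphi_{\sigma,\sigma}(v_i\otimes v_j,w_i\otimes w_j)=-\frac12\bigl(\langle v_j|w_j\rangle\nu_i(\gamma_{v_i,w_i})+\langle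 v_i|w_i\rangle\nu_j(\gamma_{v_j,w_j})\bigr)$ for $\sigma=\{i,j\}$. Elements $a_\sigma\in\mathfrak t_2$: $a_{\{1,2\}}=(1,-\frac12,-\frac12)$, $a_{\{2,3\}}=(-\frac12,1,-\frac12)$, $a_{\{1,3\}}=(-\frac12,-\frac12,1)$. The $\sigma$-action of $\mathfrak t_2$ on $E$ is $(\alpha_0,\alpha_1,\alpha_2).e^{\pm}=\pm\alpha_ie^\pm$, with $i=0,1,2$ for $\sigma=\{1,2\},\{2,3\},\{1,3\}$ respectively. Maps $\tilde\varphi_{\sigma,\tau}:\hat V(\sigma)\times\hat V(\tau)\to\hat V(\sigma+\tau)$. $\tilde\varphi_{\emptyset,\emptyset}$ is the bracket of $\mathfrak{sp}(V)^3\oplus\mathfrak t_2$ (direct sum). For $\sigma\neq\emptyset$, $\tilde\varphi_{\emptyset,\sigma}=-\tilde\varphi_{\sigma,\emptyset}$ (arguments interchanged) is the action of $\mathfrak{sp}(V)^3\oplus\mathfrak t_2$ on $V(\sigma)\otimes E$: $\mathfrak{sp}(V)^3$ acts naturally on $V(\sigma)$ and $\mathfrak t_2$ acts by the $\sigma$-action on $E$. For $\sigma=\{i,j\}$ and $\nu,\nu'\in\{+,-\}$ (read as $\pm1$ when used as a coefficient; $\delta$ is the Kronecker delta): $\tilde\varphi_{\sigma,\sigma}(v_i\otimes v_j\otimes e^\nu,w_i\otimes w_j\otimes e^{\nu'})=\delta_{\nu,-\nu'}\bigl(\varphi_{\sigma,\sigma}(v_i\otimes v_j,w_i\otimes w_j)-\nu\langle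 v_i|w_i\rangle\langle v_j|w_j\rangle a_\sigma\bigr)$. For $\sigma\ne\tau$ nonempty: $\tilde\varphi_{\sigma,\tau}(x\otimes e^\nu,y\otimes e^{\nu'})=\delta_{\nu,\nu'}\varphi_{\sigma,\tau}(x,y)\otimes e^{-\nu}$. The Lie algebra $\mathfrak g(S,S')$. A symmetric composition algebra $(S,*,q)$ is an algebra with regular quadratic form $q$ (polar form $q(x,y)=q(x+y)-q(x)-q(y)$) satisfying $q(x*y)=q(x)q(y)$ and $q(x*y,z)=q(x,y*z)$. Put $\mathfrak{tri}(S)=\{(d_0,d_1,d_2)\in\mathfrak o(S,q)^3: d_0(x*y)=d_1(x)*y+x*d_2(y)\ \forall x,y\}$, $\theta(d_0,d_1,d_2)=(d_2,d_0,d_1)$, and $t_{x,y}=(\sigma_{x,y},\frac12q(x,y)\mathrm{id}-r_xl_y,\frac12q(x,y)\mathrm{id}-l_xr_y)$, where $\sigma_{x,y}(z)=q(x,z)y-q(y,z)x$, $r_x(z)=z*x$, $l_x(z)=x*z$. For two symmetric composition algebras $S,S'$ (data of $S'$ primed), $\mathfrak g(S,S')=\mathfrak{tri}(S)\oplus\mathfrak{tri}(S')\oplus\bigoplus_{i=0}^2\iota_i(S\otimes S')$ with anticommutative product: $\mathfrak{tri}(S)\oplus\mathfrak{tri}(S')$ is a subalgebra (direct sum of Lie algebras); $[(d_0,d_1,d_2),\iota_i(a\otimes x)]=\iota_i(d_i(a)\otimes x)$; $[(d'_0,d'_1,d'_2),\iota_i(a\otimes x)]=\iota_i(a\otimes d'_i(x))$;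 $[\iota_i(a\otimes x),\iota_{i+1}(b\otimes y)]=\iota_{i+2}((a*b)\otimes(x*y))$ (indices mod 3); $[\iota_i(a\otimes x),\iota_i(b\otimes y)]=q'(x,y)\theta^i(t_{a,b})+q(a,b)\theta'^i(t'_{x,y})$. This is known to be a Lie algebra. $S_8$ is the split para-octonion algebra: the split Cayley algebra over $F$ (obtained from $M_2(F)$ by Cayley-Dickson doubling) with the same norm and product $x\bullet y=\bar x\bar y$ ($\bar{\ }$ the standard involution). $S_4$ is the split para-quaternion algebra: $M_2(F)$ with norm $\det$ and product $x\bullet y=\bar x\bar y$; it is a subalgebra of $S_8$. $S_2$ is the para-Hurwitz algebra of $F\times F$: basis $e^+,e^-$, $e^\pm\bullet e^\pm=e^\mp$, $e^\pm\bullet e^\mp=0$, $q(e^\pm)=0$, $q(e^+,e^-)=1$.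
   Formalization: In the map φ̃_{σ,σ} the term −ν⟨v_i|w_i⟩⟨v_j|w_j⟩a_σ is replaced by +ν⟨v_i|w_i⟩⟨v_j|w_j⟩a_σ, since with the printed sign the Jacobi identity fails (e.g. p⊗p⊗e⁺, q⊗q⊗e⁻, p⊗q⊗e⁺ with ⟨p|q⟩=1). *)

theory Defs
  imports "HOL-Analysis.Determinants" "HOL-Library.Function_Algebras"
begin

section \<open>Linear algebra\<close>

text \<open>Vector spaces over a field type are given by an abelian group type together with a scaling
  function (\<^locale>\<open>vector_space\<close>); subspaces are sets.  Addition on function and product types is
  pointwise.\<close>

definition fun_scale :: "('f \<Rightarrow> 'a \<Rightarrow> 'a) \<Rightarrow> 'f \<Rightarrow> ('i \<Rightarrow> 'a) \<Rightarrow> ('i \<Rightarrow> 'a)" where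
  "fun_scale s c x = (\<lambda>i. s c (x i))"

definition prod_scale ::
    "('f \<Rightarrow> 'a \<Rightarrow> 'a) \<Rightarrow> ('f \<Rightarrow> 'b \<Rightarrow> 'b) \<Rightarrow> 'f \<Rightarrow> 'a \<times> 'b \<Rightarrow> 'a \<times> 'b" where
  "prod_scale s s' c x = (s c (fst x), s' c (snd x))"

definition bilinear_map ::
    "('f::field \<Rightarrow> 'a::ab_group_add \<Rightarrow> 'a) \<Rightarrow> ('f \<Rightarrow> 'b::ab_group_add \<Rightarrow> 'b) \<Rightarrow>
     ('f \<Rightarrow> 'c::ab_group_add \<Rightarrow> 'c) \<Rightarrow> ('a \<Rightarrow> 'b \<Rightarrow> 'c) \<Rightarrow> bool" where
  "bilinear_map s1 s2 s3 f \<longleftrightarrow>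
     (\<forall>x. Vector_Spaces.linear s2 s3 (f x)) \<and> (\<forall>y. Vector_Spaces.linear s1 s3 (\<lambda>x. f x y))"

text \<open>The tensor \<open>x \<otimes> y\<close> is realized as the functional ``evaluation at \<open>(x, y)\<close>'' on bilinear forms.
  Over a field, the canonical map from the tensor product of two vector spaces to the dual of the
  space of bilinear forms is injective, and bilinear forms extend from subspaces, so the span of
  these functionals for \<open>x \<in> X\<close>, \<open>y \<in> Y\<close> is a tensor product of the subspaces \<open>X\<close> and \<open>Y\<close>.\<close>

definition tensor ::
    "('f::field \<Rightarrow> 'a::ab_group_add \<Rightarrow> 'a) \<Rightarrow> ('f \<Rightarrow> 'b::ab_group_add \<Rightarrow> 'b) \<Rightarrow>
     'a \<Rightarrow> 'b \<Rightarrow> ('a \<Rightarrow> 'b \<Rightarrow> 'f) \<Rightarrow> 'f" where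
  "tensor s s' x y = (\<lambda>B. if bilinear_map s s' (*) B then B x y else 0)"

definition tensor_space ::
    "('f::field \<Rightarrow> 'a::ab_group_add \<Rightarrow> 'a) \<Rightarrow> ('f \<Rightarrow> 'b::ab_group_add \<Rightarrow> 'b) \<Rightarrow>
     'a set \<Rightarrow> 'b set \<Rightarrow> (('a \<Rightarrow> 'b \<Rightarrow> 'f) \<Rightarrow> 'f) set" where
  "tensor_space s s' X Y =
     module.span (fun_scale (*)) {tensor s s' x y | x y. x \<in> X \<and> y \<in> Y}"

text \<open>The same for the tensor product of copies of one space indexed by a set \<open>\<sigma>\<close>; only the
  values \<open>v i\<close> with \<open>i \<in> \<sigma>\<close> matter.  Since factors are labelled by their index, no reordering of
  factors is ever needed.\<close>

definition multilinear_form ::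
    "('f::field \<Rightarrow> 'v::ab_group_add \<Rightarrow> 'v) \<Rightarrow> 'i set \<Rightarrow> (('i \<Rightarrow> 'v) \<Rightarrow> 'f) \<Rightarrow> bool" where
  "multilinear_form s \<sigma> B \<longleftrightarrow>
     (\<forall>v w. (\<forall>i\<in>\<sigma>. v i = w i) \<longrightarrow> B v = B w) \<and>
     (\<forall>i\<in>\<sigma>. \<forall>v. Vector_Spaces.linear s (*) (\<lambda>x. B (v(i := x))))"

definition itensor ::
    "('f::field \<Rightarrow> 'v::ab_group_add \<Rightarrow> 'v) \<Rightarrow> 'i set \<Rightarrow> ('i \<Rightarrow> 'v) \<Rightarrow> (('i \<Rightarrow> 'v) \<Rightarrow> 'f) \<Rightarrow> 'f" where
  "itensor s \<sigma> v = (\<lambda>B. if multilinear_form s \<sigma> B then B v else 0)"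

definition itensor_space ::
    "('f::field \<Rightarrow> 'v::ab_group_add \<Rightarrow> 'v) \<Rightarrow> 'i set \<Rightarrow> ((('i \<Rightarrow> 'v) \<Rightarrow> 'f) \<Rightarrow> 'f) set" where
  "itensor_space s \<sigma> = module.span (fun_scale (*)) (range (itensor s \<sigma>))"

definition commutator :: "('a \<Rightarrow> 'a) \<Rightarrow> ('a \<Rightarrow> 'a) \<Rightarrow> 'a \<Rightarrow> 'a::ab_group_add" where
  "commutator f g = (\<lambda>x. f (g x) - g (f x))"

section \<open>Lie algebras\<close>

record ('f, 'l) lie =
  lie_space :: "'l set"
  lie_scale :: "'f \<Rightarrow> 'l \<Rightarrow> 'l"
  lie_br :: "'l \<Rightarrow> 'l \<Rightarrow> 'l"

definition lie_algebra :: "('f::field, 'l::ab_group_add) lie \<Rightarrow> bool" where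
  "lie_algebra L \<longleftrightarrow>
     vector_space (lie_scale L) \<and> module.subspace (lie_scale L) (lie_space L) \<and>
     (\<forall>x\<in>lie_space L. \<forall>y\<in>lie_space L. lie_br L x y \<in> lie_space L) \<and>
     (\<forall>x\<in>lie_space L. \<forall>y\<in>lie_space L. \<forall>z\<in>lie_space L.
        lie_br L (x + y) z = lie_br L x z + lie_br L y z \<and>
        lie_br L z (x + y) = lie_br L z x + lie_br L z y) \<and>
     (\<forall>c. \<forall>x\<in>lie_space L. \<forall>y\<in>lie_space L.
        lie_br L (lie_scale L c x) y = lie_scale L c (lie_br L x y) \<and>
        lie_br L x (lie_scale L c y) = lie_scale L c (lie_br L x y)) \<and>
     (\<forall>x\<in>lie_space L. lie_br L x x = 0) \<and>
     (\<forall>x\<in>lie_space L. \<forall>y\<in>lie_space L. \<forall>z\<in>lie_space L.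
        lie_br L (lie_br L x y) z + lie_br L (lie_br L y z) x + lie_br L (lie_br L z x) y = 0)"

text \<open>Linear maps on \<open>lie_space L\<close> are taken to be restrictions of linear maps on the whole type;
  linear maps always extend.\<close>

definition lie_embedding ::
    "('l \<Rightarrow> 'm) \<Rightarrow> ('f::field, 'l::ab_group_add) lie \<Rightarrow> ('f, 'm::ab_group_add) lie \<Rightarrow> bool" where
  "lie_embedding f L M \<longleftrightarrow>
     Vector_Spaces.linear (lie_scale L) (lie_scale M) f \<and>
     inj_on f (lie_space L) \<and> f ` lie_space L \<subseteq> lie_space M \<and>
     (\<forall>x\<in>lie_space L. \<forall>y\<in>lie_space L. f (lie_br L x y) = lie_br M (f x) (f y))"

definition lie_isomorphic ::
    "('f::field, 'l::ab_group_add) lie \<Rightarrow> ('f, 'm::ab_group_add) lie \<Rightarrow> bool" where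
  "lie_isomorphic L M \<longleftrightarrow> (\<exists>f. lie_embedding f L M \<and> f ` lie_space L = lie_space M)"

definition lie_ideal :: "('f::field, 'l::ab_group_add) lie \<Rightarrow> 'l set \<Rightarrow> bool" where
  "lie_ideal L I \<longleftrightarrow> module.subspace (lie_scale L) I \<and> I \<subseteq> lie_space L \<and>
     (\<forall>x\<in>lie_space L. \<forall>y\<in>I. lie_br L x y \<in> I)"

definition simple_lie_algebra :: "('f::field, 'l::ab_group_add) lie \<Rightarrow> bool" where
  "simple_lie_algebra L \<longleftrightarrow> lie_algebra L \<and>
     (\<exists>x\<in>lie_space L. \<exists>y\<in>lie_space L. lie_br L x y \<noteq> 0) \<and>
     (\<forall>I. lie_ideal L I \<longrightarrow> I = {0} \<or> I = lie_space L)"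

text \<open>Split Lie algebras of a given type are described over an arbitrary field by a Chevalley basis.
  A type is a Cartan matrix \<open>C\<close> of rank \<open>n\<close>, with \<open>C i j\<close> the value of the simple root \<open>j\<close> at the
  simple coroot \<open>i\<close> (indices \<open>< n\<close>).  Roots and coroots are integer vectors of coordinates with
  respect to the simple (co)roots; all pairs (root, coroot) arise from the simple pairs by
  simple reflections.\<close>

definition unit_vec :: "nat \<Rightarrow> nat \<Rightarrow> int" where
  "unit_vec i = (\<lambda>j. if j = i then 1 else 0)"

definition pairing :: "nat \<Rightarrow> (nat \<Rightarrow> nat \<Rightarrow> int) \<Rightarrow> (nat \<Rightarrow> int) \<Rightarrow> (nat \<Rightarrow> int) \<Rightarrow> int" where
  "pairing n C \<kappa> \<beta> = (\<Sum>i<n. \<Sum>j<n. \<kappa> i * C i j * \<beta> j)"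

inductive_set root_pairs :: "nat \<Rightarrow> (nat \<Rightarrow> nat \<Rightarrow> int) \<Rightarrow> ((nat \<Rightarrow> int) \<times> (nat \<Rightarrow> int)) set"
  for n C where
  simple: "i < n \<Longrightarrow> (unit_vec i, unit_vec i) \<in> root_pairs n C"
| reflect: "(\<beta>, \<kappa>) \<in> root_pairs n C \<Longrightarrow> i < n \<Longrightarrow>
    (\<lambda>j. \<beta> j - pairing n C (unit_vec i) \<beta> * unit_vec i j,
     \<lambda>j. \<kappa> j - pairing n C \<kappa> (unit_vec i) * unit_vec i j) \<in> root_pairs n C"

definition roots :: "nat \<Rightarrow> (nat \<Rightarrow> nat \<Rightarrow> int) \<Rightarrow> (nat \<Rightarrow> int) set" where
  "roots n C = fst ` root_pairs n C"

text \<open>\<open>h i\<close> are the simple coroot elements, \<open>e \<beta>\<close> the root elements, and \<open>N\<close> the structure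
  constants \<open>\<plusminus>(r + 1)\<close>, where \<open>r\<close> is the largest number such that \<open>\<gamma> - r \<beta>\<close> is a root.\<close>

definition chevalley_basis ::
    "nat \<Rightarrow> (nat \<Rightarrow> nat \<Rightarrow> int) \<Rightarrow> ('f::field, 'l::ab_group_add) lie \<Rightarrow>
     (nat \<Rightarrow> 'l) \<Rightarrow> ((nat \<Rightarrow> int) \<Rightarrow> 'l) \<Rightarrow> bool" where
  "chevalley_basis n C L h e \<longleftrightarrow>
     inj_on h {..<n} \<and> inj_on e (roots n C) \<and> h ` {..<n} \<inter> e ` roots n C = {} \<and>
     \<not> module.dependent (lie_scale L) (h ` {..<n} \<union> e ` roots n C) \<and>
     module.span (lie_scale L) (h ` {..<n} \<union> e ` roots n C) = lie_space L \<and>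
     (\<forall>i<n. \<forall>j<n. lie_br L (h i) (h j) = 0) \<and>
     (\<forall>i<n. \<forall>\<beta>\<in>roots n C.
        lie_br L (h i) (e \<beta>) = lie_scale L (of_int (pairing n C (unit_vec i) \<beta>)) (e \<beta>)) \<and>
     (\<forall>(\<beta>, \<kappa>)\<in>root_pairs n C.
        lie_br L (e \<beta>) (e (\<lambda>j. - \<beta> j)) = (\<Sum>i<n. lie_scale L (of_int (\<kappa> i)) (h i))) \<and>
     (\<forall>\<beta>\<in>roots n C. \<forall>\<gamma>\<in>roots n C. (\<lambda>j. \<beta> j + \<gamma> j) \<notin> roots n C \<and> (\<exists>j. \<beta> j + \<gamma> j \<noteq> 0) \<longrightarrow>
        lie_br L (e \<beta>) (e \<gamma>) = 0) \<and>
     (\<exists>N :: (nat \<Rightarrow> int) \<Rightarrow> (nat \<Rightarrow> int) \<Rightarrow> int.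
        \<forall>\<beta>\<in>roots n C. \<forall>\<gamma>\<in>roots n C. (\<lambda>j. \<beta> j + \<gamma> j) \<in> roots n C \<longrightarrow>
          \<bar>N \<beta> \<gamma>\<bar> = 1 + int (GREATEST r. (\<lambda>j. \<gamma> j - int r * \<beta> j) \<in> roots n C) \<and>
          N (\<lambda>j. - \<beta> j) (\<lambda>j. - \<gamma> j) = - N \<beta> \<gamma> \<and>
          lie_br L (e \<beta>) (e \<gamma>) = lie_scale L (of_int (N \<beta> \<gamma>)) (e (\<lambda>j. \<beta> j + \<gamma> j)))"

definition cartan_A :: "nat \<Rightarrow> nat \<Rightarrow> int" where
  "cartan_A i j = (if i = j then 2 else if i = Suc j \<or> j = Suc i then - 1 else 0)"

definition split_simple_type_A :: "nat \<Rightarrow> ('f::field, 'l::ab_group_add) lie \<Rightarrow> bool" where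
  "split_simple_type_A n L \<longleftrightarrow>
     simple_lie_algebra L \<and> (\<exists>h e. chevalley_basis n cartan_A L h e)"

section \<open>The Lie algebra of two symmetric composition algebras\<close>

record ('f, 's) calg =
  ca_scale :: "'f \<Rightarrow> 's \<Rightarrow> 's"
  ca_mult :: "'s \<Rightarrow> 's \<Rightarrow> 's"
  ca_norm :: "'s \<Rightarrow> 'f"

definition polar :: "('f::field, 's::ab_group_add) calg \<Rightarrow> 's \<Rightarrow> 's \<Rightarrow> 'f" where
  "polar S x y = ca_norm S (x + y) - ca_norm S x - ca_norm S y"

definition orth :: "('f::field, 's::ab_group_add) calg \<Rightarrow> ('s \<Rightarrow> 's) set" where
  "orth S = {d. Vector_Spaces.linear (ca_scale S) (ca_scale S) d \<and>
                (\<forall>x y. polar S (d x) y + polar S x (d y) = 0)}"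

text \<open>Triples with indices modulo 3 are functions on the numeral type \<open>3\<close>, whose arithmetic is modulo 3.\<close>

definition tri :: "('f::field, 's::ab_group_add) calg \<Rightarrow> (3 \<Rightarrow> 's \<Rightarrow> 's) set" where
  "tri S = {d. (\<forall>i. d i \<in> orth S) \<and>
     (\<forall>x y. d 0 (ca_mult S x y) = ca_mult S (d 1 x) y + ca_mult S x (d 2 y))}"

text \<open>The power \<open>\<theta>\<^sup>i\<close> of \<open>\<theta>(d\<^sub>0, d\<^sub>1, d\<^sub>2) = (d\<^sub>2, d\<^sub>0, d\<^sub>1)\<close>.\<close>

definition theta_pow :: "3 \<Rightarrow> (3 \<Rightarrow> 's \<Rightarrow> 's) \<Rightarrow> 3 \<Rightarrow> 's \<Rightarrow> 's" where
  "theta_pow i d = (\<lambda>j. d (j - i))"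

definition t_elem :: "('f::field, 's::ab_group_add) calg \<Rightarrow> 's \<Rightarrow> 's \<Rightarrow> 3 \<Rightarrow> 's \<Rightarrow> 's" where
  "t_elem S x y = (\<lambda>i z.
     if i = 0 then ca_scale S (polar S x z) y - ca_scale S (polar S y z) x
     else if i = 1 then ca_scale S (polar S x y / 2) z - ca_mult S (ca_mult S y z) x
     else ca_scale S (polar S x y / 2) z - ca_mult S x (ca_mult S z y))"

text \<open>Elements of \<open>\<gg>(S, S')\<close> are triples \<open>(d, d', u)\<close> standing for \<open>d + d' + \<Sum>\<^sub>i \<iota>\<^sub>i(u i)\<close>.\<close>

type_synonym ('f, 's, 't) g_elem =
  "(3 \<Rightarrow> 's \<Rightarrow> 's) \<times> (3 \<Rightarrow> 't \<Rightarrow> 't) \<times> (3 \<Rightarrow> ('s \<Rightarrow> 't \<Rightarrow> 'f) \<Rightarrow> 'f)"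

definition g_iota :: "3 \<Rightarrow> (('s \<Rightarrow> 't \<Rightarrow> 'f) \<Rightarrow> 'f)
    \<Rightarrow> ('f::field, 's::ab_group_add, 't::ab_group_add) g_elem" where
  "g_iota i u = (0, 0, \<lambda>j. if j = i then u else 0)"

definition g_scale :: "('f::field, 's::ab_group_add) calg \<Rightarrow> ('f, 't::ab_group_add) calg \<Rightarrow>
    'f \<Rightarrow> ('f, 's, 't) g_elem \<Rightarrow> ('f, 's, 't) g_elem" where
  "g_scale S S' = prod_scale (fun_scale (fun_scale (ca_scale S)))
     (prod_scale (fun_scale (fun_scale (ca_scale S'))) (fun_scale (fun_scale (*))))"

definition g_space :: "('f::field, 's::ab_group_add) calg \<Rightarrow> ('f, 't::ab_group_add) calg \<Rightarrow>
    ('f, 's, 't) g_elem set" where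
  "g_space S S' = {(d, d', u). d \<in> tri S \<and> d' \<in> tri S' \<and>
     (\<forall>i. u i \<in> tensor_space (ca_scale S) (ca_scale S') UNIV UNIV)}"

text \<open>The product is the anticommutative bilinear map with the prescribed values on generators.
  These determine it on \<open>g_space S S'\<close>, and only its values there matter.\<close>

definition g_br :: "('f::field, 's::ab_group_add) calg \<Rightarrow> ('f, 't::ab_group_add) calg \<Rightarrow>
    ('f, 's, 't) g_elem \<Rightarrow> ('f, 's, 't) g_elem \<Rightarrow> ('f, 's, 't) g_elem" where
  "g_br S S' = (let tns = tensor (ca_scale S) (ca_scale S') in SOME br.
     bilinear_map (g_scale S S') (g_scale S S') (g_scale S S') br \<and>
     (\<forall>x y. br x y = - br y x) \<and>
     (\<forall>d\<in>tri S. \<forall>e\<in>tri S. br (d, 0, 0) (e, 0, 0) = (\<lambda>i. commutator (d i) (e i), 0, 0)) \<and>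
     (\<forall>d\<in>tri S'. \<forall>e\<in>tri S'. br (0, d, 0) (0, e, 0) = (0, \<lambda>i. commutator (d i) (e i), 0)) \<and>
     (\<forall>d\<in>tri S. \<forall>d'\<in>tri S'. br (d, 0, 0) (0, d', 0) = 0) \<and>
     (\<forall>d\<in>tri S. \<forall>i a x. br (d, 0, 0) (g_iota i (tns a x)) = g_iota i (tns (d i a) x)) \<and>
     (\<forall>d\<in>tri S'. \<forall>i a x. br (0, d, 0) (g_iota i (tns a x)) = g_iota i (tns a (d i x))) \<and>
     (\<forall>i a b x y. br (g_iota i (tns a x)) (g_iota (i + 1) (tns b y)) =
        g_iota (i + 2) (tns (ca_mult S a b) (ca_mult S' x y))) \<and>
     (\<forall>i a b x y. br (g_iota i (tns a x)) (g_iota i (tns b y)) =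
        g_scale S S' (polar S' x y) (theta_pow i (t_elem S a b), 0, 0) +
        g_scale S S' (polar S a b) (0, theta_pow i (t_elem S' x y), 0)))"

definition g_alg :: "('f::field, 's::ab_group_add) calg \<Rightarrow> ('f, 't::ab_group_add) calg \<Rightarrow>
    ('f, ('f, 's, 't) g_elem) lie" where
  "g_alg S S' = \<lparr>lie_space = g_space S S', lie_scale = g_scale S S', lie_br = g_br S S'\<rparr>"

section \<open>The symmetric composition algebras\<close>

definition mat_scale :: "'f::field \<Rightarrow> 'f^2^2 \<Rightarrow> 'f^2^2" where
  "mat_scale c x = (\<chi> i j. c * x $ i $ j)"

definition mat_bar :: "'f::field^2^2 \<Rightarrow> 'f^2^2" where
  "mat_bar x = mat (trace x) - x"

definition S4 :: "('f::field, 'f^2^2) calg" where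
  "S4 = \<lparr>ca_scale = mat_scale, ca_mult = \<lambda>x y. mat_bar x ** mat_bar y, ca_norm = det\<rparr>"

text \<open>The split Cayley algebra as the Cayley-Dickson double \<open>M\<^sub>2(F) \<oplus> M\<^sub>2(F) u\<close> with \<open>u\<^sup>2 = 1\<close>
  (any nonzero scalar in place of \<open>1\<close> gives an isomorphic algebra).\<close>

definition cayley_mult :: "('f::field^2^2) \<times> ('f^2^2) \<Rightarrow> ('f^2^2) \<times> ('f^2^2) \<Rightarrow> ('f^2^2) \<times> ('f^2^2)" where
  "cayley_mult x y =
     (fst x ** fst y + mat_bar (snd y) ** snd x, snd y ** fst x + snd x ** mat_bar (fst y))"

definition cayley_bar :: "('f::field^2^2) \<times> ('f^2^2) \<Rightarrow> ('f^2^2) \<times> ('f^2^2)" where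
  "cayley_bar x = (mat_bar (fst x), - snd x)"

definition S8 :: "('f::field, ('f^2^2) \<times> ('f^2^2)) calg" where
  "S8 = \<lparr>ca_scale = prod_scale mat_scale mat_scale,
         ca_mult = \<lambda>x y. cayley_mult (cayley_bar x) (cayley_bar y),
         ca_norm = \<lambda>x. det (fst x) - det (snd x)\<rparr>"

text \<open>\<open>(a, b)\<close> stands for \<open>a e\<^sup>+ + b e\<^sup>-\<close>, both in \<open>S2\<close> and in the two-dimensional space \<open>E\<close>.\<close>

definition S2 :: "('f::field, 'f \<times> 'f) calg" where
  "S2 = \<lparr>ca_scale = prod_scale (*) (*),
         ca_mult = \<lambda>x y. (snd x * snd y, fst x * fst y),
         ca_norm = \<lambda>x. fst x * snd x\<rparr>"

text \<open>The natural inclusion of \<open>\<gg>(S\<^sub>4, S\<^sub>2)\<close> in \<open>\<gg>(S\<^sub>8, S\<^sub>2)\<close> induced by that of \<open>S\<^sub>4\<close> in \<open>S\<^sub>8\<close>; elements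
  of \<open>tri(S\<^sub>4)\<close> are extended to elements of \<open>tri(S\<^sub>8)\<close>.\<close>

definition natural_inclusion ::
    "(('f::field, 'f^2^2, 'f \<times> 'f) g_elem \<Rightarrow> ('f, ('f^2^2) \<times> ('f^2^2), 'f \<times> 'f) g_elem) \<Rightarrow> bool" where
  "natural_inclusion f \<longleftrightarrow> lie_embedding f (g_alg S4 S2) (g_alg S8 S2) \<and>
     (\<forall>i a x. f (g_iota i (tensor (ca_scale S4) (ca_scale S2) a x)) =
        g_iota i (tensor (ca_scale S8) (ca_scale S2) (a, 0) x)) \<and>
     (\<forall>d\<in>tri S4. \<exists>e\<in>tri S8. f (d, 0, 0) = (e, 0, 0) \<and> (\<forall>i a. e i (a, 0) = (d i a, 0))) \<and>
     (\<forall>d\<in>tri S2. f (0, d, 0) = (0, d, 0))"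

section \<open>The algebra built from a two-dimensional symplectic space\<close>

text \<open>Throughout, \<open>s\<close> is the scaling of \<open>V\<close> and \<open>b\<close> the skew-symmetric form.  The index set
  \<open>{1, 2, 3}\<close> is the type \<open>3\<close>, in which \<open>3 = 0\<close>, while triples in \<open>\<tt>\<^sub>2\<close> have indices \<open>0, 1, 2\<close>.\<close>

definition sp :: "('f::field \<Rightarrow> 'v::ab_group_add \<Rightarrow> 'v) \<Rightarrow> ('v \<Rightarrow> 'v \<Rightarrow> 'f) \<Rightarrow> ('v \<Rightarrow> 'v) set" where
  "sp s b = {f. Vector_Spaces.linear s s f \<and> (\<forall>x y. b (f x) y + b x (f y) = 0)}"

definition gam :: "('f::field \<Rightarrow> 'v::ab_group_add \<Rightarrow> 'v) \<Rightarrow> ('v \<Rightarrow> 'v \<Rightarrow> 'f) \<Rightarrow> 'v \<Rightarrow> 'v \<Rightarrow> 'v \<Rightarrow> 'v" where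
  "gam s b x y = (\<lambda>z. s (b x z) y + s (b y z) x)"

definition nu_inc :: "3 \<Rightarrow> ('v \<Rightarrow> 'v) \<Rightarrow> 3 \<Rightarrow> 'v \<Rightarrow> 'v::ab_group_add" where
  "nu_inc i f = (\<lambda>j. if j = i then f else 0)"

definition t2 :: "(3 \<Rightarrow> 'f::field) set" where
  "t2 = {\<alpha>. \<alpha> 0 + \<alpha> 1 + \<alpha> 2 = 0}"

definition S_c3 :: "3 set set" where
  "S_c3 = {{}, {1, 2}, {2, 3}, {1, 3}}"

type_synonym ('f, 'v) vs = "((3 \<Rightarrow> 'v) \<Rightarrow> 'f) \<Rightarrow> 'f"
type_synonym ('f, 'v) vse = "(('f, 'v) vs \<Rightarrow> 'f \<times> 'f \<Rightarrow> 'f) \<Rightarrow> 'f"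

text \<open>\<open>\<phi>\<^sub>\<sigma>\<^sub>,\<^sub>\<tau>\<close> for \<open>\<sigma> \<noteq> \<tau>\<close> nonempty and \<open>\<phi>\<^sub>\<sigma>\<^sub>,\<^sub>\<sigma>\<close> for \<open>\<sigma>\<close> of two elements.  Here and below,
  (bi)linear maps are specified by their values on pure tensors, which determine them on the
  tensor spaces.\<close>

definition phi_off :: "('f::field \<Rightarrow> 'v::ab_group_add \<Rightarrow> 'v) \<Rightarrow> ('v \<Rightarrow> 'v \<Rightarrow> 'f) \<Rightarrow> 3 set \<Rightarrow> 3 set \<Rightarrow>
    ('f, 'v) vs \<Rightarrow> ('f, 'v) vs \<Rightarrow> ('f, 'v) vs" where
  "phi_off s b \<sigma> \<tau> = (SOME f.
     bilinear_map (fun_scale (*)) (fun_scale (*)) (fun_scale (*)) f \<and>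
     (\<forall>v w. f (itensor s \<sigma> v) (itensor s \<tau> w) =
        fun_scale (*) (\<Prod>i\<in>\<sigma> \<inter> \<tau>. b (v i) (w i))
          (itensor s (sym_diff \<sigma> \<tau>) (\<lambda>i. if i \<in> \<sigma> then v i else w i))))"

definition phi_diag :: "('f::field \<Rightarrow> 'v::ab_group_add \<Rightarrow> 'v) \<Rightarrow> ('v \<Rightarrow> 'v \<Rightarrow> 'f) \<Rightarrow> 3 set \<Rightarrow>
    ('f, 'v) vs \<Rightarrow> ('f, 'v) vs \<Rightarrow> (3 \<Rightarrow> 'v \<Rightarrow> 'v)" where
  "phi_diag s b \<sigma> = (SOME f.
     bilinear_map (fun_scale (*)) (fun_scale (*)) (fun_scale (fun_scale s)) f \<and>
     (\<forall>v w. f (itensor s \<sigma> v) (itensor s \<sigma> w) =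
        fun_scale (fun_scale s) (- 1 / 2)
          (\<Sum>i\<in>\<sigma>. fun_scale (fun_scale s) (\<Prod>j\<in>\<sigma> - {i}. b (v j) (w j))
             (nu_inc i (gam s b (v i) (w i))))))"

text \<open>The signs \<open>\<nu> = +, -\<close> are the integers \<open>1, - 1\<close>.\<close>

definition e_sgn :: "int \<Rightarrow> 'f::field \<times> 'f" where
  "e_sgn \<nu> = (if \<nu> = 1 then (1, 0) else (0, 1))"

definition t2_index :: "3 set \<Rightarrow> 3" where
  "t2_index \<sigma> = (if \<sigma> = {1, 2} then 0 else if \<sigma> = {2, 3} then 1 else 2)"

definition a_elem :: "3 set \<Rightarrow> 3 \<Rightarrow> 'f::field" where
  "a_elem \<sigma> = (\<lambda>i. if i = t2_index \<sigma> then 1 else - 1 / 2)"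

definition E_act :: "3 set \<Rightarrow> (3 \<Rightarrow> 'f::field) \<Rightarrow> 'f \<times> 'f \<Rightarrow> 'f \<times> 'f" where
  "E_act \<sigma> \<alpha> z = (\<alpha> (t2_index \<sigma>) * fst z, - \<alpha> (t2_index \<sigma>) * snd z)"

abbreviation E_scale :: "'f::field \<Rightarrow> 'f \<times> 'f \<Rightarrow> 'f \<times> 'f" where
  "E_scale \<equiv> prod_scale (*) (*)"

abbreviation VE_tensor :: "('f::field, 'v::ab_group_add) vs \<Rightarrow> 'f \<times> 'f \<Rightarrow> ('f, 'v) vse" where
  "VE_tensor \<equiv> tensor (fun_scale (*)) E_scale"

definition VE_act :: "('f::field \<Rightarrow> 'v::ab_group_add \<Rightarrow> 'v) \<Rightarrow> 3 set \<Rightarrow>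
    (3 \<Rightarrow> 'v \<Rightarrow> 'v) \<Rightarrow> (3 \<Rightarrow> 'f) \<Rightarrow> ('f, 'v) vse \<Rightarrow> ('f, 'v) vse" where
  "VE_act s \<sigma> A \<alpha> = (SOME f.
     Vector_Spaces.linear (fun_scale (*)) (fun_scale (*)) f \<and>
     (\<forall>v z. f (VE_tensor (itensor s \<sigma> v) z) =
        VE_tensor (\<Sum>i\<in>\<sigma>. itensor s \<sigma> (v(i := A i (v i)))) z +
        VE_tensor (itensor s \<sigma> v) (E_act \<sigma> \<alpha> z)))"

text \<open>The coefficient of \<open>a\<^sub>\<sigma>\<close> below is \<open>+\<nu>\<close>.  Together with the factor \<open>- 1\<close> of \<open>eps_a5\<close> this gives
  \<open>- \<nu>\<close> in the bracket, matching \<open>t'\<^bsub>e\<^sup>+,e\<^sup>-\<^esub> = (- 1, 1/2, 1/2)\<close> on \<open>e\<^sup>+\<close> in \<open>\<gg>(S\<^sub>4, S\<^sub>2)\<close>.  With \<open>- \<nu>\<close> the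
  Jacobi identity fails: if \<open>b p q = 1\<close>, take \<open>p \<otimes> p \<otimes> e\<^sup>+\<close>, \<open>q \<otimes> q \<otimes> e\<^sup>-\<close> and \<open>p \<otimes> q \<otimes> e\<^sup>+\<close> for one \<open>\<sigma>\<close>.\<close>

definition tphi_diag :: "('f::field \<Rightarrow> 'v::ab_group_add \<Rightarrow> 'v) \<Rightarrow> ('v \<Rightarrow> 'v \<Rightarrow> 'f) \<Rightarrow> 3 set \<Rightarrow>
    ('f, 'v) vse \<Rightarrow> ('f, 'v) vse \<Rightarrow> (3 \<Rightarrow> 'v \<Rightarrow> 'v) \<times> (3 \<Rightarrow> 'f)" where
  "tphi_diag s b \<sigma> = (SOME f.
     bilinear_map (fun_scale (*)) (fun_scale (*))
       (prod_scale (fun_scale (fun_scale s)) (fun_scale (*))) f \<and>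
     (\<forall>v w. \<forall>\<nu>\<in>{1, - 1}. \<forall>\<nu>'\<in>{1, - 1}.
        f (VE_tensor (itensor s \<sigma> v) (e_sgn \<nu>)) (VE_tensor (itensor s \<sigma> w) (e_sgn \<nu>')) =
          (if \<nu> = - \<nu>'
           then (phi_diag s b \<sigma> (itensor s \<sigma> v) (itensor s \<sigma> w),
                 fun_scale (*) (of_int \<nu> * (\<Prod>i\<in>\<sigma>. b (v i) (w i))) (a_elem \<sigma>))
           else 0)))"

definition tphi_off :: "('f::field \<Rightarrow> 'v::ab_group_add \<Rightarrow> 'v) \<Rightarrow> ('v \<Rightarrow> 'v \<Rightarrow> 'f) \<Rightarrow> 3 set \<Rightarrow> 3 set \<Rightarrow>
    ('f, 'v) vse \<Rightarrow> ('f, 'v) vse \<Rightarrow> ('f, 'v) vse" where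
  "tphi_off s b \<sigma> \<tau> = (SOME f.
     bilinear_map (fun_scale (*)) (fun_scale (*)) (fun_scale (*)) f \<and>
     (\<forall>x\<in>itensor_space s \<sigma>. \<forall>y\<in>itensor_space s \<tau>. \<forall>\<nu>\<in>{1, - 1}. \<forall>\<nu>'\<in>{1, - 1}.
        f (VE_tensor x (e_sgn \<nu>)) (VE_tensor y (e_sgn \<nu>')) =
          (if \<nu> = \<nu>' then VE_tensor (phi_off s b \<sigma> \<tau> x y) (e_sgn (- \<nu>)) else 0)))"

text \<open>All the spaces \<open>\<hat>V(\<sigma>)\<close> are embedded as summands in one type: a triple \<open>(A, \<alpha>, X)\<close> has the
  component \<open>(A, \<alpha>)\<close> in \<open>\<hat>V(\<emptyset>)\<close> and \<open>X \<sigma>\<close> in \<open>\<hat>V(\<sigma>)\<close> for \<open>\<sigma>\<close> nonempty.\<close>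

type_synonym ('f, 'v) a5_elem = "(3 \<Rightarrow> 'v \<Rightarrow> 'v) \<times> (3 \<Rightarrow> 'f) \<times> (3 set \<Rightarrow> ('f, 'v) vse)"

definition a5_scale :: "('f::field \<Rightarrow> 'v::ab_group_add \<Rightarrow> 'v) \<Rightarrow>
    'f \<Rightarrow> ('f, 'v) a5_elem \<Rightarrow> ('f, 'v) a5_elem" where
  "a5_scale s = prod_scale (fun_scale (fun_scale s))
     (prod_scale (fun_scale (*)) (fun_scale (fun_scale (*))))"

definition a5_inj :: "3 set \<Rightarrow> ('f::field, 'v::ab_group_add) vse \<Rightarrow> ('f, 'v) a5_elem" where
  "a5_inj \<sigma> u = (0, 0, \<lambda>\<rho>. if \<rho> = \<sigma> then u else 0)"

definition a5_comp :: "3 set \<Rightarrow> ('f::field, 'v::ab_group_add) a5_elem \<Rightarrow> ('f, 'v) a5_elem" where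
  "a5_comp \<sigma> = (\<lambda>(A, \<alpha>, X). if \<sigma> = {} then (A, \<alpha>, 0) else a5_inj \<sigma> (X \<sigma>))"

definition V_hat :: "('f::field \<Rightarrow> 'v::ab_group_add \<Rightarrow> 'v) \<Rightarrow> ('v \<Rightarrow> 'v \<Rightarrow> 'f) \<Rightarrow> 3 set \<Rightarrow>
    ('f, 'v) a5_elem set" where
  "V_hat s b \<sigma> =
     (if \<sigma> = {} then {(A, \<alpha>, 0) | A \<alpha>. (\<forall>i. A i \<in> sp s b) \<and> \<alpha> \<in> t2}
      else a5_inj \<sigma> ` tensor_space (fun_scale (*)) E_scale (itensor_space s \<sigma>) UNIV)"

definition tphi :: "('f::field \<Rightarrow> 'v::ab_group_add \<Rightarrow> 'v) \<Rightarrow> ('v \<Rightarrow> 'v \<Rightarrow> 'f) \<Rightarrow> 3 set \<Rightarrow> 3 set \<Rightarrow>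
    ('f, 'v) a5_elem \<Rightarrow> ('f, 'v) a5_elem \<Rightarrow> ('f, 'v) a5_elem" where
  "tphi s b \<sigma> \<tau> = (\<lambda>(A, \<alpha>, X) (B, \<beta>, Y).
     if \<sigma> = {} \<and> \<tau> = {} then (\<lambda>i. commutator (A i) (B i), 0, 0)
     else if \<sigma> = {} then a5_inj \<tau> (VE_act s \<tau> A \<alpha> (Y \<tau>))
     else if \<tau> = {} then - a5_inj \<sigma> (VE_act s \<sigma> B \<beta> (X \<sigma>))
     else if \<sigma> = \<tau> then (let (D, \<delta>) = tphi_diag s b \<sigma> (X \<sigma>) (Y \<sigma>) in (D, \<delta>, 0))
     else a5_inj (sym_diff \<sigma> \<tau>) (tphi_off s b \<sigma> \<tau> (X \<sigma>) (Y \<tau>)))"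

definition eps_c3 :: "3 set \<Rightarrow> 3 set \<Rightarrow> 'f::field" where
  "eps_c3 \<sigma> \<tau> = (if \<sigma> = \<tau> \<and> \<sigma> \<noteq> {} then - 2 else 1)"

definition eps_a5 :: "3 set \<Rightarrow> 3 set \<Rightarrow> 'f::field" where
  "eps_a5 \<sigma> \<tau> = (if \<sigma> = \<tau> \<and> \<sigma> \<noteq> {} then eps_c3 \<sigma> \<tau> / 2 else eps_c3 \<sigma> \<tau>)"

definition a5 :: "('f::field \<Rightarrow> 'v::ab_group_add \<Rightarrow> 'v) \<Rightarrow> ('v \<Rightarrow> 'v \<Rightarrow> 'f) \<Rightarrow>
    ('f, ('f, 'v) a5_elem) lie" where
  "a5 s b =
     \<lparr>lie_space = {\<Sum>\<sigma>\<in>S_c3. z \<sigma> | z. \<forall>\<sigma>\<in>S_c3. z \<sigma> \<in> V_hat s b \<sigma>},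
      lie_scale = a5_scale s,
      lie_br = \<lambda>x y. \<Sum>\<sigma>\<in>S_c3. \<Sum>\<tau>\<in>S_c3.
        a5_scale s (eps_a5 \<sigma> \<tau>) (tphi s b \<sigma> \<tau> (a5_comp \<sigma> x) (a5_comp \<tau> y))\<rparr>"

end

(* Both a5 and g(S4, S2) are presented as gl6 modulo scalars.  Divide 6 x 6 matrices into nine
   2 x 2 blocks indexed modulo 3.  The diagonal blocks give sl2^3 and t2, the block (k, k + 1) gives
   the coefficient of e+ and the block (k + 1, k) that of e- for the pair {k, k + 1}.  On the side of
   a5, v (x) w in V_k (x) V_(k+1) is the matrix of x |-> <v|x> w, so that contraction becomes
   multiplication of matrices and their adjoints; on the side of g(S4, S2), S4 is M2(F) and tri(S4)
   is sl2^3 acting by d_i(a) = A_(i+2) a - a A_(i+1).  Any two algebras presented in this way are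
   isomorphic, and type A5 is then a computation with matrix units.  The same table holds for the
   image of g(S4, S2) in g(S8, S2), which gives the inclusion. *)
theory Submission
  imports Defs
begin

section \<open>Linear maps on function and product spaces\<close>

text \<open>In characteristic 3 the scalar 6 x 6 matrices have trace 0, so the traceless matrices
  acquire a centre; gl6 modulo scalars is the model that fits every characteristic other than 2.
  Blocks (k, k + 1) enter through minus their adjoints: then the coefficients of e+ and e- are the
  same module over sl2^3, and e+ e+ -> e- and e- e- -> e+ are both given by
  \<open>mat_bar a ** mat_bar b\<close>, the para-quaternion product. The Jacobi identity is never
  checked in either algebra; it is carried over from matrices. The main obstacle is that the bracket
  of g(S, S') and the maps entering \<open>tphi\<close> are chosen by \<open>SOME\<close> among
  (bi)linear maps on whole function types. Nothing can be computed from such a choice until one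
  admissible map is exhibited. The witnesses come from coordinates: a tensor is a functional on
  bilinear (multilinear) forms, its coordinates are its values at products of coordinate forms, and
  these values are linear in an arbitrary functional, tensor or not. Once a witness exists, the
  specification fixes the chosen map on pure tensors and hence on their span.\<close>

lemma fun_scale_apply: "fun_scale s c x i = s c (x i)"
  by (simp add: fun_scale_def)

lemma sum_fun_apply: "(\<Sum>i\<in>I. f i) x = (\<Sum>i\<in>I. f i x)"
  by (induction I rule: infinite_finite_induct) auto

lemma vector_space_field: "vector_space ((*) :: 'f::field \<Rightarrow> 'f \<Rightarrow> 'f)"
  by unfold_locales (auto simp: algebra_simps)

lemma vector_space_fun_scale:
  assumes "vector_space s"
  shows "vector_space (fun_scale s)"
proof -
  interpret vector_space s by fact
  show ?thesis
    by unfold_locales (auto simp: fun_eq_iff fun_scale_def scale_right_distrib scale_left_distrib)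
qed

lemma vector_space_prod_scale:
  assumes "vector_space s" "vector_space s'"
  shows "vector_space (prod_scale s s')"
proof -
  interpret s: vector_space s by fact
  interpret s': vector_space s' by fact
  show ?thesis
    by unfold_locales (auto simp: prod_scale_def s.scale_right_distrib s.scale_left_distrib
        s'.scale_right_distrib s'.scale_left_distrib)
qed

lemma linearI:
  assumes "vector_space s1" "vector_space s2"
    "\<And>x y. f (x + y) = f x + f y" "\<And>c x. f (s1 c x) = s2 c (f x)"
  shows "Vector_Spaces.linear s1 s2 f"
  using assms by (simp add: Vector_Spaces.linear_iff)

lemma
  assumes "Vector_Spaces.linear s1 s2 f"
  shows linear_addD: "f (x + y) = f x + f y"
    and linear_scaleD: "f (s1 c x) = s2 c (f x)"
    and linear_vs1: "vector_space s1"
    and linear_vs2: "vector_space s2"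
    and linear_zeroD: "f 0 = 0"
    and linear_minusD: "f (- x) = - f x"
    and linear_diffD: "f (x - y) = f x - f y"
    and linear_sumD: "f (sum g I) = (\<Sum>i\<in>I. f (g i))"
proof -
  interpret Vector_Spaces.linear s1 s2 f by fact
  show "f (x + y) = f x + f y" "f (s1 c x) = s2 c (f x)" "f 0 = 0" "f (- x) = - f x"
    "f (x - y) = f x - f y" "f (sum g I) = (\<Sum>i\<in>I. f (g i))"
    by (simp_all add: add scale neg diff sum)
  show "vector_space s1" "vector_space s2" by unfold_locales
qed

lemma linear_comp:
  assumes "Vector_Spaces.linear s1 s2 f" "Vector_Spaces.linear s2 s3 g"
  shows "Vector_Spaces.linear s1 s3 (\<lambda>x. g (f x))"
  using assms by (simp add: Vector_Spaces.linear_iff)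

lemma linear_eq_on_span:
  assumes "Vector_Spaces.linear s1 s2 f" "Vector_Spaces.linear s1 s2 g"
    and "\<And>x. x \<in> B \<Longrightarrow> f x = g x" "x \<in> module.span s1 B"
  shows "f x = g x"
proof -
  interpret f: Vector_Spaces.linear s1 s2 f by fact
  interpret vector_space_pair s1 s2 by unfold_locales
  show ?thesis using assms linear_eq_on by blast
qed

section \<open>Presentations of Lie algebras by matrices modulo scalars\<close>

abbreviation gl_scale :: "'f::field \<Rightarrow> ('n \<Rightarrow> 'n \<Rightarrow> 'f) \<Rightarrow> 'n \<Rightarrow> 'n \<Rightarrow> 'f" where
  "gl_scale \<equiv> fun_scale (fun_scale (*))"

definition gl_mult :: "('n::finite \<Rightarrow> 'n \<Rightarrow> 'f::field) \<Rightarrow> ('n \<Rightarrow> 'n \<Rightarrow> 'f) \<Rightarrow> 'n \<Rightarrow> 'n \<Rightarrow> 'f" where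
  "gl_mult X Y = (\<lambda>i j. \<Sum>k\<in>UNIV. X i k * Y k j)"

definition gl_comm :: "('n::finite \<Rightarrow> 'n \<Rightarrow> 'f::field) \<Rightarrow> ('n \<Rightarrow> 'n \<Rightarrow> 'f) \<Rightarrow> 'n \<Rightarrow> 'n \<Rightarrow> 'f" where
  "gl_comm X Y = gl_mult X Y - gl_mult Y X"

definition gl_scalar :: "'f::field \<Rightarrow> 'n \<Rightarrow> 'n \<Rightarrow> 'f" where
  "gl_scalar c = (\<lambda>i j. if i = j then c else 0)"

definition gl_unit :: "'n \<Rightarrow> 'n \<Rightarrow> 'n \<Rightarrow> 'n \<Rightarrow> 'f::field" where
  "gl_unit a b = (\<lambda>i j. if i = a \<and> j = b then 1 else 0)"

lemma vector_space_gl: "vector_space gl_scale"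
  by (intro vector_space_fun_scale vector_space_field)

lemma gl_mult_assoc: "gl_mult (gl_mult X Y) Z = gl_mult X (gl_mult Y Z)"
proof (intro ext)
  fix i j
  show "gl_mult (gl_mult X Y) Z i j = gl_mult X (gl_mult Y Z) i j"
    by (simp add: gl_mult_def sum_distrib_left sum_distrib_right mult.assoc) (rule sum.swap)
qed

lemma gl_mult_distribs:
  "gl_mult (X + Y) Z = gl_mult X Z + gl_mult Y Z" "gl_mult Z (X + Y) = gl_mult Z X + gl_mult Z Y"
  "gl_mult (X - Y) Z = gl_mult X Z - gl_mult Y Z" "gl_mult Z (X - Y) = gl_mult Z X - gl_mult Z Y"
  by (simp_all add: gl_mult_def fun_eq_iff algebra_simps sum.distrib sum_subtractf)

lemma gl_mult_scale:
  "gl_mult (gl_scale c X) Y = gl_scale c (gl_mult X Y)"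
  "gl_mult X (gl_scale c Y) = gl_scale c (gl_mult X Y)"
  by (simp_all add: gl_mult_def fun_scale_def fun_eq_iff sum_distrib_left mult_ac)

lemma gl_comm_scale:
  "gl_comm (gl_scale c X) Y = gl_scale c (gl_comm X Y)"
  "gl_comm X (gl_scale c Y) = gl_scale c (gl_comm X Y)"
  by (simp_all add: gl_comm_def gl_mult_scale)
    (simp_all add: fun_scale_def fun_eq_iff algebra_simps)

lemma gl_comm_add:
  "gl_comm (X + Y) Z = gl_comm X Z + gl_comm Y Z" "gl_comm Z (X + Y) = gl_comm Z X + gl_comm Z Y"
  by (simp_all add: gl_comm_def gl_mult_distribs)

lemma gl_comm_jacobi:
  "gl_comm (gl_comm X Y) Z + gl_comm (gl_comm Y Z) X + gl_comm (gl_comm Z X) Y = 0"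
  by (simp add: gl_comm_def gl_mult_distribs gl_mult_assoc)

lemma gl_mult_unit_left: "gl_mult (gl_unit a b) X = (\<lambda>i j. if i = a then X b j else 0)"
  by (simp add: gl_mult_def gl_unit_def fun_eq_iff if_distrib[of "\<lambda>x. x * _"] cong: if_cong)

lemma gl_mult_unit_right: "gl_mult X (gl_unit a b) = (\<lambda>i j. if j = b then X i a else 0)"
  by (simp add: gl_mult_def gl_unit_def fun_eq_iff if_distrib[of "\<lambda>x. _ * x"] cong: if_cong)

lemma gl_comm_unit_unit:
  "gl_comm (gl_unit i j) (gl_unit k l) =
     (if j = k then gl_unit i l else 0) - (if l = i then gl_unit k j else 0)"
  by (simp add: gl_comm_def gl_mult_unit_left) (auto simp: gl_unit_def fun_eq_iff)

text \<open>Since the square of \<open>gl_unit j i\<close> is 0, the double commutator equals -2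
  times \<open>gl_unit j i\<close> X \<open>gl_unit j i\<close>, which sees only the entry
  \<open>X i j\<close>. This extracts a matrix unit from an ideal.\<close>

lemma gl_comm_unit_unit_apply:
  fixes X :: "'n::finite \<Rightarrow> 'n \<Rightarrow> 'f::field"
  assumes "i \<noteq> j"
  shows "gl_comm (gl_unit j i) (gl_comm (gl_unit j i) X) = gl_scale (- 2 * X i j) (gl_unit j i)"
  using assms
  by (simp add: gl_comm_def gl_mult_distribs gl_mult_unit_left gl_mult_unit_right fun_eq_iff)
    (auto simp: gl_unit_def fun_scale_def gl_mult_unit_left gl_mult_unit_right)

lemma gl_expand:
  fixes X :: "'n::finite \<Rightarrow> 'n \<Rightarrow> 'f::field"
  shows "X = (\<Sum>i\<in>UNIV. \<Sum>j\<in>UNIV. gl_scale (X i j) (gl_unit i j))"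
proof (intro ext)
  fix k l
  have "(\<Sum>j\<in>UNIV. gl_scale (X i j) (gl_unit i j) k l) = (if k = i then X k l else 0)" for i
    by (simp add: fun_scale_def gl_unit_def if_distrib[of "\<lambda>x. _ * x"] cong: if_cong)
  then show "X k l = (\<Sum>i\<in>UNIV. \<Sum>j\<in>UNIV. gl_scale (X i j) (gl_unit i j)) k l"
    by (simp add: sum_fun_apply)
qed

text \<open>Surjectivity is kept apart: for the inclusion into g(S8, S2) a map whose kernel is
  exactly the scalars suffices. That \<open>L\<close> is a Lie algebra is a conclusion and not an
  assumption.\<close>

locale pgl_map =
  fixes L :: "('f::field, 'l::ab_group_add) lie" and psi :: "('n::finite \<Rightarrow> 'n \<Rightarrow> 'f) \<Rightarrow> 'l"
  assumes linear_psi: "Vector_Spaces.linear gl_scale (lie_scale L) psi"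
    and psi_in: "psi X \<in> lie_space L"
    and psi_comm: "psi (gl_comm X Y) = lie_br L (psi X) (psi Y)"
    and psi_eq_0_iff: "psi X = 0 \<longleftrightarrow> (\<exists>c. X = gl_scalar c)"
begin

sublocale psi: Vector_Spaces.linear gl_scale "lie_scale L" psi
  by (fact linear_psi)

lemma psi_eq_iff: "psi X = psi Y \<longleftrightarrow> (\<exists>c. X - Y = gl_scalar c)"
  using psi_eq_0_iff[of "X - Y"] by (simp add: psi.diff)

end

locale pgl_presentation = pgl_map L psi
  for L :: "('f::field, 'l::ab_group_add) lie" and psi :: "('n::finite \<Rightarrow> 'n \<Rightarrow> 'f) \<Rightarrow> 'l" +
  assumes psi_onto: "x \<in> lie_space L \<Longrightarrow> \<exists>X. x = psi X"
begin

lemma lie_space_eq: "lie_space L = range psi"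
  using psi_in psi_onto by (auto simp: image_iff)

text \<open>Each axiom is the image under \<open>psi\<close> of the corresponding identity for
  commutators of matrices.\<close>

lemma lie_algebra: "lie_algebra L"
  unfolding lie_algebra_def lie_space_eq
proof (intro conjI ballI allI)
  show "vector_space (lie_scale L)" by unfold_locales
  show "module.subspace (lie_scale L) (range psi)"
    by (rule psi.subspace_image) (simp add: psi.vs1.subspace_UNIV)
  fix x y assume xy: "x \<in> range psi" "y \<in> range psi"
  then obtain X Y where X: "x = psi X" "y = psi Y" by blast
  show "lie_br L x y \<in> range psi"
    by (simp add: X flip: psi_comm)
  show "lie_br L x x = 0"
    by (simp add: X flip: psi_comm) (simp add: gl_comm_def psi.zero)
  show "lie_br L (lie_scale L c x) y = lie_scale L c (lie_br L x y)"
    "lie_br L x (lie_scale L c y) = lie_scale L c (lie_br L x y)" for c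
    by (simp_all add: X gl_comm_scale flip: psi_comm psi.scale)
  fix z assume "z \<in> range psi"
  then obtain Z where Z: "z = psi Z" by blast
  show "lie_br L (x + y) z = lie_br L x z + lie_br L y z"
    "lie_br L z (x + y) = lie_br L z x + lie_br L z y"
    by (simp_all add: X Z gl_comm_add flip: psi_comm psi.add)
  show "lie_br L (lie_br L x y) z + lie_br L (lie_br L y z) x + lie_br L (lie_br L z x) y = 0"
    by (simp add: X Z gl_comm_jacobi psi.zero flip: psi_comm psi.add)
qed

text \<open>Both maps have the scalars as kernel, so \<open>psi'\<close> factors through
  \<open>psi\<close> and the factor is injective.\<close>

lemma embedding_exists:
  fixes M :: "('f, 'm::ab_group_add) lie" and psi' :: "('n \<Rightarrow> 'n \<Rightarrow> 'f) \<Rightarrow> 'm"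
  assumes "pgl_map M psi'"
  shows "\<exists>f. lie_embedding f L M \<and> (\<forall>X. f (psi X) = psi' X)"
proof -
  interpret M: pgl_map M psi' by fact
  interpret p: vector_space_pair "gl_scale :: 'f \<Rightarrow> ('n \<Rightarrow> 'n \<Rightarrow> 'f) \<Rightarrow> _" "lie_scale L"
    unfolding vector_space_pair_def using linear_psi by (simp add: Vector_Spaces.linear_iff)
  \<comment> \<open>\<open>lie_embedding\<close> asks for a linear map on the whole type. A right
    inverse of \<open>psi\<close> that is linear everywhere provides one; it depends on choices, but
    two preimages differ by a scalar, which \<open>psi'\<close> kills.\<close>
  obtain g where g: "Vector_Spaces.linear (lie_scale L) gl_scale g" "\<And>x. x \<in> range psi \<Longrightarrow> psi (g x) = x"
    using p.linear_exists_right_inverse_on[OF linear_psi psi.vs1.subspace_UNIV] by auto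
  define f where "f = (\<lambda>x. psi' (g x))"
  have fpsi: "f (psi X) = psi' X" for X
  proof -
    have "psi (g (psi X)) = psi X" by (simp add: g(2))
    then show ?thesis
      unfolding f_def psi_eq_iff M.psi_eq_iff .
  qed
  have "lie_embedding f L M"
    unfolding lie_embedding_def lie_space_eq
  proof (intro conjI ballI)
    show "Vector_Spaces.linear (lie_scale L) (lie_scale M) f"
      unfolding f_def by (rule linear_comp[OF g(1) M.linear_psi])
    show "inj_on f (range psi)"
      by (auto simp: inj_on_def fpsi psi_eq_iff M.psi_eq_iff)
    show "f ` range psi \<subseteq> lie_space M"
      by (auto simp: fpsi M.psi_in)
    fix x y assume "x \<in> range psi" "y \<in> range psi"
    then show "f (lie_br L x y) = lie_br M (f x) (f y)"
      by (auto simp: fpsi M.psi_comm simp flip: psi_comm)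
  qed
  with fpsi show ?thesis by blast
qed

lemma isomorphic:
  fixes M :: "('f, 'm::ab_group_add) lie" and psi' :: "('n \<Rightarrow> 'n \<Rightarrow> 'f) \<Rightarrow> 'm"
  assumes "pgl_presentation M psi'"
  shows "lie_isomorphic L M"
proof -
  interpret M: pgl_presentation M psi' by fact
  obtain f where f: "lie_embedding f L M" "\<And>X. f (psi X) = psi' X"
    using embedding_exists M.pgl_map_axioms by blast
  have "f ` lie_space L = lie_space M"
    by (auto simp: lie_space_eq M.lie_space_eq f(2) image_iff)
  with f(1) show ?thesis unfolding lie_isomorphic_def by blast
qed

end

section \<open>Ideals of the matrix algebra and simplicity modulo scalars\<close>

lemma gl_unit_diff_expand:
  fixes X :: "'n::finite \<Rightarrow> 'n \<Rightarrow> 'f::field"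
  assumes n: "of_nat CARD('n) \<noteq> (0::'f)"
  defines "c \<equiv> inverse (of_nat CARD('n))"
  shows "gl_unit i i = (\<Sum>j\<in>UNIV. gl_scale c (gl_unit i i - gl_unit j j)) + (gl_scalar c :: 'n \<Rightarrow> 'n \<Rightarrow> 'f)"
proof (intro ext)
  fix k l :: 'n
  have *: "(\<Sum>j\<in>UNIV. c * (if k = j \<and> l = j then 1 else 0)) = (if k = l then c else 0)"
  proof (cases "k = l")
    case True
    then show ?thesis by (simp add: if_distrib[of "\<lambda>x. _ * x"] cong: if_cong)
  next
    case False
    then have "(if k = j \<and> l = j then 1 else 0) = (0::'f)" for j by auto
    then show ?thesis using False by (simp only: mult_zero_right sum.neutral_const if_False)
  qed
  show "gl_unit i i k l = ((\<Sum>j\<in>UNIV. gl_scale c (gl_unit i i - gl_unit j j)) + gl_scalar c) k l"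
    using n * unfolding c_def
    by (simp add: sum_fun_apply fun_scale_def gl_unit_def gl_scalar_def right_diff_distrib sum_subtractf)
qed

text \<open>\<open>J\<close> stands for the preimage of an ideal, whence the scalars in it. A
  nonscalar element yields one off-diagonal matrix unit; commutators carry it to all others and to
  the differences of diagonal units, and the scalars supply the remaining direction.\<close>

lemma gl_ideal_eq_UNIV:
  fixes J :: "('n::finite \<Rightarrow> 'n \<Rightarrow> 'f::field) set"
  assumes two: "(2::'f) \<noteq> 0" and n: "of_nat CARD('n) \<noteq> (0::'f)"
    and sub: "module.subspace gl_scale J" and comm: "\<And>X Y. Y \<in> J \<Longrightarrow> gl_comm X Y \<in> J"
    and scalar: "\<And>c. gl_scalar c \<in> J" and X: "X \<in> J" "\<And>c. X \<noteq> gl_scalar c"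
  shows "J = UNIV"
proof -
  interpret vector_space "gl_scale :: 'f \<Rightarrow> ('n \<Rightarrow> 'n \<Rightarrow> 'f) \<Rightarrow> _" by (rule vector_space_gl)
  have comm': "gl_comm Y X \<in> J" if "Y \<in> J" for X Y
  proof -
    have "gl_comm Y X = - gl_comm X Y" by (simp add: gl_comm_def)
    then show ?thesis using subspace_neg[OF sub comm[OF that]] by simp
  qed
  have cancel: "Y \<in> J" if "gl_scale c Y \<in> J" "c \<noteq> 0" for c Y
    using subspace_scale[OF sub that(1), of "inverse c"] that(2) by simp
  have offdiag: "gl_unit j i \<in> J" if "Y \<in> J" "i \<noteq> j" "Y i j \<noteq> 0" for Y i j
  proof -
    have "gl_comm (gl_unit j i) (gl_comm (gl_unit j i) Y) \<in> J"
      using that(1) comm by blast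
    then have "gl_scale (- 2 * Y i j) (gl_unit j i) \<in> J"
      unfolding gl_comm_unit_unit_apply[OF that(2)] .
    then show ?thesis by (rule cancel) (use two that(3) in simp)
  qed
  \<comment> \<open>Either an off-diagonal entry of \<open>X\<close> is nonzero and the double
    commutator applies, or \<open>X\<close> is diagonal with two distinct entries, and its
    commutator with the matching unit is a nonzero multiple of that unit.\<close>
  obtain i j where ij: "i \<noteq> j" "gl_unit i j \<in> J"
  proof (cases "\<exists>i j. i \<noteq> j \<and> X i j \<noteq> 0")
    case True
    then show ?thesis using offdiag X(1) that by metis
  next
    case False
    have "\<exists>i j. X i i \<noteq> X j j"
    proof (rule ccontr)
      assume "\<nexists>i j. X i i \<noteq> X j j"
      then have "X = gl_scalar (X i i)" for i
        using False unfolding gl_scalar_def fun_eq_iff by metis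
      with X(2) show False by blast
    qed
    then obtain i j where ij: "X i i \<noteq> X j j" by blast
    have "gl_comm X (gl_unit i j) = gl_scale (X i i - X j j) (gl_unit i j)"
    proof (intro ext)
      fix k l
      have "k \<noteq> i \<Longrightarrow> X k i = 0" "j \<noteq> l \<Longrightarrow> X j l = 0" using False by blast+
      then show "gl_comm X (gl_unit i j) k l = gl_scale (X i i - X j j) (gl_unit i j) k l"
        by (simp add: gl_comm_def gl_mult_unit_left gl_mult_unit_right)
          (auto simp: gl_unit_def fun_scale_def)
    qed
    with comm'[OF X(1), of "gl_unit i j"] have "gl_scale (X i i - X j j) (gl_unit i j) \<in> J" by simp
    then have "gl_unit i j \<in> J" by (rule cancel) (use ij in simp)
    with ij show ?thesis by (intro that[of i j]) auto
  qed
  \<comment> \<open>The unit has entry 1 at (i, j), so \<open>offdiag\<close> applied to the unit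
    itself returns the transposed one.\<close>
  have flip: "gl_unit j i \<in> J" if "gl_unit i j \<in> J" "i \<noteq> j" for i j
    using offdiag[OF that(1,2)] by (simp add: gl_unit_def)
  have row: "gl_unit i l \<in> J" if "gl_unit i j \<in> J" "l \<noteq> i" for i j l
    using comm'[OF that(1), of "gl_unit j l"] that(2) by (simp add: gl_comm_unit_unit)
  have col: "gl_unit k j \<in> J" if "gl_unit i j \<in> J" "k \<noteq> j" for i j k
    using comm[OF that(1), of "gl_unit k i"] that(2) by (auto simp add: gl_comm_unit_unit)
  have off: "gl_unit k l \<in> J" if "k \<noteq> l" for k l
  proof (cases "k = j")
    case True
    then show ?thesis using row[OF flip[OF ij(2,1)], of l] that by simp
  next
    case False
    then show ?thesis using row[OF col[OF ij(2), of k], of l] that by simp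
  qed
  have dd: "gl_unit k k - gl_unit l l \<in> J" for k l
    using comm[OF off[of l k], of "gl_unit k l"] subspace_0[OF sub]
    by (cases "k = l") (auto simp: gl_comm_unit_unit)
  \<comment> \<open>A diagonal unit is the mean of its differences to all diagonal units plus the
    identity divided by the size; here the size has to be invertible.\<close>
  have diag: "gl_unit k k \<in> J" for k
    by (subst gl_unit_diff_expand[OF n])
      (intro subspace_add[OF sub] subspace_sum[OF sub] subspace_scale[OF sub] dd scalar)
  have "Y \<in> J" for Y
    by (subst gl_expand, intro subspace_sum[OF sub] subspace_scale[OF sub]) (metis off diag)
  then show ?thesis by auto
qed

context pgl_presentation
begin

lemma simple_lie_algebra:
  assumes two: "(2::'f) \<noteq> 0" and n: "of_nat CARD('n) \<noteq> (0::'f)" and n2: "CARD('n) \<ge> 2"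
  shows "simple_lie_algebra L"
  unfolding simple_lie_algebra_def
proof (intro conjI allI impI lie_algebra)
  obtain i j :: 'n where ij: "i \<noteq> j"
    by (metis (full_types) UNIV_I card_2_iff' ex_card n2)
  \<comment> \<open>The matrix has entries 1 and -1 on its diagonal, so it is not scalar in
    characteristic other than 2.\<close>
  have "psi (gl_unit i i - gl_unit j j) \<noteq> 0"
  proof
    assume "psi (gl_unit i i - gl_unit j j) = 0"
    then obtain c where c: "gl_unit i i - gl_unit j j = (gl_scalar c :: 'n \<Rightarrow> 'n \<Rightarrow> 'f)"
      unfolding psi_eq_0_iff by blast
    from fun_cong[OF fun_cong[OF c, of i], of i] fun_cong[OF fun_cong[OF c, of j], of j] ij two
    show False by (simp add: gl_unit_def gl_scalar_def)
  qed
  moreover have "gl_comm (gl_unit i j) (gl_unit j i) = gl_unit i i - (gl_unit j j :: 'n \<Rightarrow> 'n \<Rightarrow> 'f)"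
    by (simp add: gl_comm_unit_unit)
  ultimately have "lie_br L (psi (gl_unit i j)) (psi (gl_unit j i)) \<noteq> 0"
    by (simp flip: psi_comm)
  then show "\<exists>x\<in>lie_space L. \<exists>y\<in>lie_space L. lie_br L x y \<noteq> 0"
    using psi_in by blast
  fix I assume "lie_ideal L I"
  then have sub: "psi.vs2.subspace I" and sp: "I \<subseteq> lie_space L"
    and br: "\<And>x y. x \<in> lie_space L \<Longrightarrow> y \<in> I \<Longrightarrow> lie_br L x y \<in> I"
    by (auto simp: lie_ideal_def)
  show "I = {0} \<or> I = lie_space L"
  proof (cases "I = {0}")
    case False
    define J where "J = {X. psi X \<in> I}"
    obtain x where x: "x \<in> I" "x \<noteq> 0" using False psi.vs2.subspace_0[OF sub] by blast
    then obtain X where X: "x = psi X" using sp psi_onto by blast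
    have "J = UNIV"
    proof (rule gl_ideal_eq_UNIV[OF two n])
      show "module.subspace gl_scale J" unfolding J_def by (rule psi.subspace_linear_preimage[OF sub])
      show "\<And>X Y. Y \<in> J \<Longrightarrow> gl_comm X Y \<in> J" by (simp add: J_def psi_comm br psi_in)
      have "psi (gl_scalar c) = 0" for c unfolding psi_eq_0_iff by blast
      then show "gl_scalar c \<in> J" for c by (simp add: J_def psi.vs2.subspace_0[OF sub])
      show "X \<in> J" using x X by (simp add: J_def)
      show "X \<noteq> gl_scalar c" for c using x X psi_eq_0_iff by blast
    qed
    then show ?thesis using sp lie_space_eq by (auto simp: J_def)
  qed simp
qed

end

subsection \<open>Roots of type A\<close>

text \<open>\<open>rt i j\<close> is the root \<open>\<epsilon>\<^sub>i - \<epsilon>\<^sub>j\<close>, where \<open>\<epsilon>\<^sub>k - \<epsilon>\<^sub>k\<^sub>+\<^sub>1\<close> are the simple roots.\<close>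

definition rt :: "nat \<Rightarrow> nat \<Rightarrow> nat \<Rightarrow> int" where
  "rt i j k = of_bool (i \<le> k) - of_bool (j \<le> k)"

text \<open>The coefficient of \<epsilon>_k for a vector given in simple roots \<epsilon>_k -
  \<epsilon>_(k+1). In these coordinates a root shows as one entry 1 and one entry -1, which makes
  sums and strings of roots easy to test.\<close>

definition eps_coord :: "(nat \<Rightarrow> int) \<Rightarrow> nat \<Rightarrow> int" where
  "eps_coord \<beta> k = \<beta> k - (if k = 0 then 0 else \<beta> (k - 1))"

lemma eps_coord_rt: "eps_coord (rt i j) k = of_bool (k = i) - of_bool (k = j)"
  by (cases k) (auto simp: eps_coord_def rt_def)

lemma eps_coord_add: "eps_coord (\<lambda>j. \<beta> j + \<gamma> j) k = eps_coord \<beta> k + eps_coord \<gamma> k"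
  by (simp add: eps_coord_def)

lemma eps_coord_diff_mult: "eps_coord (\<lambda>j. \<gamma> j - r * \<beta> j) k = eps_coord \<gamma> k - r * eps_coord \<beta> k"
  by (simp add: eps_coord_def algebra_simps)

lemma rt_uminus: "(\<lambda>k. - rt i j k) = rt j i"
  by (simp add: rt_def fun_eq_iff)

lemma unit_vec_eq_rt: "unit_vec i = rt i (Suc i)"
  by (auto simp: unit_vec_def rt_def fun_eq_iff)

definition A_roots :: "nat \<Rightarrow> (nat \<times> nat) set" where
  "A_roots n = {(i, j). i \<le> n \<and> j \<le> n \<and> i \<noteq> j}"

lemma cartan_A_sym: "cartan_A i j = cartan_A j i"
  by (auto simp: cartan_A_def)

lemma pairing_sym: "pairing n cartan_A \<beta> \<kappa> = pairing n cartan_A \<kappa> \<beta>"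
  unfolding pairing_def by (subst sum.swap) (simp add: cartan_A_sym mult_ac)

lemma pairing_unit_vec:
  assumes "i < n"
  shows "pairing n cartan_A (unit_vec i) \<beta> =
    2 * \<beta> i - (if i = 0 then 0 else \<beta> (i - 1)) - (if Suc i < n then \<beta> (Suc i) else 0)"
proof -
  have "pairing n cartan_A (unit_vec i) \<beta> = (\<Sum>k<n. unit_vec i k * (\<Sum>j<n. cartan_A k j * \<beta> j))"
    by (simp add: pairing_def sum_distrib_left mult.assoc)
  also have "\<dots> = (\<Sum>j<n. cartan_A i j * \<beta> j)"
    using assms by (simp add: unit_vec_def if_distrib[of "\<lambda>x. x * _"] cong: if_cong)
  also have "\<dots> = (\<Sum>j<n. (if j = i then 2 * \<beta> j else 0) - (if i \<noteq> 0 \<and> j = i - 1 then \<beta> j else 0)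
      - (if j = Suc i then \<beta> j else 0))"
    by (intro sum.cong refl) (auto simp: cartan_A_def)
  also have "\<dots> = 2 * \<beta> i - (if i = 0 then 0 else \<beta> (i - 1)) - (if Suc i < n then \<beta> (Suc i) else 0)"
    using assms by (simp add: sum_subtractf if_if_eq_conj[symmetric] cong: if_cong) auto
  finally show ?thesis .
qed

lemma pairing_rt:
  assumes "i < n" "a \<le> n" "b \<le> n"
  shows "pairing n cartan_A (unit_vec i) (rt a b) =
    of_bool (i = a) - of_bool (Suc i = a) - of_bool (i = b) + of_bool (Suc i = b)"
  using assms unfolding pairing_unit_vec[OF assms(1)]
  by (cases i) (auto simp: rt_def of_bool_def)

text \<open>The reflection in the simple root i exchanges \<epsilon>_i and \<epsilon>_(i+1), so on
  roots it is a transposition of indices.\<close>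

lemma reflect_rt:
  assumes "i < n" "a \<le> n" "b \<le> n"
  shows "(\<lambda>j. rt a b j - pairing n cartan_A (unit_vec i) (rt a b) * unit_vec i j) =
    rt (Transposition.transpose i (Suc i) a) (Transposition.transpose i (Suc i) b)"
  unfolding pairing_rt[OF assms]
  by (auto simp: fun_eq_iff rt_def unit_vec_def Transposition.transpose_def of_bool_def)

text \<open>The Cartan matrix is symmetric, so a root and its coroot have equal coordinates and one
  predicate \<open>R\<close> covers both. Starting from a simple root, transpositions of neighbours
  push the far index outward one step at a time; both signs are carried along.\<close>

lemma rt_in_root_pairs:
  assumes "(i, j) \<in> A_roots n"
  shows "(rt i j, rt i j) \<in> root_pairs n cartan_A"
proof -
  define R where "R a b \<longleftrightarrow> (rt a b, rt a b) \<in> root_pairs n cartan_A" for a b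
  have reflect: "R (Transposition.transpose i (Suc i) a) (Transposition.transpose i (Suc i) b)"
    if "R a b" "i < n" "a \<le> n" "b \<le> n" for a b i
    using root_pairs.reflect[of "rt a b" "rt a b" n cartan_A i] that
    by (simp add: R_def reflect_rt pairing_sym[of n "rt a b" "unit_vec i"])
  have simple: "R i (Suc i)" if "i < n" for i
    using root_pairs.simple[of i n cartan_A] that by (simp add: R_def unit_vec_eq_rt)
  have simple': "R (Suc i) i" if "i < n" for i
    using reflect[OF simple[OF that] that] that by simp
  have "R i (Suc (i + d)) \<and> R (Suc (i + d)) i" if "i + d < n" for i d
    using that
  proof (induction d)
    case (Suc d)
    then show ?case
      using reflect[of i "Suc (i + d)" "Suc (i + d)"] reflect[of "Suc (i + d)" i "Suc (i + d)"]
      by (simp add: Transposition.transpose_def)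
  qed (simp add: simple simple')
  from this[of i "j - Suc i"] this[of j "i - Suc j"] assms show ?thesis
    by (cases "i < j") (auto simp: A_roots_def R_def)
qed

lemma root_pairs_A: "root_pairs n cartan_A = (\<lambda>(i, j). (rt i j, rt i j)) ` A_roots n"
proof (rule antisym[OF subrelI subsetI])
  fix \<beta> \<kappa> assume "(\<beta>, \<kappa>) \<in> root_pairs n cartan_A"
  then show "(\<beta>, \<kappa>) \<in> (\<lambda>(i, j). (rt i j, rt i j)) ` A_roots n"
  proof (induction rule: root_pairs.induct)
    case (simple i)
    then have "(i, Suc i) \<in> A_roots n" by (simp add: A_roots_def)
    then show ?case unfolding unit_vec_eq_rt by (rule rev_image_eqI) simp
  next
    case (reflect \<beta> \<kappa> i)
    then obtain a b where ab: "\<beta> = rt a b" "\<kappa> = rt a b" "(a, b) \<in> A_roots n" by auto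
    have i: "i < n" by fact
    let ?t = "Transposition.transpose i (Suc i)"
    have "(?t a, ?t b) \<in> A_roots n"
      using ab(3) i by (auto simp: A_roots_def Transposition.transpose_def)
    moreover have "a \<le> n" "b \<le> n" using ab(3) by (auto simp: A_roots_def)
    ultimately show ?case
      unfolding ab(1,2) pairing_sym[of n "rt a b" "unit_vec i"]
      by (intro image_eqI[where x = "(?t a, ?t b)"]) (simp_all only: reflect_rt[OF i] prod.case)
  qed
next
  fix x assume "x \<in> (\<lambda>(i, j). (rt i j, rt i j)) ` A_roots n"
  then show "x \<in> root_pairs n cartan_A" by (auto intro: rt_in_root_pairs)
qed

lemma roots_A: "roots n cartan_A = (\<lambda>(i, j). rt i j) ` A_roots n"
  by (simp add: roots_def root_pairs_A image_image case_prod_unfold)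

definition rt_fst :: "(nat \<Rightarrow> int) \<Rightarrow> nat" where
  "rt_fst \<beta> = (THE k. eps_coord \<beta> k = 1)"

definition rt_snd :: "(nat \<Rightarrow> int) \<Rightarrow> nat" where
  "rt_snd \<beta> = (THE k. eps_coord \<beta> k = - 1)"

lemma rt_fst_rt: "i \<noteq> j \<Longrightarrow> rt_fst (rt i j) = i"
  unfolding rt_fst_def by (rule the_equality) (auto simp: eps_coord_rt of_bool_def split: if_splits)

lemma rt_snd_rt: "i \<noteq> j \<Longrightarrow> rt_snd (rt i j) = j"
  unfolding rt_snd_def by (rule the_equality) (auto simp: eps_coord_rt of_bool_def split: if_splits)

lemma eps_coord_root:
  assumes "\<beta> \<in> roots n cartan_A"
  shows "eps_coord \<beta> k \<in> {- 1, 0, 1}" "eps_coord \<beta> k = 1 \<Longrightarrow> eps_coord \<beta> l = 1 \<Longrightarrow> k = l"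
  using assms by (auto simp: roots_A eps_coord_rt of_bool_def split: if_splits)

text \<open>Read in \<epsilon>-coordinates: one cancellation between the two roots leaves a vector
  \<epsilon>_a - \<epsilon>_b, two cancellations leave 0, and without any the sum has too many or
  too large entries.\<close>

lemma rt_add_root:
  assumes "(i, j) \<in> A_roots n" "(k, l) \<in> A_roots n"
  shows "(\<lambda>m. rt i j m + rt k l m) \<in> roots n cartan_A \<longleftrightarrow> (j = k) \<noteq> (i = l)"
proof
  assume R: "(\<lambda>m. rt i j m + rt k l m) \<in> roots n cartan_A"
  then obtain a b where ab: "(\<lambda>m. rt i j m + rt k l m) = rt a b" "a \<noteq> b"
    by (auto simp: roots_A A_roots_def)
  have eq: "of_bool (m = i) - of_bool (m = j) + (of_bool (m = k) - of_bool (m = l)) =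
      (of_bool (m = a) - of_bool (m = b) :: int)" for m
    using arg_cong[OF ab(1), of "\<lambda>f. eps_coord f m"] unfolding eps_coord_add eps_coord_rt .
  have "\<not> (j = k \<and> i = l)"
    using eq[of a] ab(2) by auto
  moreover have "j = k \<or> i = l"
  proof (rule ccontr)
    assume "\<not> (j = k \<or> i = l)"
    then have "i = a \<and> k = a"
      using eq[of i] eq[of k] assms by (auto simp: A_roots_def of_bool_def split: if_splits)
    then show False
      using eq[of i] \<open>\<not> (j = k \<or> i = l)\<close> assms by (auto simp: A_roots_def of_bool_def split: if_splits)
  qed
  ultimately show "(j = k) \<noteq> (i = l)" by blast
next
  assume "(j = k) \<noteq> (i = l)"
  then have "(\<lambda>m. rt i j m + rt k l m) = (if j = k then rt i l else rt k j)"
    "(if j = k then (i, l) else (k, j)) \<in> A_roots n"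
    using assms by (auto simp: rt_def fun_eq_iff A_roots_def)
  then show "(\<lambda>m. rt i j m + rt k l m) \<in> roots n cartan_A"
    unfolding roots_A by (auto split: if_splits)
qed

text \<open>At the index where the two roots cancel, \<gamma> - r \<beta> has \<epsilon>-coordinate
  1 + r or -(1 + r), while roots allow only -1, 0, 1. Hence all structure constants are 1 or
  -1.\<close>

lemma root_string_A:
  assumes "(i, j) \<in> A_roots n" "(k, l) \<in> A_roots n"
    and "(\<lambda>m. rt i j m + rt k l m) \<in> roots n cartan_A"
  shows "(GREATEST r. (\<lambda>m. rt k l m - int r * rt i j m) \<in> roots n cartan_A) = 0"
proof (rule Greatest_equality)
  show "(\<lambda>m. rt k l m - int 0 * rt i j m) \<in> roots n cartan_A"
    using assms(2) by (auto simp: roots_A)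
  fix r assume R: "(\<lambda>m. rt k l m - int r * rt i j m) \<in> roots n cartan_A"
  have "(j = k) \<noteq> (i = l)" using rt_add_root[OF assms(1,2)] assms(3) by simp
  with eps_coord_root(1)[OF R, of i] eps_coord_root(1)[OF R, of j] assms(1,2)
  show "r \<le> 0"
    unfolding eps_coord_diff_mult by (auto simp: eps_coord_rt A_roots_def of_bool_def split: if_splits)
qed

section \<open>Linear independence and the Chevalley basis of type A\<close>

lemma (in vector_space) independent_family:
  assumes I: "finite I" and ind: "\<And>c. (\<Sum>i\<in>I. scale (c i) (v i)) = 0 \<Longrightarrow> \<forall>i\<in>I. c i = 0"
  shows "inj_on v I" "independent (v ` I)"
proof -
  show inj: "inj_on v I"
  proof (rule inj_onI, rule ccontr)
    fix i j assume ij: "i \<in> I" "j \<in> I" "v i = v j" "i \<noteq> j"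
    define c :: "_ \<Rightarrow> 'a" where "c k = (if k = i then 1 else 0) - (if k = j then 1 else 0)" for k
    have "(\<Sum>k\<in>I. scale (c k) (v k)) =
        (\<Sum>k\<in>I. if k = i then v k else 0) - (\<Sum>k\<in>I. if k = j then v k else 0)"
      unfolding sum_subtractf[symmetric] by (intro sum.cong) (auto simp: c_def)
    also have "\<dots> = 0" using ij I by simp
    finally have "c i = 0" using ind ij(1) by blast
    then show False using ij(4) by (simp add: c_def)
  qed
  show "independent (v ` I)"
  proof
    assume "dependent (v ` I)"
    then obtain u where u: "\<exists>x\<in>v ` I. u x \<noteq> 0" "(\<Sum>x\<in>v ` I. scale (u x) x) = 0"
      using I by (auto simp: dependent_finite)
    from u(2) have "(\<Sum>i\<in>I. scale (u (v i)) (v i)) = 0"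
      by (simp add: sum.reindex[OF inj])
    from ind[OF this] u(1) show False by blast
  qed
qed

text \<open>The basis consists of the images of the off-diagonal matrix units and of the differences
  of neighbouring diagonal ones. Invertibility of n + 1 enters twice: for independence modulo
  scalars and for spanning.\<close>

lemma (in pgl_presentation) chevalley_basis_exists:
  assumes n: "CARD('n) = Suc n" and nz: "of_nat (Suc n) \<noteq> (0::'f)"
  shows "\<exists>h e. chevalley_basis n cartan_A L h e"
proof -
  obtain ix :: "nat \<Rightarrow> 'n" where "bij_betw ix {0..<card (UNIV :: 'n set)} UNIV"
    using ex_bij_betw_nat_finite[OF finite] by blast
  moreover have "{0..<card (UNIV :: 'n set)} = {..n}"
    using n by auto
  ultimately have bij: "bij_betw ix {..n} UNIV"
    by simp
  have ix_eq: "ix i = ix j \<longleftrightarrow> i = j" if "i \<le> n" "j \<le> n" for i j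
    using bij that by (auto simp: bij_betw_def inj_on_def)
  have ix_onto: "\<exists>i\<le>n. p = ix i" for p
    using bij by (auto simp: bij_betw_def image_iff set_eq_iff)
  define E :: "nat \<Rightarrow> nat \<Rightarrow> 'n \<Rightarrow> 'n \<Rightarrow> 'f" where "E i j = gl_unit (ix i) (ix j)" for i j
  define H where "H k = E k k - E (Suc k) (Suc k)" for k
  define h where "h k = psi (H k)" for k
  define e where "e \<beta> = psi (E (rt_fst \<beta>) (rt_snd \<beta>))" for \<beta>
  have e_rt: "e (rt i j) = psi (E i j)" if "i \<noteq> j" for i j
    using that by (simp add: e_def rt_fst_rt rt_snd_rt)
  have comm: "gl_comm (E i j) (E k l) = (if j = k then E i l else 0) - (if l = i then E k j else 0)"
    if "i \<le> n" "j \<le> n" "k \<le> n" "l \<le> n" for i j k l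
    using that by (simp add: E_def gl_comm_unit_unit ix_eq)
  have E_apply: "E i j (ix a) (ix b) = of_bool (i = a \<and> j = b)"
    if "i \<le> n" "j \<le> n" "a \<le> n" "b \<le> n" for i j a b
    using that by (auto simp: E_def gl_unit_def ix_eq)
  have sumH: "(\<Sum>k<n. gl_scale (of_bool (i \<le> k)) (H k)) = E i i - E n n" if "i \<le> n" for i
  proof -
    have "(\<Sum>k<n. gl_scale (of_bool (i \<le> k)) (H k)) = (\<Sum>k\<in>{i..<n}. H k)"
      by (rule sum.mono_neutral_cong_right) (auto simp: fun_scale_def fun_eq_iff)
    also have "\<dots> = - (\<Sum>k\<in>{i..<n}. E (Suc k) (Suc k) - E k k)"
      by (simp add: H_def flip: sum_negf)
    also have "\<dots> = E i i - E n n"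
      using sum_Suc_diff'[OF that, of "\<lambda>k. E k k"] by simp
    finally show ?thesis .
  qed
  have sumH_rt: "(\<Sum>k<n. gl_scale (of_int (rt i j k)) (H k)) = E i i - E j j"
    if "i \<le> n" "j \<le> n" for i j
  proof -
    have "(\<Sum>k<n. gl_scale (of_int (rt i j k)) (H k)) =
      (\<Sum>k<n. gl_scale (of_bool (i \<le> k)) (H k)) -
      (\<Sum>k<n. gl_scale (of_bool (j \<le> k)) (H k))"
      unfolding sum_subtractf[symmetric]
      by (intro sum.cong refl) (simp add: rt_def fun_scale_def fun_eq_iff algebra_simps)
    then show ?thesis
      using that by (simp add: sumH)
  qed
  let ?I = "A_roots n <+> {..<n}"
  let ?v = "case_sum (\<lambda>(i, j). psi (E i j)) h"
  have fin: "finite (A_roots n)"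
    by (rule finite_subset[of _ "{..n} \<times> {..n}"]) (auto simp: A_roots_def)
  then have finI: "finite ?I" by simp
  \<comment> \<open>A linear relation in \<open>L\<close> says only that the matrix \<open>M\<close>
    is a scalar l. Its diagonal entries c_0, c_a - c_(a-1) and finally -c_(n-1) all equal l, so c_a
    = (a + 1) l and (n + 1) l = 0.\<close>
  have "\<forall>i\<in>?I. c i = 0" if zero: "(\<Sum>i\<in>?I. lie_scale L (c i) (?v i)) = 0" for c
  proof -
    define M where "M = (\<Sum>p\<in>A_roots n. gl_scale (c (Inl p)) (E (fst p) (snd p))) +
        (\<Sum>k<n. gl_scale (c (Inr k)) (H k))"
    have "psi M = (\<Sum>i\<in>?I. lie_scale L (c i) (?v i))"
      using fin by (simp add: sum.Plus M_def psi.add psi.sum psi.scale h_def case_prod_unfold)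
    then obtain l where l: "M = gl_scalar l"
      using zero psi_eq_0_iff[of M] by auto
    have M_apply: "M (ix a) (ix b) = (if a \<noteq> b then c (Inl (a, b)) else
        (if a < n then c (Inr a) else 0) - (if a > 0 then c (Inr (a - 1)) else 0))"
      if ab: "a \<le> n" "b \<le> n" for a b
    proof -
      have "(\<Sum>p\<in>A_roots n. gl_scale (c (Inl p)) (E (fst p) (snd p)) (ix a) (ix b)) =
          (\<Sum>p\<in>A_roots n. if p = (a, b) then c (Inl p) else 0)"
        using ab by (intro sum.cong refl) (auto simp: fun_scale_def E_apply A_roots_def)
      then have 1: "(\<Sum>p\<in>A_roots n. gl_scale (c (Inl p)) (E (fst p) (snd p)) (ix a) (ix b)) =
          (if a \<noteq> b then c (Inl (a, b)) else 0)"
        using fin ab by (simp add: A_roots_def)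
      have "(\<Sum>k<n. gl_scale (c (Inr k)) (H k) (ix a) (ix b)) =
          (\<Sum>k<n. (if k = a \<and> a = b then c (Inr k) else 0) - (if 0 < a \<and> k = a - 1 \<and> a = b then c (Inr k) else 0))"
        using ab by (intro sum.cong refl) (auto simp: fun_scale_def H_def E_apply)
      also have "\<dots> = (if a = b then
          (if a < n then c (Inr a) else 0) - (if a > 0 then c (Inr (a - 1)) else 0) else 0)"
        using ab by (cases "a = b"; cases "a = 0") (auto simp: sum_subtractf)
      finally show ?thesis
        using 1 by (simp add: M_def sum_fun_apply)
    qed
    have diag: "(if a < n then c (Inr a) else 0) - (if a > 0 then c (Inr (a - 1)) else 0) = l" if "a \<le> n" for a
      using M_apply[OF that that] by (simp add: l gl_scalar_def)
    have c_l: "c (Inr a) = of_nat (Suc a) * l" if "a < n" for a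
      using that
    proof (induction a)
      case (Suc a)
      then show ?case using diag[of "Suc a"] by (simp add: algebra_simps)
    qed (use diag[of 0] in simp)
    have "of_nat (Suc n) * l = 0"
      using diag[of n] c_l[of "n - 1"] by (cases n) (auto simp: algebra_simps)
    then have "l = 0" using nz by simp
    moreover have "c (Inl (a, b)) = 0" if "(a, b) \<in> A_roots n" for a b
      using M_apply[of a b] that by (auto simp: A_roots_def l gl_scalar_def ix_eq)
    ultimately show ?thesis
      using c_l by auto
  qed
  note ind = psi.vs2.independent_family[where v = ?v, OF finI this]
  have image: "?v ` ?I = h ` {..<n} \<union> e ` roots n cartan_A"
  proof -
    have "e ` roots n cartan_A = (\<lambda>(i, j). psi (E i j)) ` A_roots n"
      unfolding roots_A image_image by (intro image_cong refl) (auto simp: A_roots_def e_rt)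
    then show ?thesis by (auto simp: Plus_def image_Un image_image)
  qed
  let ?S = "psi.vs2.span (h ` {..<n} \<union> e ` roots n cartan_A)"
  have hS: "h k \<in> ?S" if "k < n" for k
    using that by (intro psi.vs2.span_base) auto
  have eS: "psi (E i j) \<in> ?S" if "i \<le> n" "j \<le> n" "i \<noteq> j" for i j
    using that by (intro psi.vs2.span_base UnI2 image_eqI[of _ _ "rt i j"])
      (auto simp: e_rt roots_A A_roots_def)
  have dS: "psi (E i i - E j j) \<in> ?S" if "i \<le> n" "j \<le> n" for i j
    unfolding sumH_rt[OF that, symmetric] psi.sum psi.scale
    using hS by (intro psi.vs2.span_sum psi.vs2.span_scale) (auto simp: h_def)
  have uS: "psi (gl_unit p q) \<in> ?S" for p q
  proof (cases "p = q")
    case True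
    have "psi (gl_unit p p - gl_unit j j) \<in> ?S" for j
      using dS ix_onto[of p] ix_onto[of j] unfolding E_def by blast
    moreover have "psi (gl_scalar c) = 0" for c
      unfolding psi_eq_0_iff by blast
    moreover have "of_nat CARD('n) \<noteq> (0::'f)" unfolding n by (fact nz)
    ultimately have "psi (gl_unit p p) \<in> ?S"
      by (subst gl_unit_diff_expand) (auto simp: psi.add psi.sum psi.scale
        intro!: psi.vs2.span_sum psi.vs2.span_scale)
    then show ?thesis using True by simp
  next
    case False
    then show ?thesis
      using eS ix_onto[of p] ix_onto[of q] unfolding E_def by blast
  qed
  have span: "?S = lie_space L"
  proof
    have "psi.vs2.subspace (lie_space L)"
      unfolding lie_space_eq by (rule psi.subspace_image) (simp add: psi.vs1.subspace_UNIV)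
    then show "?S \<subseteq> lie_space L"
      by (intro psi.vs2.span_minimal) (auto simp: h_def e_def psi_in)
    show "lie_space L \<subseteq> ?S"
    proof
      fix x assume "x \<in> lie_space L"
      then obtain X where X: "x = psi X" using psi_onto by blast
      show "x \<in> ?S"
        unfolding X by (subst gl_expand)
          (auto simp: psi.sum psi.scale intro!: psi.vs2.span_sum psi.vs2.span_scale uS)
    qed
  qed
  \<comment> \<open>The sign of whichever term survives in [e_ij, e_kl], which is e_il if j = k and
    -e_kj if l = i.\<close>
  define N :: "(nat \<Rightarrow> int) \<Rightarrow> (nat \<Rightarrow> int) \<Rightarrow> int"
    where "N \<beta> \<gamma> = (if rt_snd \<beta> = rt_fst \<gamma> then 1 else - 1)" for \<beta> \<gamma>
  have br_e: "lie_br L (e (rt i j)) (e (rt k l)) = psi ((if j = k then E i l else 0) - (if l = i then E k j else 0))"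
    if "(i, j) \<in> A_roots n" "(k, l) \<in> A_roots n" for i j k l
    using that comm[of i j k l] by (auto simp: A_roots_def e_rt simp flip: psi_comm)
  have "chevalley_basis n cartan_A L h e"
    unfolding chevalley_basis_def
  proof (intro conjI)
    have "inj_on (?v \<circ> Inr) {..<n}"
      by (rule comp_inj_on) (auto intro: inj_on_subset[OF ind(1)])
    then show "inj_on h {..<n}" by (simp add: comp_def)
    have e_v: "e (rt i j) = ?v (Inl (i, j))" if "(i, j) \<in> A_roots n" for i j
      using that by (simp add: e_rt A_roots_def)
    show "inj_on e (roots n cartan_A)"
    proof (rule inj_onI)
      fix \<beta> \<gamma> assume "\<beta> \<in> roots n cartan_A" "\<gamma> \<in> roots n cartan_A" "e \<beta> = e \<gamma>"
      then obtain i j k l where ijkl: "\<beta> = rt i j" "\<gamma> = rt k l" "(i, j) \<in> A_roots n" "(k, l) \<in> A_roots n"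
        "?v (Inl (i, j)) = ?v (Inl (k, l))"
        by (auto simp: roots_A e_v)
      then show "\<beta> = \<gamma>" using inj_onD[OF ind(1) ijkl(5)] by auto
    qed
    have "h k \<noteq> e (rt i j)" if "(i, j) \<in> A_roots n" "k < n" for i j k
      using inj_onD[OF ind(1), of "Inr k" "Inl (i, j)"] that e_v by auto
    then show "h ` {..<n} \<inter> e ` roots n cartan_A = {}"
      by (auto simp: roots_A)
    show "\<not> psi.vs2.dependent (h ` {..<n} \<union> e ` roots n cartan_A)"
      using ind(2) unfolding image .
    show "?S = lie_space L" by (fact span)
    have "gl_comm (H i) (H j) = 0" if "i < n" "j < n" for i j
    proof -
      have "gl_comm (X - Y) Z = gl_comm X Z - gl_comm Y Z" "gl_comm Z (X - Y) = gl_comm Z X - gl_comm Z Y"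
        for X Y Z :: "'n \<Rightarrow> 'n \<Rightarrow> 'f"
        by (simp_all add: gl_comm_def gl_mult_distribs)
      then show ?thesis using that by (auto simp: H_def comm)
    qed
    then show "\<forall>i<n. \<forall>j<n. lie_br L (h i) (h j) = 0"
      by (simp add: h_def psi.zero flip: psi_comm)
    have "gl_comm (H k) (E i j) = gl_scale (of_int (pairing n cartan_A (unit_vec k) (rt i j))) (E i j)"
      if "k < n" "i \<le> n" "j \<le> n" "i \<noteq> j" for i j k
    proof -
      have "gl_comm (H k) (E i j) = gl_comm (E k k) (E i j) - gl_comm (E (Suc k) (Suc k)) (E i j)"
        by (simp add: gl_comm_def gl_mult_distribs H_def)
      then show ?thesis
        using that by (auto simp: comm pairing_rt fun_scale_def fun_eq_iff)
    qed
    then show "\<forall>i<n. \<forall>\<beta>\<in>roots n cartan_A. lie_br L (h i) (e \<beta>) =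
        lie_scale L (of_int (pairing n cartan_A (unit_vec i) \<beta>)) (e \<beta>)"
      by (auto simp: h_def roots_A e_rt A_roots_def simp flip: psi_comm psi.scale)
    have "lie_br L (e (rt i j)) (e (rt j i)) = (\<Sum>k<n. lie_scale L (of_int (rt i j k)) (h k))"
      if "(i, j) \<in> A_roots n" for i j
    proof -
      have "(\<Sum>k<n. lie_scale L (of_int (rt i j k)) (h k)) = psi (\<Sum>k<n. gl_scale (of_int (rt i j k)) (H k))"
        by (simp add: psi.sum psi.scale h_def)
      also have "\<dots> = psi (E i i - E j j)"
        using that sumH_rt[of i j] by (simp add: A_roots_def)
      finally show ?thesis
        using that by (subst br_e) (auto simp: A_roots_def)
    qed
    then show "\<forall>(\<beta>, \<kappa>)\<in>root_pairs n cartan_A.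
        lie_br L (e \<beta>) (e (\<lambda>j. - \<beta> j)) = (\<Sum>i<n. lie_scale L (of_int (\<kappa> i)) (h i))"
      by (auto simp: root_pairs_A rt_uminus)
    show "\<forall>\<beta>\<in>roots n cartan_A. \<forall>\<gamma>\<in>roots n cartan_A.
        (\<lambda>j. \<beta> j + \<gamma> j) \<notin> roots n cartan_A \<and> (\<exists>j. \<beta> j + \<gamma> j \<noteq> 0) \<longrightarrow> lie_br L (e \<beta>) (e \<gamma>) = 0"
    proof (intro ballI impI)
      fix \<beta> \<gamma> assume "\<beta> \<in> roots n cartan_A" "\<gamma> \<in> roots n cartan_A"
        and *: "(\<lambda>j. \<beta> j + \<gamma> j) \<notin> roots n cartan_A \<and> (\<exists>j. \<beta> j + \<gamma> j \<noteq> 0)"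
      then obtain i j k l where ijkl: "\<beta> = rt i j" "\<gamma> = rt k l" "(i, j) \<in> A_roots n" "(k, l) \<in> A_roots n"
        by (auto simp: roots_A)
      have "(j = k) = (i = l)" using * rt_add_root[OF ijkl(3,4)] by (simp add: ijkl(1,2))
      moreover have "\<not> (j = k \<and> i = l)" using * by (auto simp: ijkl(1,2) rt_def)
      ultimately show "lie_br L (e \<beta>) (e \<gamma>) = 0"
        unfolding ijkl(1,2) br_e[OF ijkl(3,4)] by (auto simp: psi.zero)
    qed
    show "\<exists>N :: (nat \<Rightarrow> int) \<Rightarrow> (nat \<Rightarrow> int) \<Rightarrow> int. \<forall>\<beta>\<in>roots n cartan_A. \<forall>\<gamma>\<in>roots n cartan_A.
        (\<lambda>j. \<beta> j + \<gamma> j) \<in> roots n cartan_A \<longrightarrow>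
          \<bar>N \<beta> \<gamma>\<bar> = 1 + int (GREATEST r. (\<lambda>j. \<gamma> j - int r * \<beta> j) \<in> roots n cartan_A) \<and>
          N (\<lambda>j. - \<beta> j) (\<lambda>j. - \<gamma> j) = - N \<beta> \<gamma> \<and>
          lie_br L (e \<beta>) (e \<gamma>) = lie_scale L (of_int (N \<beta> \<gamma>)) (e (\<lambda>j. \<beta> j + \<gamma> j))"
    proof (intro exI[of _ N] ballI impI)
      fix \<beta> \<gamma> assume "\<beta> \<in> roots n cartan_A" "\<gamma> \<in> roots n cartan_A"
        and *: "(\<lambda>j. \<beta> j + \<gamma> j) \<in> roots n cartan_A"
      then obtain i j k l where ijkl: "\<beta> = rt i j" "\<gamma> = rt k l" "(i, j) \<in> A_roots n" "(k, l) \<in> A_roots n"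
        by (auto simp: roots_A)
      have ne: "i \<noteq> j" "k \<noteq> l" using ijkl(3,4) by (auto simp: A_roots_def)
      have xor: "(j = k) \<noteq> (i = l)" using * rt_add_root[OF ijkl(3,4)] by (simp add: ijkl(1,2))
      have sum: "(\<lambda>m. rt i j m + rt k l m) = (if j = k then rt i l else rt k j)"
        using xor by (auto simp: rt_def fun_eq_iff)
      have "\<bar>N \<beta> \<gamma>\<bar> = 1 + int (GREATEST r. (\<lambda>j. \<gamma> j - int r * \<beta> j) \<in> roots n cartan_A)"
        using root_string_A[OF ijkl(3,4)] * unfolding ijkl(1,2) by (simp add: N_def)
      moreover have "N (\<lambda>j. - \<beta> j) (\<lambda>j. - \<gamma> j) = - N \<beta> \<gamma>"
        unfolding ijkl(1,2) rt_uminus N_def using ne xor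
        by (simp add: rt_fst_rt rt_snd_rt)
      moreover have "lie_br L (e \<beta>) (e \<gamma>) = lie_scale L (of_int (N \<beta> \<gamma>)) (e (\<lambda>j. \<beta> j + \<gamma> j))"
        unfolding ijkl(1,2) br_e[OF ijkl(3,4)] sum N_def using ne xor
        by (auto simp: rt_fst_rt rt_snd_rt e_rt psi.neg)
      ultimately show "\<bar>N \<beta> \<gamma>\<bar> = 1 + int (GREATEST r. (\<lambda>j. \<gamma> j - int r * \<beta> j) \<in> roots n cartan_A) \<and>
          N (\<lambda>j. - \<beta> j) (\<lambda>j. - \<gamma> j) = - N \<beta> \<gamma> \<and>
          lie_br L (e \<beta>) (e \<gamma>) = lie_scale L (of_int (N \<beta> \<gamma>)) (e (\<lambda>j. \<beta> j + \<gamma> j))"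
        by blast
    qed
  qed
  then show ?thesis by blast
qed

lemma (in pgl_presentation) split_simple_type_A:
  assumes "(2::'f) \<noteq> 0" "CARD('n) = Suc n" "n > 0" "of_nat (Suc n) \<noteq> (0::'f)"
  shows "split_simple_type_A n L"
  unfolding split_simple_type_A_def
  using simple_lie_algebra chevalley_basis_exists[of n] assms by simp

section \<open>Block matrices\<close>

text \<open>Simplification of index sums produces the numerals 3 and 4, which denote 0 and 1 in this
  type.\<close>

lemma three_eq_0: "(3::3) = 0" and four_eq_1: "(4::3) = 1"
  by simp_all

lemma three_cases: "(k::3) = 0 \<or> k = 1 \<or> k = 2"
  using exhaust_3[of k] by auto

lemma three_add:
  "(k::3) + 1 + 1 = k + 2" "k + 1 + 2 = k" "k + 2 + 2 = k + 1" "k + 2 + 1 = k"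
  "k - 1 = k + 2" "k - 2 = k + 1"
  using three_cases[of k] by (auto simp: three_eq_0 four_eq_1)

lemma three_neq:
  "(k::3) + 1 \<noteq> k" "k + 2 \<noteq> k" "k + 1 \<noteq> k + 2" "k \<noteq> k + 1" "k \<noteq> k + 2" "k + 2 \<noteq> k + 1"
  by simp_all

text \<open>The sum may start at any k. Expanding relative to the block under consideration avoids
  splitting into the three values of the index.\<close>

lemma sum_three: "(\<Sum>i\<in>UNIV. f i) = f k + f (k + 1) + (f (k + 2 :: 3) :: 'a::comm_monoid_add)"
  using three_cases[of k] by (auto simp: sum_3 add_ac three_eq_0 four_eq_1)

lemma sum_three_0: "(\<Sum>i\<in>UNIV. f i) = f 0 + f 1 + (f (2::3) :: 'a::comm_monoid_add)"
  using sum_three[of f 0] by simp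

lemma all_three: "(\<forall>i. Q (i::3)) \<longleftrightarrow> Q k \<and> Q (k + 1) \<and> Q (k + 2)"
proof -
  have "i = k \<or> i = k + 1 \<or> i = k + 2" for i
    using three_cases[of i] three_cases[of k] by (auto simp: three_eq_0 four_eq_1)
  then show ?thesis by metis
qed

section \<open>Identities for 2 x 2 matrices and their adjoints\<close>

lemmas mat2_simps = vec_eq_iff forall_2 mat_scale_def mat_bar_def mat_def trace_def sum_2
  matrix_matrix_mult_def

lemma mat_commutator_shift:
  fixes A B :: "'f::field^2^2"
  shows "(A - mat r) ** (B - mat s) - (B - mat s) ** (A - mat r) = A ** B - B ** A"
  by (simp add: mat2_simps algebra_simps)

lemma mat_scale_minus: "mat_scale (- r) A = - mat_scale r A"
  by (simp add: mat2_simps)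

text \<open>The scalar parts removed from two diagonal blocks come back through their half
  difference of traces. With the minus sign the full blocks reappear; with the plus sign there
  remains the trace term that arises when both blocks are replaced by their adjoints, trace minus
  block.\<close>

lemma mat_action_shift:
  fixes A B :: "'f::field^2^2"
  assumes "(2::'f) \<noteq> 0"
  shows "(A - mat (trace A / 2)) ** b - b ** (B - mat (trace B / 2)) +
      mat_scale ((trace B - trace A) / 2) b = A ** b - b ** B + mat_scale (trace B - trace A) b"
    and "(A - mat (trace A / 2)) ** b - b ** (B - mat (trace B / 2)) -
      mat_scale ((trace B - trace A) / 2) b = A ** b - b ** B"
proof -
  have "(A - mat r) ** b - b ** (B - mat s) + mat_scale (s - r) b = A ** b - b ** B + mat_scale (2 * s - 2 * r) b"
    "(A - mat r) ** b - b ** (B - mat s) - mat_scale (s - r) b = A ** b - b ** B" for r s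
    by (simp_all add: mat2_simps algebra_simps)
  from this[of "trace A / 2" "trace B / 2"] show
    "(A - mat (trace A / 2)) ** b - b ** (B - mat (trace B / 2)) +
      mat_scale ((trace B - trace A) / 2) b = A ** b - b ** B + mat_scale (trace B - trace A) b"
    "(A - mat (trace A / 2)) ** b - b ** (B - mat (trace B / 2)) -
      mat_scale ((trace B - trace A) / 2) b = A ** b - b ** B"
    using assms by (simp_all add: diff_divide_distrib)
qed

lemma vector_space_mat_scale: "vector_space (mat_scale :: 'f::field \<Rightarrow> _)"
  by unfold_locales (simp_all add: mat2_simps algebra_simps)

lemma mat_bar_mult: "mat_bar (a ** b) = mat_bar b ** mat_bar (a :: 'f::field^2^2)"
  by (simp add: mat2_simps algebra_simps)

lemma mat_bar_linear:
  "mat_bar (a + b) = mat_bar a + mat_bar b" "mat_bar (a - b) = mat_bar a - mat_bar b"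
  "mat_bar (- a) = - mat_bar a" "mat_bar (mat_scale r a) = mat_scale r (mat_bar a)"
  by (simp_all add: mat2_simps algebra_simps)

lemma mat_mult_bar: "b ** mat_bar x = mat_scale (trace x) b - b ** (x :: 'f::field^2^2)"
  and mat_bar_mult_left: "mat_bar x ** b = mat_scale (trace x) b - x ** b"
  by (simp_all add: mat2_simps algebra_simps)

lemma mat2_minus: "(- a) ** b = - (a ** b)" "a ** (- b) = - (a ** (b :: 'f::field^2^2))"
  "mat_scale r (- a) = - mat_scale r a" "mat_scale (r - s) a = mat_scale r a - mat_scale s a"
  by (simp_all add: mat2_simps algebra_simps)

text \<open>The block (k, k + 1) of a commutator, with k, k + 1, k + 2 written 0, 1, 2, expressed
  through minus the adjoints of the blocks 01. Adjoints of diagonal blocks are rewritten as trace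
  minus block; the path through the third index becomes a product of adjoints in reversed
  order.\<close>

lemma mat_bar_gl_comm_identity:
  fixes x00 :: "'f::field^2^2"
  shows "- mat_bar ((x00 ** y01 - y00 ** x01) + (x01 ** y11 - y01 ** x11) + (x02 ** y21 - y02 ** x21)) =
    (x11 ** (- mat_bar y01) - (- mat_bar y01) ** x00 + mat_scale (trace x00 - trace x11) (- mat_bar y01)) -
    (y11 ** (- mat_bar x01) - (- mat_bar x01) ** y00 + mat_scale (trace y00 - trace y11) (- mat_bar x01)) +
    (mat_bar x21 ** mat_bar y02 - mat_bar y21 ** mat_bar x02)"
  by (simp add: mat_bar_linear mat_bar_mult mat_mult_bar[of _ x00] mat_mult_bar[of _ y00]
      mat_bar_mult_left[of x11] mat_bar_mult_left[of y11] mat2_minus)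

section \<open>The nine blocks of a 6 x 6 matrix\<close>

definition blk :: "(3 \<times> 2 \<Rightarrow> 3 \<times> 2 \<Rightarrow> 'f::field) \<Rightarrow> 3 \<Rightarrow> 3 \<Rightarrow> 'f^2^2" where
  "blk X i j = (\<chi> r s. X (i, r) (j, s))"

lemma blk_linear:
  "blk (X + Y) i j = blk X i j + blk Y i j" "blk (gl_scale c X) i j = mat_scale c (blk X i j)"
  by (simp_all add: blk_def vec_eq_iff mat_scale_def fun_scale_def)

lemma blk_gl_comm:
  fixes X Y :: "3 \<times> 2 \<Rightarrow> 3 \<times> 2 \<Rightarrow> 'f::field"
  shows "blk (gl_comm X Y) i j = (\<Sum>m\<in>UNIV. blk X i m ** blk Y m j - blk Y i m ** blk X m j)"
proof -
  have "(\<Sum>p\<in>UNIV. X (i, r) p * Y p (j, s)) = (\<Sum>m\<in>UNIV. \<Sum>q\<in>UNIV. X (i, r) (m, q) * Y (m, q) (j, s))"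
    for X Y :: "3 \<times> 2 \<Rightarrow> 3 \<times> 2 \<Rightarrow> 'f::field" and r s
    by (simp add: sum.cartesian_product flip: UNIV_Times_UNIV)
  then show ?thesis
    by (simp add: blk_def gl_comm_def gl_mult_def vec_eq_iff matrix_matrix_mult_def sum_subtractf)
qed

lemma gl_eq_iff_blk: "X = Y \<longleftrightarrow> (\<forall>i j. blk X i j = blk Y i j)"
  by (auto simp: blk_def vec_eq_iff fun_eq_iff)

lemma blk_gl_scalar: "blk (gl_scalar c) i j = (if i = j then mat c else 0)"
  by (auto simp: blk_def vec_eq_iff gl_scalar_def mat_def)

definition blk_H :: "(3 \<times> 2 \<Rightarrow> 3 \<times> 2 \<Rightarrow> 'f::field) \<Rightarrow> 3 \<Rightarrow> 'f^2^2" where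
  "blk_H X i = blk X i i - mat (trace (blk X i i) / 2)"

text \<open>The scalar by which the parts removed in \<open>blk_H\<close> act on the block (i + 1, i
  + 2). The three values add up to 0, and they vanish together exactly if all diagonal blocks have
  the same trace.\<close>

definition blk_T :: "(3 \<times> 2 \<Rightarrow> 3 \<times> 2 \<Rightarrow> 'f::field) \<Rightarrow> 3 \<Rightarrow> 'f" where
  "blk_T X i = (trace (blk X (i + 1) (i + 1)) - trace (blk X (i + 2) (i + 2))) / 2"

text \<open>The signs of two upper blocks cancel in (- \<open>mat_bar a\<close>)(-
  \<open>mat_bar b\<close>), which lies in the lower block \<open>N (k + 2)\<close>. For two lower
  blocks the commutator contributes - b a in an upper block, and minus the adjoint of this is again
  \<open>mat_bar a ** mat_bar b\<close>.\<close>

definition blk_P :: "(3 \<times> 2 \<Rightarrow> 3 \<times> 2 \<Rightarrow> 'f::field) \<Rightarrow> 3 \<Rightarrow> 'f^2^2" where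
  "blk_P X k = - mat_bar (blk X k (k + 1))"

definition blk_N :: "(3 \<times> 2 \<Rightarrow> 3 \<times> 2 \<Rightarrow> 'f::field) \<Rightarrow> 3 \<Rightarrow> 'f^2^2" where
  "blk_N X k = blk X (k + 1) k"

text \<open>Traceless parts of the commutator of - \<open>mat_bar a\<close> in block (k, k + 1) with
  c in block (k + 1, k), whose diagonal blocks are - \<open>mat_bar a ** c\<close> and
  \<open>c ** mat_bar a\<close>. \<open>PN_T\<close> is the value of \<open>blk_T\<close> on the
  same commutator.\<close>

definition PN_H :: "3 \<Rightarrow> 'f::field^2^2 \<Rightarrow> 'f^2^2 \<Rightarrow> 3 \<Rightarrow> 'f^2^2" where
  "PN_H k a c = (\<lambda>i. if i = k then mat (trace (mat_bar a ** c) / 2) - mat_bar a ** c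
     else if i = k + 1 then c ** mat_bar a - mat (trace (mat_bar a ** c) / 2) else 0)"

definition PN_T :: "3 \<Rightarrow> 'f::field^2^2 \<Rightarrow> 'f^2^2 \<Rightarrow> 3 \<Rightarrow> 'f" where
  "PN_T k a c = (\<lambda>i. - trace (mat_bar a ** c) * (if i = k - 1 then 1 else - 1 / 2))"

text \<open>\<open>H\<close>, \<open>T\<close>, \<open>P\<close> and \<open>N\<close> parametrize the diagonal, the upper and the lower part of \<open>\<pp>\<gg>\<ll>\<^sub>6\<close>, divided
  into nine \<open>2 \<times> 2\<close> blocks indexed modulo 3: \<open>P k\<close> lives in block \<open>(k, k + 1)\<close> and \<open>N k\<close> in block
  \<open>(k + 1, k)\<close>.\<close>

locale block_table =
  fixes L :: "('f::field, 'l::ab_group_add) lie"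
    and H :: "(3 \<Rightarrow> 'f^2^2) \<Rightarrow> 'l" and T :: "(3 \<Rightarrow> 'f) \<Rightarrow> 'l"
    and P N :: "3 \<Rightarrow> 'f^2^2 \<Rightarrow> 'l"
  assumes two: "(2::'f) \<noteq> 0"
    and linear_H: "Vector_Spaces.linear (fun_scale mat_scale) (lie_scale L) H"
    and linear_T: "Vector_Spaces.linear (fun_scale (*)) (lie_scale L) T"
    and linear_P: "Vector_Spaces.linear mat_scale (lie_scale L) (P k)"
    and linear_N: "Vector_Spaces.linear mat_scale (lie_scale L) (N k)"
    and subspace: "module.subspace (lie_scale L) (lie_space L)"
    and H_in: "(\<forall>i. trace (A i) = 0) \<Longrightarrow> H A \<in> lie_space L"
    and T_in: "\<alpha> \<in> t2 \<Longrightarrow> T \<alpha> \<in> lie_space L"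
    and P_in: "P k a \<in> lie_space L" and N_in: "N k a \<in> lie_space L"
    and table_inj: "(\<forall>i. trace (A i) = 0) \<Longrightarrow> \<alpha> \<in> t2 \<Longrightarrow>
      H A + T \<alpha> + (\<Sum>k\<in>UNIV. P k (f k)) + (\<Sum>k\<in>UNIV. N k (g k)) = 0 \<Longrightarrow>
      A = 0 \<and> \<alpha> = 0 \<and> f = 0 \<and> g = 0"
    and br_add: "x \<in> lie_space L \<Longrightarrow> y \<in> lie_space L \<Longrightarrow> z \<in> lie_space L \<Longrightarrow>
      lie_br L (x + y) z = lie_br L x z + lie_br L y z"
    and br_anti: "x \<in> lie_space L \<Longrightarrow> y \<in> lie_space L \<Longrightarrow> lie_br L x y = - lie_br L y x"
    and br_HH: "(\<forall>i. trace (A i) = 0) \<Longrightarrow> (\<forall>i. trace (B i) = 0) \<Longrightarrow>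
      lie_br L (H A) (H B) = H (\<lambda>i. A i ** B i - B i ** A i)"
    and br_HT: "(\<forall>i. trace (A i) = 0) \<Longrightarrow> \<alpha> \<in> t2 \<Longrightarrow> lie_br L (H A) (T \<alpha>) = 0"
    and br_TT: "\<alpha> \<in> t2 \<Longrightarrow> \<beta> \<in> t2 \<Longrightarrow> lie_br L (T \<alpha>) (T \<beta>) = 0"
    and br_HP: "(\<forall>i. trace (A i) = 0) \<Longrightarrow>
      lie_br L (H A) (P k a) = P k (A (k + 1) ** a - a ** A k)"
    and br_HN: "(\<forall>i. trace (A i) = 0) \<Longrightarrow>
      lie_br L (H A) (N k a) = N k (A (k + 1) ** a - a ** A k)"
    and br_TP: "\<alpha> \<in> t2 \<Longrightarrow> lie_br L (T \<alpha>) (P k a) = P k (mat_scale (\<alpha> (k - 1)) a)"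
    and br_TN: "\<alpha> \<in> t2 \<Longrightarrow> lie_br L (T \<alpha>) (N k a) = N k (mat_scale (- \<alpha> (k - 1)) a)"
    and br_PP: "lie_br L (P k a) (P k b) = 0"
    and br_NN: "lie_br L (N k a) (N k b) = 0"
    and br_PP_Suc: "lie_br L (P k a) (P (k + 1) b) = N (k + 2) (mat_bar a ** mat_bar b)"
    and br_NN_Suc: "lie_br L (N k a) (N (k + 1) b) = P (k + 2) (mat_bar a ** mat_bar b)"
    and br_PN: "lie_br L (P k a) (N k c) = H (PN_H k a c) + T (PN_T k a c)"
    and br_PN_0: "j \<noteq> k \<Longrightarrow> lie_br L (P k a) (N j c) = 0"
begin

sublocale H: Vector_Spaces.linear "fun_scale mat_scale" "lie_scale L" H by (fact linear_H)
sublocale T: Vector_Spaces.linear "fun_scale (*)" "lie_scale L" T by (fact linear_T)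
sublocale P: Vector_Spaces.linear mat_scale "lie_scale L" "P k" for k by (fact linear_P)
sublocale N: Vector_Spaces.linear mat_scale "lie_scale L" "N k" for k by (fact linear_N)

abbreviation br where "br \<equiv> lie_br L"

section \<open>From the table to a homomorphism defined on gl6\<close>

definition PS :: "(3 \<Rightarrow> 'f^2^2) \<Rightarrow> 'l" where "PS a = (\<Sum>k\<in>UNIV. P k (a k))"
definition NS :: "(3 \<Rightarrow> 'f^2^2) \<Rightarrow> 'l" where "NS a = (\<Sum>k\<in>UNIV. N k (a k))"

lemma PS_linear:
  "PS (a + b) = PS a + PS b" "PS (a - b) = PS a - PS b" "PS (- a) = - PS a"
  "PS (\<lambda>k. mat_scale r (a k)) = lie_scale L r (PS a)"
  by (simp_all add: PS_def P.add P.diff P.neg P.scale sum.distrib sum_subtractf sum_negf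
      H.vs2.scale_sum_right)

lemma NS_linear:
  "NS (a + b) = NS a + NS b" "NS (a - b) = NS a - NS b" "NS (- a) = - NS a"
  "NS (\<lambda>k. mat_scale r (a k)) = lie_scale L r (NS a)"
  by (simp_all add: NS_def N.add N.diff N.neg N.scale sum.distrib sum_subtractf sum_negf
      H.vs2.scale_sum_right)

lemma add_in: "x \<in> lie_space L \<Longrightarrow> y \<in> lie_space L \<Longrightarrow> x + y \<in> lie_space L"
  by (rule H.vs2.subspace_add[OF subspace])

lemma PS_in: "PS a \<in> lie_space L" and NS_in: "NS a \<in> lie_space L"
  by (auto simp: PS_def NS_def intro!: H.vs2.subspace_sum[OF subspace] P_in N_in)

lemma br_add_right: "x \<in> lie_space L \<Longrightarrow> y \<in> lie_space L \<Longrightarrow> z \<in> lie_space L \<Longrightarrow>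
    br z (x + y) = br z x + br z y"
proof -
  assume xyz: "x \<in> lie_space L" "y \<in> lie_space L" "z \<in> lie_space L"
  have "br z (x + y) = - br x z - br y z"
    using br_anti[OF xyz(3) add_in[OF xyz(1,2)]] br_add[OF xyz] by simp
  then show ?thesis
    using br_anti[OF xyz(3,1)] br_anti[OF xyz(3,2)] by simp
qed

lemma br_sum3: "(\<And>k. f k \<in> lie_space L) \<Longrightarrow> x \<in> lie_space L \<Longrightarrow>
    br (\<Sum>k\<in>(UNIV::3 set). f k) x = (\<Sum>k\<in>UNIV. br (f k) x)"
  by (simp add: sum_three_0 br_add add_in)

lemma br_sum3_right: "(\<And>k. f k \<in> lie_space L) \<Longrightarrow> x \<in> lie_space L \<Longrightarrow>
    br x (\<Sum>k\<in>(UNIV::3 set). f k) = (\<Sum>k\<in>UNIV. br x (f k))"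
  by (simp add: sum_three_0 br_add_right add_in)

lemma br_H_PS: "(\<forall>i. trace (A i) = 0) \<Longrightarrow> br (H A) (PS b) = PS (\<lambda>k. A (k + 1) ** b k - b k ** A k)"
  by (simp add: PS_def br_sum3_right P_in H_in br_HP)

lemma br_H_NS: "(\<forall>i. trace (A i) = 0) \<Longrightarrow> br (H A) (NS b) = NS (\<lambda>k. A (k + 1) ** b k - b k ** A k)"
  by (simp add: NS_def br_sum3_right N_in H_in br_HN)

lemma br_T_PS: "\<alpha> \<in> t2 \<Longrightarrow> br (T \<alpha>) (PS b) = PS (\<lambda>k. mat_scale (\<alpha> (k - 1)) (b k))"
  by (simp add: PS_def br_sum3_right P_in T_in br_TP del: diff_numeral_special)

lemma br_T_NS: "\<alpha> \<in> t2 \<Longrightarrow> br (T \<alpha>) (NS b) = NS (\<lambda>k. mat_scale (- \<alpha> (k - 1)) (b k))"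
  by (simp add: NS_def br_sum3_right N_in T_in br_TN)

lemma br_PP_pred: "br (P k a) (P (k + 2) b) = - N (k + 1) (mat_bar b ** mat_bar a)"
  using br_PP_Suc[of "k + 2" b a] br_anti[OF P_in[of k a] P_in[of "k + 2" b]] by (simp add: three_add)

lemma br_NN_pred: "br (N k a) (N (k + 2) b) = - P (k + 1) (mat_bar b ** mat_bar a)"
  using br_NN_Suc[of "k + 2" b a] br_anti[OF N_in[of k a] N_in[of "k + 2" b]] by (simp add: three_add)

lemma br_PS_PS: "br (PS a) (PS b) =
    NS (\<lambda>k. mat_bar (a (k + 1)) ** mat_bar (b (k + 2)) - mat_bar (b (k + 1)) ** mat_bar (a (k + 2)))"
proof -
  have "br (P k x) (PS b) = N (k + 2) (mat_bar x ** mat_bar (b (k + 1))) - N (k + 1) (mat_bar (b (k + 2)) ** mat_bar x)"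
    for k x
    unfolding PS_def by (simp add: br_sum3_right P_in sum_three[of _ k] br_PP br_PP_Suc br_PP_pred br_add_right add_in P_in N_in)
  then have "br (PS a) (PS b) = (\<Sum>k\<in>UNIV. N (k + 2) (mat_bar (a k) ** mat_bar (b (k + 1))) -
      N (k + 1) (mat_bar (b (k + 2)) ** mat_bar (a k)))"
    by (subst PS_def) (simp add: br_sum3 P_in PS_in)
  then show ?thesis
    by (simp add: NS_def sum_three_0 three_eq_0 four_eq_1 N.diff)
qed

lemma br_NS_NS: "br (NS a) (NS b) =
    PS (\<lambda>k. mat_bar (a (k + 1)) ** mat_bar (b (k + 2)) - mat_bar (b (k + 1)) ** mat_bar (a (k + 2)))"
proof -
  have "br (N k x) (NS b) = P (k + 2) (mat_bar x ** mat_bar (b (k + 1))) - P (k + 1) (mat_bar (b (k + 2)) ** mat_bar x)"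
    for k x
    unfolding NS_def by (simp add: br_sum3_right N_in sum_three[of _ k] br_NN br_NN_Suc br_NN_pred br_add_right add_in P_in N_in)
  then have "br (NS a) (NS b) = (\<Sum>k\<in>UNIV. P (k + 2) (mat_bar (a k) ** mat_bar (b (k + 1))) -
      P (k + 1) (mat_bar (b (k + 2)) ** mat_bar (a k)))"
    by (subst NS_def) (simp add: br_sum3 N_in NS_in)
  then show ?thesis
    by (simp add: PS_def sum_three_0 three_eq_0 four_eq_1 P.diff)
qed

lemma br_PS_NS: "br (PS a) (NS c) = H (\<Sum>k\<in>UNIV. PN_H k (a k) (c k)) + T (\<Sum>k\<in>UNIV. PN_T k (a k) (c k))"
proof -
  have "br (P k x) (NS c) = H (PN_H k x (c k)) + T (PN_T k x (c k))" for k x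
    unfolding NS_def by (simp add: br_sum3_right P_in N_in sum_three[of _ k] br_PN br_PN_0 br_add_right add_in P_in N_in)
  then show ?thesis
    unfolding PS_def by (simp add: br_sum3 P_in NS_in H.sum T.sum sum.distrib)
qed

definition psi :: "(3 \<times> 2 \<Rightarrow> 3 \<times> 2 \<Rightarrow> 'f) \<Rightarrow> 'l" where
  "psi X = H (blk_H X) + T (blk_T X) + PS (blk_P X) + NS (blk_N X)"

lemma trace_blk_H:
  fixes X :: "3 \<times> 2 \<Rightarrow> 3 \<times> 2 \<Rightarrow> 'f"
  shows "trace (blk_H X i) = 0"
  using two by (simp add: blk_H_def mat2_simps field_simps)

lemma blk_T_in:
  fixes X :: "3 \<times> 2 \<Rightarrow> 3 \<times> 2 \<Rightarrow> 'f"
  shows "blk_T X \<in> t2"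
  by (simp add: blk_T_def t2_def three_eq_0 four_eq_1 flip: add_divide_distrib)

text \<open>Each of the four equations below sorts the blocks of the commutator by the pair of
  components of \<open>X\<close> and \<open>Y\<close> that they come from. After that both sides
  consist of the same brackets of components.\<close>

lemma psi_gl_comm: "psi (gl_comm X Y) = br (psi X) (psi Y)"
proof -
  note in_space = add_in H_in T_in PS_in NS_in trace_blk_H blk_T_in
  have PH: "br (PS a) (H A) = - br (H A) (PS a)" "br (NS a) (H A) = - br (H A) (NS a)"
    if "\<forall>i. trace (A i) = 0" for a A
    by (auto intro!: br_anti in_space that)
  have PT: "br (PS a) (T A) = - br (T A) (PS a)" "br (NS a) (T A) = - br (T A) (NS a)"
    if "A \<in> t2" for a A
    by (auto intro!: br_anti in_space that)
  have TH: "br (T B) (H A) = 0" if "\<forall>i. trace (A i) = 0" "B \<in> t2" for A B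
    using br_anti[of "T B" "H A"] br_HT[OF that] that by (simp add: in_space)
  have NP: "br (NS c) (PS a) = - br (PS a) (NS c)" for a c
    by (intro br_anti in_space)
  have H_eq: "blk_H (gl_comm X Y) = (\<lambda>i. blk_H X i ** blk_H Y i - blk_H Y i ** blk_H X i) +
      (\<Sum>k\<in>UNIV. PN_H k (blk_P X k) (blk_N Y k)) - (\<Sum>k\<in>UNIV. PN_H k (blk_P Y k) (blk_N X k))"
  proof (rule ext)
    fix k
    show "blk_H (gl_comm X Y) k = ((\<lambda>i. blk_H X i ** blk_H Y i - blk_H Y i ** blk_H X i) + (\<Sum>k\<in>UNIV. PN_H k (blk_P X k) (blk_N Y k)) - (\<Sum>k\<in>UNIV. PN_H k (blk_P Y k) (blk_N X k))) k"
      using two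
      by (simp add: blk_H_def blk_gl_comm sum_three[of _ k] sum_fun_apply three_add PN_H_def PN_T_def
          blk_P_def blk_N_def blk_H_def mat_commutator_shift)
        (simp add: mat2_simps algebra_simps add_divide_distrib diff_divide_distrib)
  qed
  have T_eq: "blk_T (gl_comm X Y) =
      (\<Sum>k\<in>UNIV. PN_T k (blk_P X k) (blk_N Y k)) - (\<Sum>k\<in>UNIV. PN_T k (blk_P Y k) (blk_N X k))"
  proof (rule ext)
    fix k
    show "blk_T (gl_comm X Y) k = ((\<Sum>k\<in>UNIV. PN_T k (blk_P X k) (blk_N Y k)) - (\<Sum>k\<in>UNIV. PN_T k (blk_P Y k) (blk_N X k))) k"
      using two
      by (simp add: blk_T_def blk_gl_comm sum_three[of _ k] sum_fun_apply three_add PN_H_def PN_T_def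
          blk_P_def blk_N_def blk_H_def blk_T_def del: diff_divide_distrib)
        (simp add: mat2_simps field_simps)
  qed
  have P_eq: "blk_P (gl_comm X Y) =
      (\<lambda>k. blk_H X (k + 1) ** blk_P Y k - blk_P Y k ** blk_H X k) -
      (\<lambda>k. blk_H Y (k + 1) ** blk_P X k - blk_P X k ** blk_H Y k) +
      (\<lambda>k. mat_scale (blk_T X (k - 1)) (blk_P Y k)) - (\<lambda>k. mat_scale (blk_T Y (k - 1)) (blk_P X k)) +
      (\<lambda>k. mat_bar (blk_N X (k + 1)) ** mat_bar (blk_N Y (k + 2)) -
        mat_bar (blk_N Y (k + 1)) ** mat_bar (blk_N X (k + 2)))"
  proof (rule ext)
    fix k
    \<comment> \<open>Traceless parts and T-part are merged into the full diagonal blocks, the only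
      form in which they occur in the block product.\<close>
    have *: "blk_H X (k + 1) ** blk_P Y k - blk_P Y k ** blk_H X k + mat_scale (blk_T X (k - 1)) (blk_P Y k) =
        blk X (k + 1) (k + 1) ** blk_P Y k - blk_P Y k ** blk X k k +
        mat_scale (trace (blk X k k) - trace (blk X (k + 1) (k + 1))) (blk_P Y k)" for X Y :: "3 \<times> 2 \<Rightarrow> 3 \<times> 2 \<Rightarrow> 'f"
      using mat_action_shift(1)[OF two, of "blk X (k + 1) (k + 1)" "blk_P Y k" "blk X k k"]
      by (simp add: blk_H_def blk_T_def three_add mat_scale_minus)
    let ?b = "mat_bar (blk_N X (k + 1)) ** mat_bar (blk_N Y (k + 2)) -
        mat_bar (blk_N Y (k + 1)) ** mat_bar (blk_N X (k + 2))"
    let ?u = "\<lambda>X Y :: 3 \<times> 2 \<Rightarrow> 3 \<times> 2 \<Rightarrow> 'f. blk_H X (k + 1) ** blk_P Y k - blk_P Y k ** blk_H X k"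
    let ?s = "\<lambda>X Y :: 3 \<times> 2 \<Rightarrow> 3 \<times> 2 \<Rightarrow> 'f. mat_scale (blk_T X (k - 1)) (blk_P Y k)"
    have "blk_P (gl_comm X Y) k = (?u X Y + ?s X Y) - (?u Y X + ?s Y X) + ?b"
      unfolding * by (simp only: blk_P_def blk_N_def blk_gl_comm sum_three[of _ k] three_add
          mat_bar_gl_comm_identity)
    also have "\<dots> = ?u X Y - ?u Y X + ?s X Y - ?s Y X + ?b"
      by (simp add: algebra_simps)
    finally show "blk_P (gl_comm X Y) k = ((\<lambda>k. blk_H X (k + 1) ** blk_P Y k - blk_P Y k ** blk_H X k) - (\<lambda>k. blk_H Y (k + 1) ** blk_P X k - blk_P X k ** blk_H Y k) + (\<lambda>k. mat_scale (blk_T X (k - 1)) (blk_P Y k)) - (\<lambda>k. mat_scale (blk_T Y (k - 1)) (blk_P X k)) + (\<lambda>k. mat_bar (blk_N X (k + 1)) ** mat_bar (blk_N Y (k + 2)) - mat_bar (blk_N Y (k + 1)) ** mat_bar (blk_N X (k + 2)))) k"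
      by simp
  qed
  have N_eq: "blk_N (gl_comm X Y) =
      (\<lambda>k. blk_H X (k + 1) ** blk_N Y k - blk_N Y k ** blk_H X k) -
      (\<lambda>k. blk_H Y (k + 1) ** blk_N X k - blk_N X k ** blk_H Y k) +
      (\<lambda>k. mat_scale (- blk_T X (k - 1)) (blk_N Y k)) - (\<lambda>k. mat_scale (- blk_T Y (k - 1)) (blk_N X k)) +
      (\<lambda>k. mat_bar (blk_P X (k + 1)) ** mat_bar (blk_P Y (k + 2)) -
        mat_bar (blk_P Y (k + 1)) ** mat_bar (blk_P X (k + 2)))"
  proof (rule ext)
    fix k
    have *: "blk_H X (k + 1) ** blk_N Y k - blk_N Y k ** blk_H X k + mat_scale (- blk_T X (k - 1)) (blk_N Y k) =
        blk X (k + 1) (k + 1) ** blk_N Y k - blk_N Y k ** blk X k k" for X Y :: "3 \<times> 2 \<Rightarrow> 3 \<times> 2 \<Rightarrow> 'f"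
      using mat_action_shift(2)[OF two, of "blk X (k + 1) (k + 1)" "blk_N Y k" "blk X k k"]
      by (simp add: blk_H_def blk_T_def three_add mat_scale_minus)
    let ?b = "mat_bar (blk_P X (k + 1)) ** mat_bar (blk_P Y (k + 2)) -
        mat_bar (blk_P Y (k + 1)) ** mat_bar (blk_P X (k + 2))"
    let ?u = "\<lambda>X Y :: 3 \<times> 2 \<Rightarrow> 3 \<times> 2 \<Rightarrow> 'f. blk_H X (k + 1) ** blk_N Y k - blk_N Y k ** blk_H X k"
    let ?s = "\<lambda>X Y :: 3 \<times> 2 \<Rightarrow> 3 \<times> 2 \<Rightarrow> 'f. mat_scale (- blk_T X (k - 1)) (blk_N Y k)"
    have "blk_N (gl_comm X Y) k = (?u X Y + ?s X Y) - (?u Y X + ?s Y X) + ?b"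
      unfolding * by (simp add: blk_gl_comm sum_three[of _ k] three_add blk_P_def blk_N_def)
        (simp add: mat2_simps algebra_simps)
    also have "\<dots> = ?u X Y - ?u Y X + ?s X Y - ?s Y X + ?b"
      by (simp add: algebra_simps)
    finally show "blk_N (gl_comm X Y) k = ((\<lambda>k. blk_H X (k + 1) ** blk_N Y k - blk_N Y k ** blk_H X k) - (\<lambda>k. blk_H Y (k + 1) ** blk_N X k - blk_N X k ** blk_H Y k) + (\<lambda>k. mat_scale (- blk_T X (k - 1)) (blk_N Y k)) - (\<lambda>k. mat_scale (- blk_T Y (k - 1)) (blk_N X k)) + (\<lambda>k. mat_bar (blk_P X (k + 1)) ** mat_bar (blk_P Y (k + 2)) - mat_bar (blk_P Y (k + 1)) ** mat_bar (blk_P X (k + 2)))) k"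
      by simp
  qed
  show ?thesis
    unfolding psi_def H_eq T_eq P_eq N_eq
    by (simp only: br_add br_add_right in_space br_HH br_HT TH br_TT PH PT NP br_H_PS br_H_NS
        br_T_PS br_T_NS br_PS_PS br_NS_NS br_PS_NS H.add H.diff T.add T.diff PS_linear(1,2) NS_linear(1,2)
        not_False_eq_True simp_thms HOL.simp_thms) (simp add: algebra_simps)
qed

lemma psi_eq_0_iff: "psi X = 0 \<longleftrightarrow> (\<exists>c. X = gl_scalar c)"
proof
  assume "psi X = 0"
  then have 0: "blk_H X = 0" "blk_T X = 0" "blk_P X = 0" "blk_N X = 0"
    using table_inj[of "blk_H X" "blk_T X" "blk_P X" "blk_N X"] trace_blk_H blk_T_in
    by (simp_all add: psi_def PS_def NS_def)
  have blk_diag: "blk X i i = mat (trace (blk X i i) / 2)" for i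
    using fun_cong[OF 0(1), of i] by (simp add: blk_H_def)
  have "trace (blk X (i + 1) (i + 1)) = trace (blk X (i + 2) (i + 2))" for i
    using fun_cong[OF 0(2), of i] two by (simp add: blk_T_def)
  from this[of 1] this[of 2] have "trace (blk X i i) = trace (blk X 0 0)" for i
    using three_cases[of i] by (auto simp: three_eq_0 four_eq_1)
  then have "blk X i i = mat (trace (blk X 0 0) / 2)" for i
    using blk_diag[of i] by metis
  moreover have up: "blk X i (i + 1) = 0" for i
    using fun_cong[OF 0(3), of i] by (simp add: blk_P_def) (simp add: mat2_simps)
  have low: "blk X (i + 1) i = 0" for i
    using fun_cong[OF 0(4), of i] by (simp add: blk_N_def)
  have "blk X i (i + 2) = 0" for i
    using low[of "i + 2"] by (simp add: three_add)
  moreover note up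
  moreover define c where "c = trace (blk X 0 0) / 2"
  ultimately have "\<forall>j. blk X i j = blk (gl_scalar c) i j" for i
    unfolding all_three[of _ i] c_def[symmetric] by (simp add: blk_gl_scalar)
  then show "\<exists>c. X = gl_scalar c"
    unfolding gl_eq_iff_blk by blast
next
  assume "\<exists>c. X = gl_scalar c"
  then obtain c where X: "X = gl_scalar c" by blast
  have "blk_H X = 0" "blk_T X = 0" "blk_P X = 0" "blk_N X = 0"
    using two by (auto simp: X fun_eq_iff blk_H_def blk_T_def blk_P_def blk_N_def blk_gl_scalar
        mat2_simps)
  then show "psi X = 0"
    by (simp add: psi_def H.zero T.zero PS_def NS_def P.zero N.zero)
qed

sublocale pgl_map L psi
proof
  show "psi (X + Y) = psi X + psi Y" for X Y :: "3 \<times> 2 \<Rightarrow> 3 \<times> 2 \<Rightarrow> 'f"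
  proof -
    have "blk_H (X + Y) = blk_H X + blk_H Y" "blk_T (X + Y) = blk_T X + blk_T Y"
      "blk_P (X + Y) = blk_P X + blk_P Y" "blk_N (X + Y) = blk_N X + blk_N Y"
      by (simp_all add: fun_eq_iff blk_H_def blk_T_def blk_P_def blk_N_def blk_linear trace_add
        add_divide_distrib diff_divide_distrib) (simp_all add: mat2_simps)
    then show ?thesis by (simp add: psi_def H.add T.add PS_linear NS_linear)
  qed
  show "psi (gl_scale c X) = lie_scale L c (psi X)" for c X
  proof -
    have "blk_H (gl_scale c X) = fun_scale mat_scale c (blk_H X)" "blk_T (gl_scale c X) = fun_scale (*) c (blk_T X)"
      "blk_P (gl_scale c X) = (\<lambda>k. mat_scale c (blk_P X k))" "blk_N (gl_scale c X) = (\<lambda>k. mat_scale c (blk_N X k))"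
      by (simp_all add: fun_eq_iff blk_H_def blk_T_def blk_P_def blk_N_def blk_linear fun_scale_apply)
        (simp_all add: mat2_simps algebra_simps flip: add_divide_distrib diff_divide_distrib)
    then show ?thesis by (simp add: psi_def H.scale T.scale PS_linear NS_linear H.vs2.scale_right_distrib)
  qed
  show "psi X \<in> lie_space L" for X
    by (simp add: psi_def add_in H_in T_in PS_in NS_in trace_blk_H blk_T_in)
qed (simp_all add: psi_gl_comm psi_eq_0_iff vector_space_gl[unfolded vector_space_def])

end
lemma blk_surj: "\<exists>X. \<forall>i j. blk X i j = B i j"
  by (rule exI[of _ "\<lambda>(i, r) (j, s). B i j $ r $ s"]) (simp add: blk_def vec_eq_iff)

lemma blk_components_surj:
  fixes A :: "3 \<Rightarrow> 'f::field^2^2"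
  assumes two: "(2::'f) \<noteq> 0" and A: "\<forall>i. trace (A i) = 0" and \<alpha>: "\<alpha> \<in> t2"
  shows "\<exists>X. blk_H X = A \<and> blk_T X = \<alpha> \<and> blk_P X = f \<and> blk_N X = g"
proof -
  \<comment> \<open>\<open>r i\<close> is half the trace of the diagonal block i. The T-part
    determines these up to a common summand, fixed here by giving block 0 trace 0. There is no
    division by 3, so characteristic 3 is included.\<close>
  define r where "r i = (if i = 0 then 0 else if i = 1 then - \<alpha> 2 else \<alpha> 1)" for i :: 3
  obtain X where X: "\<And>i j. blk X i j =
      (if i = j then A i + mat (r i) else if j = i + 1 then - mat_bar (f i) else g j)"
    using blk_surj[of "\<lambda>i j. if i = j then A i + mat (r i) else if j = i + 1 then - mat_bar (f i) else g j"]
    by blast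
  have tr: "trace (A i + mat (r i)) = 2 * r i" for i
    using A by (simp add: trace_add) (simp add: trace_def mat_def sum_2)
  have "blk_H X = A"
    using two by (simp add: blk_H_def X tr fun_eq_iff)
  moreover have "blk_T X = \<alpha>"
  proof
    fix i
    have *: "\<alpha> 0 = - \<alpha> 2 - \<alpha> 1"
      using \<alpha> unfolding t2_def by (simp add: eq_diff_eq eq_neg_iff_add_eq_0 add_ac)
    have "blk_T X i = r (i + 1) - r (i + 2)"
      using two unfolding blk_T_def X by (simp only: tr if_True refl flip: right_diff_distrib) simp
    moreover have "r 0 = 0" "r 1 = - \<alpha> 2" "r 2 = \<alpha> 1"
      by (simp_all add: r_def)
    ultimately show "blk_T X i = \<alpha> i"
      using three_cases[of i] by (elim disjE) (simp_all add: * three_eq_0 four_eq_1)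
  qed
  moreover have "blk_P X = f"
    by (auto simp: fun_eq_iff blk_P_def X) (simp add: mat2_simps)
  moreover have "blk_N X = g"
    by (auto simp: fun_eq_iff blk_N_def X add.assoc)
  ultimately show ?thesis by blast
qed

lemma (in block_table) psi_components:
  assumes "\<forall>i. trace (A i) = 0" "\<alpha> \<in> t2"
  shows "\<exists>X. blk_H X = A \<and> blk_T X = \<alpha> \<and> blk_P X = f \<and> blk_N X = g \<and> psi X = H A + T \<alpha> + PS f + NS g"
  using blk_components_surj[OF two assms, of f g] by (auto simp: psi_def)

locale block_table_onto = block_table +
  assumes table_onto: "x \<in> lie_space L \<Longrightarrow> \<exists>A \<alpha> f g. (\<forall>i. trace (A i) = 0) \<and> \<alpha> \<in> t2 \<and>
      x = H A + T \<alpha> + (\<Sum>k\<in>UNIV. P k (f k)) + (\<Sum>k\<in>UNIV. N k (g k))"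
begin

sublocale pgl_presentation L psi
proof
  fix x assume "x \<in> lie_space L"
  then show "\<exists>X. x = psi X"
    using table_onto psi_components unfolding PS_def NS_def by metis
qed

end

section \<open>Linear extension from coordinates\<close>

lemma bilinear_mapI:
  assumes "vector_space s1" "vector_space s2" "vector_space s3"
    "\<And>x x' y. f (x + x') y = f x y + f x' y" "\<And>c x y. f (s1 c x) y = s3 c (f x y)"
    "\<And>x y y'. f x (y + y') = f x y + f x y'" "\<And>c x y. f x (s2 c y) = s3 c (f x y)"
  shows "bilinear_map s1 s2 s3 f"
  unfolding bilinear_map_def using assms by (auto intro!: linearI)

lemma
  assumes "bilinear_map s1 s2 s3 f"
  shows bilinear_add_left: "f (x + x') y = f x y + f x' y"
    and bilinear_scale_left: "f (s1 c x) y = s3 c (f x y)"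
    and bilinear_add_right: "f x (y + y') = f x y + f x y'"
    and bilinear_scale_right: "f x (s2 c y) = s3 c (f x y)"
    and bilinear_minus_left: "f (- x) y = - f x y"
    and bilinear_minus_right: "f x (- y) = - f x y"
    and bilinear_zero_left: "f 0 y = 0"
    and bilinear_zero_right: "f x 0 = 0"
    and bilinear_vs: "vector_space s1" "vector_space s2" "vector_space s3"
proof -
  have l: "Vector_Spaces.linear s1 s3 (\<lambda>x. f x y)" for y
    using assms by (simp add: bilinear_map_def)
  have r: "Vector_Spaces.linear s2 s3 (f x)" for x
    using assms by (simp add: bilinear_map_def)
  show "f (x + x') y = f x y + f x' y" "f (s1 c x) y = s3 c (f x y)"
    "f (- x) y = - f x y" "f 0 y = 0"
    using linear_addD[OF l] linear_scaleD[OF l] linear_minusD[OF l] linear_zeroD[OF l] by auto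
  show "f x (y + y') = f x y + f x y'" "f x (s2 c y) = s3 c (f x y)"
    "f x (- y) = - f x y" "f x 0 = 0"
    using linear_addD[OF r] linear_scaleD[OF r] linear_minusD[OF r] linear_zeroD[OF r] by auto
  show "vector_space s1" "vector_space s2" "vector_space s3"
    using linear_vs1[OF l] linear_vs1[OF r] linear_vs2[OF r] by auto
qed

text \<open>The functionals \<open>c\<close> need not determine u. The sum is linear on the whole
  type, as the specifications by \<open>SOME\<close> demand, and is the wanted extension wherever
  \<open>c\<close> does give coordinates.\<close>

definition lin_ext :: "('f \<Rightarrow> 'z \<Rightarrow> 'z::ab_group_add) \<Rightarrow> ('p::finite \<Rightarrow> 'u \<Rightarrow> 'f) \<Rightarrow> ('p \<Rightarrow> 'z) \<Rightarrow> 'u \<Rightarrow> 'z" where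
  "lin_ext s c v u = (\<Sum>p\<in>UNIV. s (c p u) (v p))"

locale coords =
  fixes su :: "'f::field \<Rightarrow> 'u::ab_group_add \<Rightarrow> 'u" and c :: "'p::finite \<Rightarrow> 'u \<Rightarrow> 'f"
  assumes linear_c: "Vector_Spaces.linear su (*) (c p)"
begin

lemma c_simps: "c p (x + y) = c p x + c p y" "c p (su r x) = r * c p x" "c p 0 = 0"
  "c p (- x) = - c p x" "c p (x - y) = c p x - c p y"
  using linear_addD[OF linear_c] linear_scaleD[OF linear_c] linear_zeroD[OF linear_c]
    linear_minusD[OF linear_c] linear_diffD[OF linear_c] by auto

lemma lin_ext_linear: "vector_space s \<Longrightarrow> Vector_Spaces.linear su s (lin_ext s c v)"
proof -
  assume s: "vector_space s"
  interpret s: vector_space s by fact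
  show ?thesis
    by (rule linearI)
      (auto simp: lin_ext_def c_simps s.scale_left_distrib sum.distrib s.scale_sum_right linear_vs1[OF linear_c] s)
qed

lemma lin_ext_linear_values:
  assumes "vector_space s"
  shows "lin_ext s c (\<lambda>p. v p + w p) u = lin_ext s c v u + lin_ext s c w u"
    "lin_ext s c (\<lambda>p. s r (v p)) u = s r (lin_ext s c v u)"
    "lin_ext s c (\<lambda>p. - v p) u = - lin_ext s c v u"
    "lin_ext s c (\<lambda>p. 0) u = 0"
proof -
  interpret s: vector_space s by fact
  show "lin_ext s c (\<lambda>p. v p + w p) u = lin_ext s c v u + lin_ext s c w u"
    "lin_ext s c (\<lambda>p. s r (v p)) u = s r (lin_ext s c v u)"
    "lin_ext s c (\<lambda>p. - v p) u = - lin_ext s c v u"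
    "lin_ext s c (\<lambda>p. 0) u = 0"
    by (simp_all add: lin_ext_def s.scale_right_distrib sum.distrib s.scale_sum_right mult.commute sum_negf)
qed

end

lemma lin_ext_swap:
  assumes "vector_space s"
  shows "lin_ext s c (\<lambda>p. lin_ext s c' (G p) w) u = lin_ext s c' (\<lambda>r. lin_ext s c (\<lambda>p. G p r) u) w"
proof -
  interpret s: vector_space s by fact
  show ?thesis
    unfolding lin_ext_def s.scale_sum_right by (subst sum.swap) (simp add: mult.commute)
qed

lemma lin_ext2_bilinear:
  assumes "coords su c" "coords su' c'" "vector_space s"
  shows "bilinear_map su su' s (\<lambda>u w. lin_ext s c (\<lambda>p. lin_ext s c' (G p) w) u)"
proof -
  interpret c: coords su c by fact
  interpret c': coords su' c' by fact
  note s = assms(3)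
  show ?thesis
    unfolding bilinear_map_def
  proof (intro conjI allI)
    show "Vector_Spaces.linear su s (\<lambda>u. lin_ext s c (\<lambda>p. lin_ext s c' (G p) w) u)" for w
      by (rule c.lin_ext_linear[OF s])
    show "Vector_Spaces.linear su' s (\<lambda>w. lin_ext s c (\<lambda>p. lin_ext s c' (G p) w) u)" for u
      by (subst lin_ext_swap[OF s]) (rule c'.lin_ext_linear[OF s])
  qed
qed

lemma (in coords) lin_ext2_anti:
  assumes s: "vector_space s" and anti: "\<And>p r. G p r = - G r p"
  shows "lin_ext s c (\<lambda>p. lin_ext s c (G p) w) u = - lin_ext s c (\<lambda>p. lin_ext s c (G p) u) w"
proof -
  have "lin_ext s c (\<lambda>p. G p r) u = - lin_ext s c (G r) u" for r
  proof -
    have "(\<lambda>p. G p r) = (\<lambda>p. - G r p)" by (rule ext) (rule anti)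
    then show ?thesis by (simp only: lin_ext_linear_values(3)[OF s])
  qed
  then have eq: "(\<lambda>r. lin_ext s c (\<lambda>p. G p r) u) = (\<lambda>r. - lin_ext s c (G r) u)" by blast
  have "lin_ext s c (\<lambda>p. lin_ext s c (G p) w) u = lin_ext s c (\<lambda>r. lin_ext s c (\<lambda>p. G p r) u) w"
    by (rule lin_ext_swap[OF s])
  also have "\<dots> = - lin_ext s c (\<lambda>p. lin_ext s c (G p) u) w"
    unfolding eq by (rule lin_ext_linear_values(3)[OF s])
  finally show ?thesis .
qed

locale framed_space = vector_space s
  for s :: "'f::field \<Rightarrow> 'a::ab_group_add \<Rightarrow> 'a" +
  fixes fr :: "'k::finite \<Rightarrow> 'a" and crd :: "'k \<Rightarrow> 'a \<Rightarrow> 'f"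
  assumes linear_crd: "Vector_Spaces.linear s (*) (crd k)"
    and frame: "(\<Sum>k\<in>UNIV. s (crd k x) (fr k)) = x"
begin

sublocale coords s crd
  by (rule coords.intro) (fact linear_crd)

lemma lin_ext_eq: "Vector_Spaces.linear s s' f \<Longrightarrow> lin_ext s' crd (\<lambda>k. f (fr k)) x = f x"
  using linear_sumD[of s s' f "\<lambda>k. s (crd k x) (fr k)" UNIV] frame[of x]
  by (simp add: lin_ext_def linear_scaleD[of s s' f])

end

text \<open>Evaluation at a product of coordinate forms: linear in every functional u, and on a pure
  tensor the product of the coordinates of its factors.\<close>

definition tensor_crd ::
    "('k \<Rightarrow> 'a \<Rightarrow> 'f::field) \<Rightarrow> ('l \<Rightarrow> 'b \<Rightarrow> 'f) \<Rightarrow> 'k \<times> 'l \<Rightarrow> (('a \<Rightarrow> 'b \<Rightarrow> 'f) \<Rightarrow> 'f) \<Rightarrow> 'f" where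
  "tensor_crd crd crd' p u = u (\<lambda>x y. crd (fst p) x * crd' (snd p) y)"

lemma tensor_bilinear:
  assumes "vector_space s" "vector_space s'"
  shows "bilinear_map s s' (fun_scale (*)) (tensor s s')"
  by (rule bilinear_mapI)
    (auto simp: tensor_def fun_eq_iff fun_scale_def assms vector_space_field vector_space_fun_scale
      bilinear_add_left bilinear_add_right bilinear_scale_left bilinear_scale_right)

locale framed_pair = A: framed_space s fr crd + B: framed_space s' fr' crd'
  for s :: "'f::field \<Rightarrow> 'a::ab_group_add \<Rightarrow> 'a" and fr :: "'k::finite \<Rightarrow> 'a" and crd
  and s' :: "'f \<Rightarrow> 'b::ab_group_add \<Rightarrow> 'b" and fr' :: "'l::finite \<Rightarrow> 'b" and crd'
begin

abbreviation "tns \<equiv> tensor s s'"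
abbreviation "tc \<equiv> tensor_crd crd crd'"

lemma coord_form_bilinear: "bilinear_map s s' (*) (\<lambda>x y. crd k x * crd' l y)"
  by (rule bilinear_mapI)
    (auto simp: A.c_simps B.c_simps algebra_simps vector_space_field A.vector_space_axioms B.vector_space_axioms)

lemma tc_tensor: "tc p (tns a x) = crd (fst p) a * crd' (snd p) x"
  by (simp add: tensor_crd_def tensor_def coord_form_bilinear)

sublocale T: coords "fun_scale (*)" tc
  by (rule coords.intro)
    (auto intro!: linearI simp: tensor_crd_def fun_scale_def vector_space_field vector_space_fun_scale algebra_simps)

lemma lin_ext_tensor:
  assumes "bilinear_map s s' s3 G"
  shows "lin_ext s3 tc (\<lambda>p. G (fr (fst p)) (fr' (snd p))) (tns a x) = G a x"
proof -
  interpret s3: vector_space s3 using bilinear_vs(3)[OF assms] .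
  have "lin_ext s3 tc (\<lambda>p. G (fr (fst p)) (fr' (snd p))) (tns a x) =
      (\<Sum>k\<in>UNIV. \<Sum>l\<in>UNIV. s3 (crd k a * crd' l x) (G (fr k) (fr' l)))"
    by (simp add: lin_ext_def tc_tensor sum.cartesian_product flip: UNIV_Times_UNIV) 
      (simp add: case_prod_unfold)
  also have "\<dots> = (\<Sum>k\<in>UNIV. s3 (crd k a) (\<Sum>l\<in>UNIV. s3 (crd' l x) (G (fr k) (fr' l))))"
    by (simp add: s3.scale_sum_right)
  also have "(\<lambda>k. \<Sum>l\<in>UNIV. s3 (crd' l x) (G (fr k) (fr' l))) = (\<lambda>k. G (fr k) x)"
    using B.lin_ext_eq[of s3 "G _"] assms by (simp add: bilinear_map_def lin_ext_def)
  also have "(\<Sum>k\<in>UNIV. s3 (crd k a) (G (fr k) x)) = G a x"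
    using A.lin_ext_eq[of s3 "\<lambda>a. G a x"] assms by (simp add: bilinear_map_def lin_ext_def)
  finally show ?thesis .
qed

lemma lin_ext_tensor_tensor:
  assumes "\<And>a x. bilinear_map s s' s3 (G a x)" "\<And>b y. bilinear_map s s' s3 (\<lambda>a x. G a x b y)"
  shows "lin_ext s3 tc (\<lambda>p. lin_ext s3 tc (\<lambda>r. G (fr (fst p)) (fr' (snd p)) (fr (fst r)) (fr' (snd r))) (tns b y))
      (tns a x) = G a x b y"
  unfolding lin_ext_tensor[OF assms(1)] by (rule lin_ext_tensor[OF assms(2)])

end
section \<open>Existence of the bracket of \<open>\<gg>(S, S')\<close>\<close>

text \<open>\<open>t_anti\<close> serves the anticommutativity clause in the specification of
  \<open>g_br\<close>: for two elements of the same summand iota_i the polar forms are symmetric, so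
  the sign must come from the triples t.\<close>

locale framed_calg = framed_space "ca_scale S" fr crd
  for S :: "('f::field, 's::ab_group_add) calg" and fr :: "'k::finite \<Rightarrow> 's" and crd +
  assumes bilinear_mult: "bilinear_map (ca_scale S) (ca_scale S) (ca_scale S) (ca_mult S)"
    and bilinear_polar: "bilinear_map (ca_scale S) (ca_scale S) (*) (polar S)"
    and t_anti: "t_elem S x y i z = - t_elem S y x i z"
begin

lemma polar_sym: "polar S x y = polar S y x"
  by (simp add: polar_def add.commute)

lemma t_bilinear: "bilinear_map (ca_scale S) (ca_scale S) (ca_scale S) (\<lambda>x y. t_elem S x y i z)"
  by (rule bilinear_mapI)
    (simp_all add: t_elem_def vector_space_axioms scale_left_distrib scale_right_distrib
      scale_right_diff_distrib mult.commute
      bilinear_add_left[OF bilinear_mult] bilinear_add_right[OF bilinear_mult]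
      bilinear_scale_left[OF bilinear_mult] bilinear_scale_right[OF bilinear_mult]
      bilinear_add_left[OF bilinear_polar] bilinear_add_right[OF bilinear_polar]
      bilinear_scale_left[OF bilinear_polar] bilinear_scale_right[OF bilinear_polar]
      add_divide_distrib)

text \<open>The commutator is not bilinear on arbitrary functions, so it has to be composed with the
  projection \<open>proj_lin\<close> onto the linear ones.\<close>

definition proj_lin :: "('s \<Rightarrow> 's) \<Rightarrow> 's \<Rightarrow> 's" where
  "proj_lin d = lin_ext (ca_scale S) crd (\<lambda>k. d (fr k))"

lemma proj_lin_linear: "Vector_Spaces.linear (ca_scale S) (ca_scale S) (proj_lin d)"
  unfolding proj_lin_def by (rule lin_ext_linear) (fact vector_space_axioms)

lemma proj_lin_id: "Vector_Spaces.linear (ca_scale S) (ca_scale S) d \<Longrightarrow> proj_lin d = d"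
  unfolding proj_lin_def by (rule ext) (rule lin_ext_eq)

lemma proj_lin_simps:
  "proj_lin (d + e) = proj_lin d + proj_lin e" "proj_lin (fun_scale (ca_scale S) r d) = fun_scale (ca_scale S) r (proj_lin d)"
  "proj_lin 0 = 0"
  using lin_ext_linear_values[OF vector_space_axioms]
  by (simp_all add: proj_lin_def fun_eq_iff fun_scale_def)

lemma tri_linear: "d \<in> tri S \<Longrightarrow> Vector_Spaces.linear (ca_scale S) (ca_scale S) (d i)"
  by (simp add: tri_def orth_def)

lemma proj_lin_tri: "d \<in> tri S \<Longrightarrow> proj_lin (d i) = d i"
  by (intro proj_lin_id tri_linear)

lemma commutator_proj_lin_simps:
  "commutator (proj_lin (d + d')) (proj_lin e) = commutator (proj_lin d) (proj_lin e) + commutator (proj_lin d') (proj_lin e)"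
  "commutator (proj_lin (fun_scale (ca_scale S) r d)) (proj_lin e) =
    fun_scale (ca_scale S) r (commutator (proj_lin d) (proj_lin e))"
  "commutator (proj_lin 0) (proj_lin e) = 0" "commutator (proj_lin e) (proj_lin 0) = 0"
  unfolding proj_lin_simps
  by (simp_all add: commutator_def fun_eq_iff fun_scale_def linear_addD[OF proj_lin_linear] linear_scaleD[OF proj_lin_linear]
      linear_zeroD[OF proj_lin_linear] scale_right_diff_distrib)

end

lemma commutator_anti: "commutator f g = - commutator g f"
  by (simp add: commutator_def fun_eq_iff)

locale framed_calg_pair = A: framed_calg S fr crd + B: framed_calg S' fr' crd'
  for S :: "('f::field, 's::ab_group_add) calg" and fr :: "'k::finite \<Rightarrow> 's" and crd
  and S' :: "('f, 't::ab_group_add) calg" and fr' :: "'l::finite \<Rightarrow> 't" and crd'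
begin

sublocale framed_pair "ca_scale S" fr crd "ca_scale S'" fr' crd'
  by unfold_locales

lemma vector_space_functional: "vector_space (fun_scale (*) :: 'f \<Rightarrow> ((('s \<Rightarrow> 't \<Rightarrow> 'f) \<Rightarrow> 'f)) \<Rightarrow> _)"
  by (intro vector_space_fun_scale vector_space_field)

text \<open>The common shape of the tri(S) and tri(S') parts of products inside one summand iota_j.
  \<open>G p r k z\<close> is the k-th entry of the triple for two basis tensors, and the argument i
  - j is the shift by the j-th power of \<theta>.\<close>

definition diag_ext :: "('f \<Rightarrow> 'z \<Rightarrow> 'z) \<Rightarrow> (('k \<times> 'l) \<Rightarrow> ('k \<times> 'l) \<Rightarrow> 3 \<Rightarrow> 'x \<Rightarrow> 'z) \<Rightarrow>
    (3 \<Rightarrow> ('s \<Rightarrow> 't \<Rightarrow> 'f) \<Rightarrow> 'f) \<Rightarrow> (3 \<Rightarrow> ('s \<Rightarrow> 't \<Rightarrow> 'f) \<Rightarrow> 'f) \<Rightarrow> 3 \<Rightarrow> 'x \<Rightarrow> 'z::ab_group_add" where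
  "diag_ext s3 G u w =
    (\<lambda>i z. \<Sum>j\<in>UNIV. lin_ext s3 tc (\<lambda>p. lin_ext s3 tc (\<lambda>r. G p r (i - j) z) (w j)) (u j))"

definition br_d :: "(3 \<Rightarrow> ('s \<Rightarrow> 't \<Rightarrow> 'f) \<Rightarrow> 'f) \<Rightarrow> (3 \<Rightarrow> ('s \<Rightarrow> 't \<Rightarrow> 'f) \<Rightarrow> 'f) \<Rightarrow> 3 \<Rightarrow> 's \<Rightarrow> 's" where
  "br_d = diag_ext (ca_scale S) (\<lambda>p r k z.
     ca_scale S (polar S' (fr' (snd p)) (fr' (snd r))) (t_elem S (fr (fst p)) (fr (fst r)) k z))"

definition br_d' :: "(3 \<Rightarrow> ('s \<Rightarrow> 't \<Rightarrow> 'f) \<Rightarrow> 'f) \<Rightarrow> (3 \<Rightarrow> ('s \<Rightarrow> 't \<Rightarrow> 'f) \<Rightarrow> 'f) \<Rightarrow> 3 \<Rightarrow> 't \<Rightarrow> 't" where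
  "br_d' = diag_ext (ca_scale S') (\<lambda>p r k z.
     ca_scale S' (polar S (fr (fst p)) (fr (fst r))) (t_elem S' (fr' (snd p)) (fr' (snd r)) k z))"

definition act :: "('s \<Rightarrow> 's) \<Rightarrow> (('s \<Rightarrow> 't \<Rightarrow> 'f) \<Rightarrow> 'f) \<Rightarrow> (('s \<Rightarrow> 't \<Rightarrow> 'f) \<Rightarrow> 'f)" where
  "act d w = lin_ext (fun_scale (*)) tc (\<lambda>p. tns (A.proj_lin d (fr (fst p))) (fr' (snd p))) w"

definition act' :: "('t \<Rightarrow> 't) \<Rightarrow> (('s \<Rightarrow> 't \<Rightarrow> 'f) \<Rightarrow> 'f) \<Rightarrow> (('s \<Rightarrow> 't \<Rightarrow> 'f) \<Rightarrow> 'f)" where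
  "act' d w = lin_ext (fun_scale (*)) tc (\<lambda>p. tns (fr (fst p)) (B.proj_lin d (fr' (snd p)))) w"

definition mul :: "(('s \<Rightarrow> 't \<Rightarrow> 'f) \<Rightarrow> 'f) \<Rightarrow> (('s \<Rightarrow> 't \<Rightarrow> 'f) \<Rightarrow> 'f) \<Rightarrow> (('s \<Rightarrow> 't \<Rightarrow> 'f) \<Rightarrow> 'f)" where
  "mul u w = lin_ext (fun_scale (*)) tc (\<lambda>p. lin_ext (fun_scale (*)) tc (\<lambda>r.
     tns (ca_mult S (fr (fst p)) (fr (fst r))) (ca_mult S' (fr' (snd p)) (fr' (snd r)))) w) u"

text \<open>The witness for the choice in \<open>g_br\<close>. The product of iota_i and iota_(i+1)
  falls into component j = i + 2, that is i = j + 1, which explains the indices j + 1 and j + 2 in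
  the last component.\<close>

definition g_br0 :: "('f, 's, 't) g_elem \<Rightarrow> ('f, 's, 't) g_elem \<Rightarrow> ('f, 's, 't) g_elem" where
  "g_br0 = (\<lambda>(d, d', u) (e, e', w).
     ((\<lambda>i. commutator (A.proj_lin (d i)) (A.proj_lin (e i))) + br_d u w,
      (\<lambda>i. commutator (B.proj_lin (d' i)) (B.proj_lin (e' i))) + br_d' u w,
      \<lambda>j. (act (d j) (w j) - act (e j) (u j)) + (act' (d' j) (w j) - act' (e' j) (u j)) +
        (mul (u (j + 1)) (w (j + 2)) - mul (w (j + 1)) (u (j + 2)))))"

lemma diag_ext_bilinear:
  assumes "vector_space s3"
  shows "bilinear_map (fun_scale (fun_scale (*))) (fun_scale (fun_scale (*))) (fun_scale (fun_scale s3)) (diag_ext s3 G)"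
proof -
  interpret s3: vector_space s3 by fact
  note b = lin_ext2_bilinear[OF T.coords_axioms T.coords_axioms s3.vector_space_axioms]
  show ?thesis
    by (rule bilinear_mapI)
      (auto simp: diag_ext_def fun_eq_iff bilinear_add_left[OF b] bilinear_add_right[OF b] fun_scale_apply
        bilinear_scale_left[OF b] bilinear_scale_right[OF b] sum.distrib s3.scale_sum_right
        intro!: vector_space_fun_scale vector_space_field assms)
qed

lemmas br_d_bilinear = diag_ext_bilinear[OF A.vector_space_axioms, of "\<lambda>p r k z.
     ca_scale S (polar S' (fr' (snd p)) (fr' (snd r))) (t_elem S (fr (fst p)) (fr (fst r)) k z)", folded br_d_def]
lemmas br_d'_bilinear = diag_ext_bilinear[OF B.vector_space_axioms, of "\<lambda>p r k z.
     ca_scale S' (polar S (fr (fst p)) (fr (fst r))) (t_elem S' (fr' (snd p)) (fr' (snd r)) k z)", folded br_d'_def]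

lemma mul_bilinear: "bilinear_map (fun_scale (*)) (fun_scale (*)) (fun_scale (*)) mul"
  using lin_ext2_bilinear[OF T.coords_axioms T.coords_axioms vector_space_functional]
  unfolding mul_def[abs_def] .

lemma diag_ext_anti:
  assumes "vector_space s3" "\<And>p r k z. G p r k z = - G r p k z"
  shows "diag_ext s3 G u w = - diag_ext s3 G w u"
  unfolding diag_ext_def
  by (intro ext) (subst T.lin_ext2_anti[OF assms], simp add: sum_negf)

lemma br_d_anti: "br_d u w = - br_d w u"
  unfolding br_d_def
  by (rule diag_ext_anti[OF A.vector_space_axioms]) (metis A.t_anti B.polar_sym A.scale_minus_right)

lemma br_d'_anti: "br_d' u w = - br_d' w u"
  unfolding br_d'_def
  by (rule diag_ext_anti[OF B.vector_space_axioms]) (metis B.t_anti A.polar_sym B.scale_minus_right)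

lemma act_linear: "Vector_Spaces.linear (fun_scale (*)) (fun_scale (*)) (act d)"
  unfolding act_def[abs_def] by (rule T.lin_ext_linear[OF vector_space_functional])

lemma act'_linear: "Vector_Spaces.linear (fun_scale (*)) (fun_scale (*)) (act' d)"
  unfolding act'_def[abs_def] by (rule T.lin_ext_linear[OF vector_space_functional])

lemmas tns_bilinear = tensor_bilinear[OF A.vector_space_axioms B.vector_space_axioms]

lemma act_simps: "act (d + e) w = act d w + act e w" "act (fun_scale (ca_scale S) r d) w = fun_scale (*) r (act d w)"
  "act 0 w = 0"
  by (simp_all add: act_def A.proj_lin_simps fun_scale_apply bilinear_add_left[OF tns_bilinear]
      bilinear_scale_left[OF tns_bilinear] bilinear_zero_left[OF tns_bilinear]
      T.lin_ext_linear_values[OF vector_space_functional])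

lemma act'_simps: "act' (d + e) w = act' d w + act' e w" "act' (fun_scale (ca_scale S') r d) w = fun_scale (*) r (act' d w)"
  "act' 0 w = 0"
  by (simp_all add: act'_def B.proj_lin_simps fun_scale_apply bilinear_add_right[OF tns_bilinear]
      bilinear_scale_right[OF tns_bilinear] bilinear_zero_right[OF tns_bilinear]
      T.lin_ext_linear_values[OF vector_space_functional])

lemma act_tensor: "d \<in> tri S \<Longrightarrow> act (d i) (tns a x) = tns (d i a) x"
  unfolding act_def A.proj_lin_tri
  by (rule lin_ext_tensor[of _ "\<lambda>a x. tns (d i a) x"], rule bilinear_mapI)
    (simp_all add: A.vector_space_axioms B.vector_space_axioms vector_space_functional
      linear_addD[OF A.tri_linear] linear_scaleD[OF A.tri_linear]
      bilinear_add_left[OF tns_bilinear] bilinear_add_right[OF tns_bilinear]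
      bilinear_scale_left[OF tns_bilinear] bilinear_scale_right[OF tns_bilinear])

lemma act'_tensor: "d \<in> tri S' \<Longrightarrow> act' (d i) (tns a x) = tns a (d i x)"
  unfolding act'_def B.proj_lin_tri
  by (rule lin_ext_tensor[of _ "\<lambda>a x. tns a (d i x)"], rule bilinear_mapI)
    (simp_all add: A.vector_space_axioms B.vector_space_axioms vector_space_functional
      linear_addD[OF B.tri_linear] linear_scaleD[OF B.tri_linear]
      bilinear_add_left[OF tns_bilinear] bilinear_add_right[OF tns_bilinear]
      bilinear_scale_left[OF tns_bilinear] bilinear_scale_right[OF tns_bilinear])

lemma mul_tensor: "mul (tns a x) (tns b y) = tns (ca_mult S a b) (ca_mult S' x y)"
  unfolding mul_def
  by (rule lin_ext_tensor_tensor[of _ "\<lambda>a x b y. tns (ca_mult S a b) (ca_mult S' x y)"]; rule bilinear_mapI)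
    (simp_all add: A.vector_space_axioms B.vector_space_axioms vector_space_functional
      bilinear_add_left[OF A.bilinear_mult] bilinear_add_right[OF A.bilinear_mult]
      bilinear_scale_left[OF A.bilinear_mult] bilinear_scale_right[OF A.bilinear_mult]
      bilinear_add_left[OF B.bilinear_mult] bilinear_add_right[OF B.bilinear_mult]
      bilinear_scale_left[OF B.bilinear_mult] bilinear_scale_right[OF B.bilinear_mult]
      bilinear_add_left[OF tns_bilinear] bilinear_add_right[OF tns_bilinear]
      bilinear_scale_left[OF tns_bilinear] bilinear_scale_right[OF tns_bilinear])

lemma br_d_tensor: "lin_ext (ca_scale S) tc (\<lambda>p. lin_ext (ca_scale S) tc (\<lambda>r.
     ca_scale S (polar S' (fr' (snd p)) (fr' (snd r))) (t_elem S (fr (fst p)) (fr (fst r)) k z)) (tns b y)) (tns a x) =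
   ca_scale S (polar S' x y) (t_elem S a b k z)"
  by (rule lin_ext_tensor_tensor[of _ "\<lambda>a x b y. ca_scale S (polar S' x y) (t_elem S a b k z)"]; rule bilinear_mapI)
    (simp_all add: A.vector_space_axioms B.vector_space_axioms A.scale_left_distrib A.scale_right_distrib
      mult.commute bilinear_add_left[OF A.t_bilinear] bilinear_add_right[OF A.t_bilinear]
      bilinear_scale_left[OF A.t_bilinear] bilinear_scale_right[OF A.t_bilinear]
      bilinear_add_left[OF B.bilinear_polar] bilinear_add_right[OF B.bilinear_polar]
      bilinear_scale_left[OF B.bilinear_polar] bilinear_scale_right[OF B.bilinear_polar])

lemma br_d'_tensor: "lin_ext (ca_scale S') tc (\<lambda>p. lin_ext (ca_scale S') tc (\<lambda>r.
     ca_scale S' (polar S (fr (fst p)) (fr (fst r))) (t_elem S' (fr' (snd p)) (fr' (snd r)) k z)) (tns b y)) (tns a x) =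
   ca_scale S' (polar S a b) (t_elem S' x y k z)"
  by (rule lin_ext_tensor_tensor[of _ "\<lambda>a x b y. ca_scale S' (polar S a b) (t_elem S' x y k z)"]; rule bilinear_mapI)
    (simp_all add: A.vector_space_axioms B.vector_space_axioms B.scale_left_distrib B.scale_right_distrib
      mult.commute bilinear_add_left[OF B.t_bilinear] bilinear_add_right[OF B.t_bilinear]
      bilinear_scale_left[OF B.t_bilinear] bilinear_scale_right[OF B.t_bilinear]
      bilinear_add_left[OF A.bilinear_polar] bilinear_add_right[OF A.bilinear_polar]
      bilinear_scale_left[OF A.bilinear_polar] bilinear_scale_right[OF A.bilinear_polar])

lemma vector_space_g_scale: "vector_space (g_scale S S')"
  unfolding g_scale_def
  by (intro vector_space_prod_scale vector_space_fun_scale vector_space_field A.vector_space_axioms B.vector_space_axioms)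

lemma g_br0_anti: "g_br0 x y = - g_br0 y x"
proof -
  obtain d d' u e e' w where xy: "x = (d, d', u)" "y = (e, e', w)" by (metis surj_pair)
  show ?thesis
    unfolding xy g_br0_def prod.case
    by (subst (1) br_d_anti, subst (1) br_d'_anti)
      (simp add: fun_eq_iff commutator_anti[of "A.proj_lin (d _)"] commutator_anti[of "B.proj_lin (d' _)"])
qed

lemma g_br0_add_left: "g_br0 (x + x') y = g_br0 x y + g_br0 x' y"
proof -
  obtain d d' u f f' v e e' w where xy: "x = (d, d', u)" "x' = (f, f', v)" "y = (e, e', w)" by (metis surj_pair)
  show ?thesis
    by (simp add: xy g_br0_def A.commutator_proj_lin_simps B.commutator_proj_lin_simps act_simps act'_simps
        bilinear_add_left[OF br_d_bilinear] bilinear_add_left[OF br_d'_bilinear]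
        bilinear_add_left[OF mul_bilinear] bilinear_add_right[OF mul_bilinear]
        linear_addD[OF act_linear] linear_addD[OF act'_linear]) (simp add: fun_eq_iff)
qed

lemma g_br0_scale_left: "g_br0 (g_scale S S' r x) y = g_scale S S' r (g_br0 x y)"
proof -
  obtain d d' u e e' w where xy: "x = (d, d', u)" "y = (e, e', w)" by (metis surj_pair)
  interpret fs: vector_space "fun_scale (*) :: 'f \<Rightarrow> (('s \<Rightarrow> 't \<Rightarrow> 'f) \<Rightarrow> 'f) \<Rightarrow> _" by (fact vector_space_functional)
  have 1: "(\<lambda>i. commutator (A.proj_lin (fun_scale (fun_scale (ca_scale S)) r d i)) (A.proj_lin (e i))) =
      fun_scale (fun_scale (ca_scale S)) r (\<lambda>i. commutator (A.proj_lin (d i)) (A.proj_lin (e i)))"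
    by (simp add: fun_eq_iff fun_scale_apply A.commutator_proj_lin_simps)
  have 2: "(\<lambda>i. commutator (B.proj_lin (fun_scale (fun_scale (ca_scale S')) r d' i)) (B.proj_lin (e' i))) =
      fun_scale (fun_scale (ca_scale S')) r (\<lambda>i. commutator (B.proj_lin (d' i)) (B.proj_lin (e' i)))"
    by (simp add: fun_eq_iff fun_scale_apply B.commutator_proj_lin_simps)
  have 3: "fun_scale (fun_scale (ca_scale S)) r (f + g) = fun_scale (fun_scale (ca_scale S)) r f + fun_scale (fun_scale (ca_scale S)) r g"
    "fun_scale (fun_scale (ca_scale S')) r (f' + g') = fun_scale (fun_scale (ca_scale S')) r f' + fun_scale (fun_scale (ca_scale S')) r g'"
    for f g :: "3 \<Rightarrow> 's \<Rightarrow> 's" and f' g' :: "3 \<Rightarrow> 't \<Rightarrow> 't"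
    by (simp_all add: fun_eq_iff fun_scale_apply A.scale_right_distrib B.scale_right_distrib)
  have 4: "fun_scale (fun_scale (*)) r f i = fun_scale (*) r (f i)" for f :: "3 \<Rightarrow> ('s \<Rightarrow> 't \<Rightarrow> 'f) \<Rightarrow> 'f" and i
    by (simp add: fun_scale_apply)
  have 5: "fun_scale (fun_scale (ca_scale S)) r d i = fun_scale (ca_scale S) r (d i)"
      "fun_scale (fun_scale (ca_scale S')) r d' i = fun_scale (ca_scale S') r (d' i)" for i
    by (simp_all add: fun_scale_apply)
  show ?thesis
    unfolding xy g_br0_def g_scale_def prod_scale_def prod.case fst_conv snd_conv 1 2 3
      bilinear_scale_left[OF br_d_bilinear] bilinear_scale_left[OF br_d'_bilinear]
    by (simp add: fun_eq_iff 4 5 act_simps act'_simps linear_scaleD[OF act_linear] linear_scaleD[OF act'_linear]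
        bilinear_scale_left[OF mul_bilinear] bilinear_scale_right[OF mul_bilinear]
        fs.scale_right_distrib fs.scale_right_diff_distrib)
qed

lemma g_br0_bilinear: "bilinear_map (g_scale S S') (g_scale S S') (g_scale S S') g_br0"
proof (rule bilinear_mapI)
  show "g_br0 x (y + y') = g_br0 x y + g_br0 x y'" for x y y'
    using g_br0_add_left[of y y' x] by (simp add: g_br0_anti[of x])
  interpret g: vector_space "g_scale S S'" by (fact vector_space_g_scale)
  show "g_br0 x (g_scale S S' c y) = g_scale S S' c (g_br0 x y)" for x y c
    using g_br0_scale_left[of c y x] by (simp add: g_br0_anti[of x])
qed (simp_all add: g_br0_add_left g_br0_scale_left vector_space_g_scale)

text \<open>The predicate under \<open>SOME\<close> in \<open>g_br\<close>, named so that
  \<open>someI\<close> can be applied to it.\<close>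

definition is_g_br where
  "is_g_br br \<longleftrightarrow> (
     bilinear_map (g_scale S S') (g_scale S S') (g_scale S S') br \<and>
     (\<forall>x y. br x y = - br y x) \<and>
     (\<forall>d\<in>tri S. \<forall>e\<in>tri S. br (d, 0, 0) (e, 0, 0) = (\<lambda>i. commutator (d i) (e i), 0, 0)) \<and>
     (\<forall>d\<in>tri S'. \<forall>e\<in>tri S'. br (0, d, 0) (0, e, 0) = (0, \<lambda>i. commutator (d i) (e i), 0)) \<and>
     (\<forall>d\<in>tri S. \<forall>d'\<in>tri S'. br (d, 0, 0) (0, d', 0) = 0) \<and>
     (\<forall>d\<in>tri S. \<forall>i a x. br (d, 0, 0) (g_iota i (tns a x)) = g_iota i (tns (d i a) x)) \<and>
     (\<forall>d\<in>tri S'. \<forall>i a x. br (0, d, 0) (g_iota i (tns a x)) = g_iota i (tns a (d i x))) \<and>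
     (\<forall>i a b x y. br (g_iota i (tns a x)) (g_iota (i + 1) (tns b y)) =
        g_iota (i + 2) (tns (ca_mult S a b) (ca_mult S' x y))) \<and>
     (\<forall>i a b x y. br (g_iota i (tns a x)) (g_iota i (tns b y)) =
        g_scale S S' (polar S' x y) (theta_pow i (t_elem S a b), 0, 0) +
        g_scale S S' (polar S a b) (0, theta_pow i (t_elem S' x y), 0)))"

lemmas br_zero = bilinear_zero_left[OF br_d_bilinear] bilinear_zero_left[OF br_d'_bilinear]
  bilinear_zero_right[OF br_d_bilinear] bilinear_zero_right[OF br_d'_bilinear]
  bilinear_zero_left[OF mul_bilinear] bilinear_zero_right[OF mul_bilinear]
  linear_zeroD[OF act_linear] linear_zeroD[OF act'_linear]

lemma diag_ext_iota:
  assumes "vector_space s3"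
  shows "diag_ext s3 G (\<lambda>j. if j = i then u else 0) (\<lambda>j. if j = k then w else 0) =
    (if i = k then (\<lambda>m z. lin_ext s3 tc (\<lambda>p. lin_ext s3 tc (\<lambda>r. G p r (m - i) z) w) u) else 0)"
proof (intro ext)
  fix m z
  let ?F = "\<lambda>j w u. lin_ext s3 tc (\<lambda>p. lin_ext s3 tc (\<lambda>r. G p r (m - j) z) w) u"
  note b = lin_ext2_bilinear[OF T.coords_axioms T.coords_axioms assms]
  have "(\<Sum>j\<in>UNIV. ?F j (if j = k then w else 0) (if j = i then u else 0)) =
      (\<Sum>j\<in>UNIV. if j = i then if i = k then ?F i w u else 0 else 0)"
    by (rule sum.cong) (auto simp: bilinear_zero_left[OF b] bilinear_zero_right[OF b])
  then show "diag_ext s3 G (\<lambda>j. if j = i then u else 0) (\<lambda>j. if j = k then w else 0) m z =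
      (if i = k then (\<lambda>m z. lin_ext s3 tc (\<lambda>p. lin_ext s3 tc (\<lambda>r. G p r (m - i) z) w) u) else 0) m z"
    by (simp add: diag_ext_def)
qed

lemmas br_d_iota = diag_ext_iota[OF A.vector_space_axioms, of "\<lambda>p r k z.
     ca_scale S (polar S' (fr' (snd p)) (fr' (snd r))) (t_elem S (fr (fst p)) (fr (fst r)) k z)", folded br_d_def]
lemmas br_d'_iota = diag_ext_iota[OF B.vector_space_axioms, of "\<lambda>p r k z.
     ca_scale S' (polar S (fr (fst p)) (fr (fst r))) (t_elem S' (fr' (snd p)) (fr' (snd r)) k z)", folded br_d'_def]

lemma is_g_br_g_br0: "is_g_br g_br0"
  unfolding is_g_br_def
proof (intro conjI allI ballI)
  show "bilinear_map (g_scale S S') (g_scale S S') (g_scale S S') g_br0" by (fact g_br0_bilinear)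
  show "g_br0 x y = - g_br0 y x" for x y by (fact g_br0_anti)
  show "g_br0 (d, 0, 0) (e, 0, 0) = (\<lambda>i. commutator (d i) (e i), 0, 0)" if "d \<in> tri S" "e \<in> tri S" for d e
    using that by (simp add: g_br0_def br_zero A.proj_lin_tri A.commutator_proj_lin_simps B.commutator_proj_lin_simps)
      (simp add: fun_eq_iff)
  show "g_br0 (0, d, 0) (0, e, 0) = (0, \<lambda>i. commutator (d i) (e i), 0)" if "d \<in> tri S'" "e \<in> tri S'" for d e
    using that by (simp add: g_br0_def br_zero B.proj_lin_tri A.commutator_proj_lin_simps B.commutator_proj_lin_simps)
      (simp add: fun_eq_iff)
  show "g_br0 (d, 0, 0) (0, e, 0) = 0" if "d \<in> tri S" "e \<in> tri S'" for d e
    by (simp add: g_br0_def br_zero A.commutator_proj_lin_simps B.commutator_proj_lin_simps)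
      (simp add: fun_eq_iff zero_prod_def)
  show "g_br0 (d, 0, 0) (g_iota i (tns a x)) = g_iota i (tns (d i a) x)" if "d \<in> tri S" for d i a x
    using that by (simp add: g_br0_def g_iota_def br_zero A.commutator_proj_lin_simps B.commutator_proj_lin_simps
        act_simps act'_simps act_tensor)
      (simp add: fun_eq_iff br_zero act_tensor)
  show "g_br0 (0, d, 0) (g_iota i (tns a x)) = g_iota i (tns a (d i x))" if "d \<in> tri S'" for d i a x
    using that by (simp add: g_br0_def g_iota_def br_zero A.commutator_proj_lin_simps B.commutator_proj_lin_simps
        act_simps act'_simps act'_tensor)
      (simp add: fun_eq_iff br_zero act'_tensor)
  show "g_br0 (g_iota i (tns a x)) (g_iota (i + 1) (tns b y)) =
        g_iota (i + 2) (tns (ca_mult S a b) (ca_mult S' x y))" for i a b x y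
  proof -
    have "j + 1 = i \<longleftrightarrow> j = i + 2" "j + 2 = i + 1 \<longleftrightarrow> j = i + 2" "j + 2 = i \<longleftrightarrow> j = i + 1" for j
      using three_cases[of j] three_cases[of i]
      by (elim disjE; simp add: three_eq_0 four_eq_1)+
    then show ?thesis
      by (simp add: g_br0_def g_iota_def br_zero A.commutator_proj_lin_simps B.commutator_proj_lin_simps
        act_simps act'_simps br_d_iota br_d'_iota) (simp add: fun_eq_iff br_zero mul_tensor)
  qed
  show "g_br0 (g_iota i (tns a x)) (g_iota i (tns b y)) =
        g_scale S S' (polar S' x y) (theta_pow i (t_elem S a b), 0, 0) +
        g_scale S S' (polar S a b) (0, theta_pow i (t_elem S' x y), 0)" for i a b x y
  proof -
    have "(\<lambda>j. mul (if j + 1 = i then tns c z else 0) (if j + 2 = i then tns e w else 0)) = 0" for c z e w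
      by (auto simp: fun_eq_iff br_zero)
    then show ?thesis
      by (simp add: g_br0_def g_iota_def br_zero A.commutator_proj_lin_simps B.commutator_proj_lin_simps
        act_simps act'_simps br_d_iota br_d'_iota br_d_tensor br_d'_tensor g_scale_def prod_scale_def)
        (simp add: fun_eq_iff fun_scale_def theta_pow_def)
  qed
qed

lemma is_g_br_g_br: "is_g_br (g_br S S')"
  using someI[of is_g_br, OF is_g_br_g_br0] unfolding g_br_def is_g_br_def Let_def .

end

section \<open>The composition algebras as framed algebras\<close>

definition fr2 :: "2 \<Rightarrow> 'f::field \<times> 'f" where
  "fr2 k = (if k = 1 then (1, 0) else (0, 1))"

definition crd2 :: "2 \<Rightarrow> 'f::field \<times> 'f \<Rightarrow> 'f" where
  "crd2 k x = (if k = 1 then fst x else snd x)"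

definition fr4 :: "2 \<times> 2 \<Rightarrow> 'f::field^2^2" where
  "fr4 p = (\<chi> i j. if (i, j) = p then 1 else 0)"

definition crd4 :: "2 \<times> 2 \<Rightarrow> 'f::field^2^2 \<Rightarrow> 'f" where
  "crd4 p x = x $ fst p $ snd p"

definition fr8 :: "(2 \<times> 2) + (2 \<times> 2) \<Rightarrow> ('f::field^2^2) \<times> ('f^2^2)" where
  "fr8 = case_sum (\<lambda>p. (fr4 p, 0)) (\<lambda>p. (0, fr4 p))"

definition crd8 :: "(2 \<times> 2) + (2 \<times> 2) \<Rightarrow> ('f::field^2^2) \<times> ('f^2^2) \<Rightarrow> 'f" where
  "crd8 p x = case_sum (\<lambda>p. crd4 p (fst x)) (\<lambda>p. crd4 p (snd x)) p"

lemma S4_simps: "ca_scale S4 = mat_scale" "ca_mult S4 x y = mat_bar x ** mat_bar y" "ca_norm S4 = det"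
  by (simp_all add: S4_def)

lemma S2_simps: "ca_scale S2 = prod_scale (*) (*)" "ca_mult S2 x y = (snd x * snd y, fst x * fst y)"
  "ca_norm S2 x = fst x * snd x"
  by (simp_all add: S2_def)

lemma S8_simps: "ca_scale S8 = prod_scale mat_scale mat_scale"
  "ca_mult S8 x y = cayley_mult (cayley_bar x) (cayley_bar y)"
  "ca_norm S8 x = det (fst x) - det (snd x)"
  by (simp_all add: S8_def)

lemma polar_S4: "polar S4 x y = trace (mat_bar x ** y)"
  by (simp add: polar_def S4_simps det_2) (simp add: mat2_simps algebra_simps)

lemma polar_S2: "polar S2 x y = fst x * snd y + snd x * fst y"
  by (simp add: polar_def S2_simps algebra_simps)

lemma polar_S8: "polar S8 x y = trace (mat_bar (fst x) ** fst y) - trace (mat_bar (snd x) ** snd y)"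
  by (simp add: polar_def S8_simps det_2) (simp add: mat2_simps algebra_simps)

lemma mat_mult_linear:
  fixes a b c :: "'f::field^2^2"
  shows "(a + b) ** c = a ** c + b ** c" "a ** (b + c) = a ** b + a ** c"
    "(a - b) ** c = a ** c - b ** c" "a ** (b - c) = a ** b - a ** c"
    "mat_scale r a ** b = mat_scale r (a ** b)" "a ** mat_scale r b = mat_scale r (a ** b)"
    "(- a) ** b = - (a ** b)" "a ** (- b) = - (a ** b)"
    "trace (mat_scale r a) = r * trace a" "trace (- a) = - trace a"
    "trace (a + b) = trace a + trace b" "trace (a - b) = trace a - trace b"
  by (simp_all add: mat2_simps algebra_simps)

lemma mat_scale_linear:
  "mat_scale r (a + b) = mat_scale r a + mat_scale r b" "mat_scale r (a - b) = mat_scale r a - mat_scale r b"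
  by (simp_all add: mat2_simps algebra_simps)

lemma mat2_norm: "a ** mat_bar a = mat (det a)" "mat_bar a ** a = mat (det (a :: 'f::field^2^2))"
  by (simp_all add: det_2) (simp_all add: mat2_simps algebra_simps)

lemma mat_mult_mat: "a ** mat r = mat_scale r a" "mat r ** a = mat_scale r (a :: 'f::field^2^2)"
  by (simp_all add: mat2_simps algebra_simps)

lemma mat_bar_bar: "mat_bar (mat_bar a) = (a :: 'f::field^2^2)"
  by (simp add: mat2_simps algebra_simps)

lemma mat2_norm_assoc:
  "a ** (mat_bar a ** b) = mat_scale (det a) b" "mat_bar a ** (a ** b) = mat_scale (det a) (b :: 'f::field^2^2)"
  by (simp_all add: matrix_mul_assoc mat2_norm mat_mult_mat)

lemma sum_2_2: "(\<Sum>k\<in>UNIV. g (k :: 2 \<times> 2)) = g (1, 1) + g (1, 2) + (g (2, 1) + g (2, 2))"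
proof -
  have "(\<Sum>k\<in>UNIV. g k) = (\<Sum>i\<in>UNIV. \<Sum>j\<in>UNIV. g (i, j))"
    by (simp add: sum.cartesian_product flip: UNIV_Times_UNIV)
  then show ?thesis by (simp add: sum_2)
qed

text \<open>Linearizing the two norm identities makes \<open>(x, y) \<mapsto> t\<^bsub>x,y\<^esub>\<close> skew-symmetric.\<close>

lemma t_elem_anti:
  fixes S :: "('f::field, 's::ab_group_add) calg"
  assumes two: "(2::'f) \<noteq> 0"
    and bilinear: "bilinear_map (ca_scale S) (ca_scale S) (ca_scale S) (ca_mult S)"
    and norm: "\<And>x z. ca_mult S (ca_mult S x z) x = ca_scale S (ca_norm S x) z"
      "\<And>x z. ca_mult S x (ca_mult S z x) = ca_scale S (ca_norm S x) z"
  shows "t_elem S x y i z = - t_elem S y x i z"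
proof -
  interpret vector_space "ca_scale S" by (rule bilinear_vs(1)[OF bilinear])
  note b = bilinear_add_left[OF bilinear] bilinear_add_right[OF bilinear]
  have sym: "polar S y x = polar S x y" by (simp add: polar_def add.commute)
  have half: "ca_scale S (polar S x y / 2) z + ca_scale S (polar S x y / 2) z = ca_scale S (polar S x y) z"
    using two by (simp flip: scale_left_distrib add_divide_distrib)
  have "ca_mult S (ca_mult S y z) x + ca_mult S (ca_mult S x z) y = ca_scale S (polar S x y) z"
    using norm(1)[of "x + y" z] by (simp add: b norm polar_def scale_left_diff_distrib algebra_simps)
  moreover have "ca_mult S x (ca_mult S z y) + ca_mult S y (ca_mult S z x) = ca_scale S (polar S x y) z"
    using norm(2)[of "x + y" z] by (simp add: b norm polar_def scale_left_diff_distrib algebra_simps)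
  ultimately show ?thesis
    unfolding t_elem_def sym using half by (auto simp: algebra_simps) 
qed

lemma framed_space_S4: "framed_space (ca_scale (S4 :: ('f::field, _) calg)) fr4 crd4"
  unfolding S4_simps
proof (intro framed_space.intro framed_space_axioms.intro vector_space_mat_scale)
  show "Vector_Spaces.linear mat_scale (*) (crd4 k)" for k
    by (intro linearI vector_space_mat_scale vector_space_field) (simp_all add: crd4_def mat_scale_def)
  show "(\<Sum>k\<in>UNIV. mat_scale (crd4 k x) (fr4 k)) = x" for x :: "'f^2^2"
    by (simp add: sum_2_2 vec_eq_iff forall_2 crd4_def fr4_def mat_scale_def)
qed

lemma framed_space_S2: "framed_space (ca_scale (S2 :: ('f::field, _) calg)) fr2 crd2"
  unfolding S2_simps
proof (intro framed_space.intro framed_space_axioms.intro vector_space_prod_scale vector_space_field)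
  show "Vector_Spaces.linear (prod_scale (*) (*)) (*) (crd2 k)" for k
    by (intro linearI vector_space_prod_scale vector_space_field) (simp_all add: crd2_def prod_scale_def)
  show "(\<Sum>k\<in>UNIV. prod_scale (*) (*) (crd2 k x) (fr2 k)) = x" for x :: "'f \<times> 'f"
    by (simp add: sum_2 crd2_def fr2_def prod_scale_def)
qed

lemma framed_space_S8: "framed_space (ca_scale (S8 :: ('f::field, _) calg)) fr8 crd8"
  unfolding S8_simps
proof (intro framed_space.intro framed_space_axioms.intro vector_space_prod_scale vector_space_mat_scale)
  interpret f: framed_space "mat_scale :: 'f \<Rightarrow> _" fr4 crd4
    using framed_space_S4 unfolding S4_simps .
  show "Vector_Spaces.linear (prod_scale mat_scale mat_scale) (*) (crd8 k :: ('f^2^2) \<times> ('f^2^2) \<Rightarrow> 'f)" for k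
    by (intro linearI vector_space_prod_scale vector_space_mat_scale vector_space_field)
      (auto simp: crd8_def prod_scale_def f.c_simps split: sum.splits)
  show "(\<Sum>k\<in>UNIV. prod_scale mat_scale mat_scale (crd8 k x) (fr8 k)) = x" for x :: "('f^2^2) \<times> ('f^2^2)"
    using f.frame[of "fst x"] f.frame[of "snd x"]
    by (simp add: sum.Plus crd8_def fr8_def prod_scale_def prod_eq_iff fst_sum snd_sum f.scale_zero_right flip: UNIV_Plus_UNIV)
qed

lemma framed_calg_S4:
  assumes two: "(2::'f::field) \<noteq> 0"
  shows "framed_calg (S4 :: ('f, _) calg) fr4 crd4"
proof (intro framed_calg.intro framed_space_S4 framed_calg_axioms.intro)
  show mult: "bilinear_map (ca_scale S4) (ca_scale S4) (ca_scale S4) (ca_mult (S4 :: ('f, _) calg))"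
    by (rule bilinear_mapI) (simp_all add: S4_simps vector_space_mat_scale mat_mult_linear mat_bar_linear)
  show "bilinear_map (ca_scale S4) (ca_scale S4) (*) (polar (S4 :: ('f, _) calg))"
    by (rule bilinear_mapI)
      (simp_all add: S4_simps polar_S4 vector_space_mat_scale vector_space_field mat_mult_linear mat_bar_linear)
  show "t_elem S4 x y i z = - t_elem S4 y x i z" for x y z :: "'f^2^2" and i
  proof (rule t_elem_anti[OF two mult])
    show "ca_mult S4 (ca_mult S4 x z) x = ca_scale S4 (ca_norm S4 x) z"
      "ca_mult S4 x (ca_mult S4 z x) = ca_scale S4 (ca_norm S4 x) z" for x z :: "'f^2^2"
      by (simp_all add: S4_simps mat_bar_mult mat_bar_bar matrix_mul_assoc[symmetric] mat2_norm mat2_norm_assoc mat_mult_mat)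
  qed
qed

lemma framed_calg_S2:
  assumes two: "(2::'f::field) \<noteq> 0"
  shows "framed_calg (S2 :: ('f, _) calg) fr2 crd2"
proof (intro framed_calg.intro framed_space_S2 framed_calg_axioms.intro)
  show mult: "bilinear_map (ca_scale S2) (ca_scale S2) (ca_scale S2) (ca_mult (S2 :: ('f, _) calg))"
    by (rule bilinear_mapI) (auto simp: S2_simps prod_scale_def algebra_simps intro!: vector_space_prod_scale vector_space_field)
  show "bilinear_map (ca_scale S2) (ca_scale S2) (*) (polar (S2 :: ('f, _) calg))"
    by (rule bilinear_mapI)
      (auto simp: S2_simps polar_S2 prod_scale_def algebra_simps intro!: vector_space_prod_scale vector_space_field)
  show "t_elem S2 x y i z = - t_elem S2 y x i z" for x y z :: "'f \<times> 'f" and i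
  proof (rule t_elem_anti[OF two mult])
    show "ca_mult S2 (ca_mult S2 x z) x = ca_scale S2 (ca_norm S2 x) z"
      "ca_mult S2 x (ca_mult S2 z x) = ca_scale S2 (ca_norm S2 x) z" for x z :: "'f \<times> 'f"
      by (simp_all add: S2_simps prod_scale_def)
  qed
qed

lemma framed_calg_S8:
  assumes two: "(2::'f::field) \<noteq> 0"
  shows "framed_calg (S8 :: ('f, _) calg) fr8 crd8"
proof (intro framed_calg.intro framed_space_S8 framed_calg_axioms.intro)
  show mult: "bilinear_map (ca_scale S8) (ca_scale S8) (ca_scale S8) (ca_mult (S8 :: ('f, _) calg))"
    by (rule bilinear_mapI)
      (simp_all add: S8_simps cayley_mult_def cayley_bar_def prod_scale_def
        vector_space_prod_scale vector_space_mat_scale mat_mult_linear mat_bar_linear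
        mat_scale_linear mat_scale_minus mat2_minus)
  show "bilinear_map (ca_scale S8) (ca_scale S8) (*) (polar (S8 :: ('f, _) calg))"
    by (rule bilinear_mapI)
      (simp_all add: S8_simps polar_S8 prod_scale_def vector_space_prod_scale
        vector_space_mat_scale vector_space_field mat_mult_linear mat_bar_linear algebra_simps)
  show "t_elem S8 x y i z = - t_elem S8 y x i z" for x y z :: "('f^2^2) \<times> ('f^2^2)" and i
  proof (rule t_elem_anti[OF two mult])
    show "ca_mult S8 (ca_mult S8 x z) x = ca_scale S8 (ca_norm S8 x) z"
      "ca_mult S8 x (ca_mult S8 z x) = ca_scale S8 (ca_norm S8 x) z" for x z :: "('f^2^2) \<times> ('f^2^2)"
      by (simp_all add: S8_simps cayley_mult_def cayley_bar_def prod_scale_def mat_bar_linear mat_bar_mult mat_bar_bar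
        mat_mult_linear matrix_mul_assoc[symmetric] mat2_norm mat2_norm_assoc mat_mult_mat mat2_minus)
  qed
qed

section \<open>The table of \<open>\<gg>(S, S\<^sub>2)\<close> for an algebra containing \<open>M\<^sub>2(F)\<close>\<close>

lemma (in framed_calg) linear_combine:
  assumes "Vector_Spaces.linear (ca_scale S) (ca_scale S) d" "Vector_Spaces.linear (ca_scale S) (ca_scale S) e"
  shows "Vector_Spaces.linear (ca_scale S) (ca_scale S) (d + e)"
    "Vector_Spaces.linear (ca_scale S) (ca_scale S) (fun_scale (ca_scale S) r d)"
    "Vector_Spaces.linear (ca_scale S) (ca_scale S) 0"
  by (auto intro!: linearI vector_space_axioms simp: linear_addD[OF assms(1)] linear_addD[OF assms(2)] fun_scale_def
      linear_scaleD[OF assms(1)] linear_scaleD[OF assms(2)] scale_right_distrib mult.commute)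

lemma (in framed_calg) subspace_tri: "module.subspace (fun_scale (fun_scale (ca_scale S))) (tri S)"
proof -
  interpret F: vector_space "fun_scale (fun_scale (ca_scale S)) :: 'f \<Rightarrow> (3 \<Rightarrow> 's \<Rightarrow> 's) \<Rightarrow> _"
    by (intro vector_space_fun_scale vector_space_axioms)
  note b = bilinear_add_left[OF bilinear_polar] bilinear_add_right[OF bilinear_polar]
    bilinear_scale_left[OF bilinear_polar] bilinear_scale_right[OF bilinear_polar]
    bilinear_zero_left[OF bilinear_polar] bilinear_zero_right[OF bilinear_polar]
  note m = bilinear_add_left[OF bilinear_mult] bilinear_add_right[OF bilinear_mult]
    bilinear_scale_left[OF bilinear_mult] bilinear_scale_right[OF bilinear_mult]
    bilinear_zero_left[OF bilinear_mult] bilinear_zero_right[OF bilinear_mult]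
  have orth: "d + e \<in> orth S" "fun_scale (ca_scale S) r d \<in> orth S" "0 \<in> orth S"
    if "d \<in> orth S" "e \<in> orth S" for d e r
  proof -
    have d: "Vector_Spaces.linear (ca_scale S) (ca_scale S) d" "\<And>x y. polar S (d x) y + polar S x (d y) = 0"
      and e: "Vector_Spaces.linear (ca_scale S) (ca_scale S) e" "\<And>x y. polar S (e x) y + polar S x (e y) = 0"
      using that by (auto simp: orth_def)
    have "polar S (d x) y + polar S (e x) y + (polar S x (d y) + polar S x (e y)) = 0" for x y
      using d(2)[of x y] e(2)[of x y] by (metis add.commute add.left_commute add_0)
    then show "d + e \<in> orth S" using linear_combine(1)[OF d(1) e(1)] by (simp add: orth_def b)
    show "fun_scale (ca_scale S) r d \<in> orth S"
      using linear_combine(2)[OF d(1) e(1)] d(2) by (simp add: orth_def b fun_scale_apply flip: distrib_left)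
    show "0 \<in> orth S" using linear_combine(3)[OF d(1) e(1)] by (simp add: orth_def b)
  qed
  have zero: "0 \<in> orth S"
    by (simp add: orth_def b linearI vector_space_axioms)
  show ?thesis
    by (rule F.subspaceI)
      (auto simp: tri_def orth(1) orth(2)[OF _ zero] zero m fun_scale_apply scale_right_distrib algebra_simps)
qed

lemma subspace_tensor_space:
  fixes s :: "'f::field \<Rightarrow> 'a::ab_group_add \<Rightarrow> 'a" and s' :: "'f \<Rightarrow> 'b::ab_group_add \<Rightarrow> 'b"
  shows "module.subspace (fun_scale (*)) (tensor_space s s' X Y)"
proof -
  interpret vector_space "fun_scale (*) :: 'f \<Rightarrow> (('a \<Rightarrow> 'b \<Rightarrow> 'f) \<Rightarrow> 'f) \<Rightarrow> _"
    by (intro vector_space_fun_scale vector_space_field)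
  show ?thesis unfolding tensor_space_def by (rule subspace_span)
qed

lemma tensor_in_space:
  fixes s :: "'f::field \<Rightarrow> 'a::ab_group_add \<Rightarrow> 'a" and s' :: "'f \<Rightarrow> 'b::ab_group_add \<Rightarrow> 'b"
  shows "x \<in> X \<Longrightarrow> y \<in> Y \<Longrightarrow> tensor s s' x y \<in> tensor_space s s' X Y"
proof -
  interpret vector_space "fun_scale (*) :: 'f \<Rightarrow> (('a \<Rightarrow> 'b \<Rightarrow> 'f) \<Rightarrow> 'f) \<Rightarrow> _"
    by (intro vector_space_fun_scale vector_space_field)
  show "x \<in> X \<Longrightarrow> y \<in> Y \<Longrightarrow> tensor s s' x y \<in> tensor_space s s' X Y"
    unfolding tensor_space_def by (rule span_base) blast
qed

context framed_calg_pair
begin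

lemma subspace_g_space: "module.subspace (g_scale S S') (g_space S S')"
proof -
  interpret g: vector_space "g_scale S S'" by (fact vector_space_g_scale)
  interpret FA: vector_space "fun_scale (fun_scale (ca_scale S)) :: 'f \<Rightarrow> (3 \<Rightarrow> 's \<Rightarrow> 's) \<Rightarrow> _"
    by (intro vector_space_fun_scale A.vector_space_axioms)
  interpret FB: vector_space "fun_scale (fun_scale (ca_scale S')) :: 'f \<Rightarrow> (3 \<Rightarrow> 't \<Rightarrow> 't) \<Rightarrow> _"
    by (intro vector_space_fun_scale B.vector_space_axioms)
  interpret F: vector_space "fun_scale (*) :: 'f \<Rightarrow> (('s \<Rightarrow> 't \<Rightarrow> 'f) \<Rightarrow> 'f) \<Rightarrow> _"
    by (intro vector_space_fun_scale vector_space_field)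
  note a = A.subspace_tri and b = B.subspace_tri
    and c = subspace_tensor_space[of "ca_scale S" "ca_scale S'" UNIV UNIV]
  show ?thesis
    by (rule g.subspaceI)
      (auto simp: g_space_def g_scale_def prod_scale_def zero_prod_def fun_scale_apply
        FA.subspace_0[OF a] FA.subspace_add[OF a] FA.subspace_scale[OF a]
        FB.subspace_0[OF b] FB.subspace_add[OF b] FB.subspace_scale[OF b]
        F.subspace_0[OF c] F.subspace_add[OF c] F.subspace_scale[OF c])
qed

lemma tri_0: "0 \<in> tri S" "0 \<in> tri S'"
proof -
  interpret FA: vector_space "fun_scale (fun_scale (ca_scale S)) :: 'f \<Rightarrow> (3 \<Rightarrow> 's \<Rightarrow> 's) \<Rightarrow> _"
    by (intro vector_space_fun_scale A.vector_space_axioms)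
  interpret FB: vector_space "fun_scale (fun_scale (ca_scale S')) :: 'f \<Rightarrow> (3 \<Rightarrow> 't \<Rightarrow> 't) \<Rightarrow> _"
    by (intro vector_space_fun_scale B.vector_space_axioms)
  show "0 \<in> tri S" "0 \<in> tri S'"
    using FA.subspace_0[OF A.subspace_tri] FB.subspace_0[OF B.subspace_tri] .
qed

lemma functional_0: "0 \<in> tensor_space (ca_scale S) (ca_scale S') UNIV UNIV"
proof -
  interpret F: vector_space "fun_scale (*) :: 'f \<Rightarrow> (('s \<Rightarrow> 't \<Rightarrow> 'f) \<Rightarrow> 'f) \<Rightarrow> _"
    by (intro vector_space_fun_scale vector_space_field)
  show ?thesis by (rule F.subspace_0[OF subspace_tensor_space])
qed

lemma g_space_intros:
  "d \<in> tri S \<Longrightarrow> (d, 0, 0) \<in> g_space S S'" "d' \<in> tri S' \<Longrightarrow> (0, d', 0) \<in> g_space S S'"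
  "g_iota i (tns a x) \<in> g_space S S'"
  by (auto simp: g_space_def g_iota_def tri_0 functional_0 tensor_in_space)

end

section \<open>The triality algebra of S2\<close>

definition tri2 :: "(3 \<Rightarrow> 'f::field) \<Rightarrow> 3 \<Rightarrow> 'f \<times> 'f \<Rightarrow> 'f \<times> 'f" where
  "tri2 \<alpha> = (\<lambda>i z. (\<alpha> i * fst z, - \<alpha> i * snd z))"

lemma tri2_in_tri: "\<alpha> \<in> t2 \<Longrightarrow> tri2 \<alpha> \<in> tri S2"
proof -
  assume "\<alpha> \<in> t2"
  then have *: "\<alpha> 0 = - \<alpha> 1 - \<alpha> 2" unfolding t2_def by (simp add: eq_diff_eq eq_neg_iff_add_eq_0 add_ac)
  show ?thesis
    by (auto simp: * tri_def orth_def tri2_def S2_simps polar_S2 prod_scale_def algebra_simps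
        intro!: linearI vector_space_prod_scale vector_space_field)
qed

text \<open>A skew map for the hyperbolic form preserves both isotropic lines and acts on them by
  opposite scalars. The product e+ e+ = e- then turns the triality relation into \<alpha>0 +
  \<alpha>1 + \<alpha>2 = 0.\<close>

lemma tri_S2:
  fixes d :: "3 \<Rightarrow> 'f::field \<times> 'f \<Rightarrow> 'f \<times> 'f"
  assumes two: "(2::'f) \<noteq> 0" and d: "d \<in> tri S2"
  shows "\<exists>\<alpha>\<in>t2. d = tri2 \<alpha>"
proof -
  define \<alpha> where "\<alpha> i = fst (d i (1, 0))" for i
  have lin: "Vector_Spaces.linear (prod_scale (*) (*)) (prod_scale (*) (*)) (d i)" for i
    using d by (simp add: tri_def orth_def S2_simps)
  have pol: "polar S2 (d i x) y + polar S2 x (d i y) = 0" for i x y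
    using d unfolding tri_def orth_def by blast
  have e: "snd (d i (1, 0)) = 0" "fst (d i (0, 1)) = 0" "snd (d i (0, 1)) = - \<alpha> i" for i
    using pol[of i "(1,0)" "(1,0)"] pol[of i "(0,1)" "(0,1)"] pol[of i "(1,0)" "(0,1)"] two
    by (auto simp: polar_S2 \<alpha>_def eq_neg_iff_add_eq_0 add.commute simp flip: mult_2)
  have "d i z = tri2 \<alpha> i z" for i z
  proof -
    have "z = prod_scale (*) (*) (fst z) (1, 0) + prod_scale (*) (*) (snd z) (0, 1)"
      by (simp add: prod_scale_def prod_eq_iff)
    then have "d i z = prod_scale (*) (*) (fst z) (d i (1, 0)) + prod_scale (*) (*) (snd z) (d i (0, 1))"
      using linear_addD[OF lin] linear_scaleD[OF lin] by metis
    then show ?thesis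
      using e[of i] by (simp add: prod_eq_iff prod_scale_def tri2_def \<alpha>_def mult.commute)
  qed
  then have eq: "d = tri2 \<alpha>" by blast
  have "d 0 (ca_mult S2 (1,0) (1,0)) = ca_mult S2 (d 1 (1,0)) (1,0) + ca_mult S2 (1,0) (d 2 (1,0))"
    using d by (simp add: tri_def)
  then have "\<alpha> \<in> t2"
    by (simp add: eq tri2_def S2_simps t2_def neg_eq_iff_add_eq_0 add.assoc)
  with eq show ?thesis by blast
qed

lemma mult_S2_e:
  "ca_mult S2 (1, 0) (1, 0) = (0, 1)" "ca_mult S2 (0, 1) (0, 1) = (1, 0)"
  "ca_mult S2 (1, 0) (0, 1) = 0" "ca_mult S2 (0, 1) (1, 0) = 0"
  "polar S2 (1, 0) (1, 0) = 0" "polar S2 (0, 1) (0, 1) = 0" "polar S2 (1, 0) (0, 1) = 1"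
  by (simp_all add: S2_simps polar_S2 zero_prod_def)

lemma t_elem_S2_e:
  assumes "(2::'f::field) \<noteq> 0"
  shows "t_elem S2 (1, 0) (1, 0) = (0 :: 3 \<Rightarrow> 'f \<times> 'f \<Rightarrow> _)" "t_elem S2 (0, 1) (0, 1) = (0 :: 3 \<Rightarrow> 'f \<times> 'f \<Rightarrow> _)"
    "t_elem S2 (1, 0) (0, 1) = tri2 (\<lambda>i. if i = 0 then - 1 else 1 / 2 :: 'f)"
  using assms
  by (auto simp: t_elem_def fun_eq_iff S2_simps polar_S2 tri2_def prod_scale_def field_simps)

text \<open>The common ground of S4 and S8, so that one table covers g(S4, S2) and its image in
  g(S8, S2): \<open>j\<close> embeds the 2 x 2 matrices and \<open>h\<close> makes sl2^3 act by
  triality triples. The index i + 1 in \<open>t_j\<close> inverts the shift k + 2 used for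
  \<open>g_P\<close> and \<open>g_N\<close> below.\<close>

locale m2_calg = framed_calg S fr crd
  for S :: "('f::field, 's::ab_group_add) calg" and fr :: "'k::finite \<Rightarrow> 's" and crd +
  fixes j :: "'f^2^2 \<Rightarrow> 's" and h :: "(3 \<Rightarrow> 'f^2^2) \<Rightarrow> 3 \<Rightarrow> 's \<Rightarrow> 's"
  assumes two: "(2::'f) \<noteq> 0"
    and linear_j: "Vector_Spaces.linear mat_scale (ca_scale S) j"
    and j_eq_0: "j a = 0 \<Longrightarrow> a = 0"
    and linear_h: "Vector_Spaces.linear (fun_scale mat_scale) (fun_scale (fun_scale (ca_scale S))) h"
    and h_tri: "(\<forall>i. trace (A i) = 0) \<Longrightarrow> h A \<in> tri S"
    and h_comm: "commutator (h A i) (h B i) = h (\<lambda>i. A i ** B i - B i ** A i) i"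
    and h_j: "h A i (j a) = j (A (i + 2) ** a - a ** A (i + 1))"
    and mult_j: "ca_mult S (j a) (j b) = j (mat_bar a ** mat_bar b)"
    and polar_j: "polar S (j a) (j b) = trace (mat_bar a ** b)"
    and t_j: "theta_pow i (t_elem S (j a) (j b)) = h (PN_H (i + 1) a b)"
begin

sublocale P: framed_calg_pair S fr crd "S2 :: ('f, 'f \<times> 'f) calg" fr2 crd2
  using framed_calg_S2[OF two] by (intro framed_calg_pair.intro framed_calg_axioms)

abbreviation "L \<equiv> g_alg S (S2 :: ('f, 'f \<times> 'f) calg)"

definition g_H :: "(3 \<Rightarrow> 'f^2^2) \<Rightarrow> ('f, 's, 'f \<times> 'f) g_elem" where "g_H A = (h A, 0, 0)"
definition g_T :: "(3 \<Rightarrow> 'f) \<Rightarrow> ('f, 's, 'f \<times> 'f) g_elem" where "g_T \<alpha> = (0, tri2 \<alpha>, 0)"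
text \<open>The summand is iota_(k+2) because k + 2 = k - 1 modulo 3 is the entry of a triple in t2
  that acts on the pair {k, k + 1}.\<close>

definition g_P :: "3 \<Rightarrow> 'f^2^2 \<Rightarrow> ('f, 's, 'f \<times> 'f) g_elem" where "g_P k a = g_iota (k + 2) (P.tns (j a) (1, 0))"
definition g_N :: "3 \<Rightarrow> 'f^2^2 \<Rightarrow> ('f, 's, 'f \<times> 'f) g_elem" where "g_N k a = g_iota (k + 2) (P.tns (j a) (0, 1))"

lemma g_iota_linear: "g_iota i (u + w) = g_iota i u + g_iota i w" "g_iota i 0 = (0 :: ('f, 's, 'f \<times> 'f) g_elem)"
  "g_iota i (fun_scale (*) c u) = g_scale S S2 c (g_iota i u)"
  for u w :: "('s \<Rightarrow> 'f \<times> 'f \<Rightarrow> 'f) \<Rightarrow> 'f"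
proof -
  have "ca_scale S2 c (0, 0) = (0 :: 'f, 0 :: 'f)"
    using P.B.scale_zero_right[of c] by (simp add: zero_prod_def)
  then show "g_iota i (u + w) = g_iota i u + g_iota i w" "g_iota i 0 = (0 :: ('f, 's, 'f \<times> 'f) g_elem)"
    "g_iota i (fun_scale (*) c u) = g_scale S S2 c (g_iota i u)"
    by (auto simp: g_iota_def g_scale_def prod_scale_def fun_eq_iff fun_scale_def zero_prod_def scale_zero_right)
qed

lemmas g_br_spec = P.is_g_br_g_br[unfolded P.is_g_br_def]
lemmas g_br_bilinear = g_br_spec[THEN conjunct1]
lemmas g_br_anti = g_br_spec[THEN conjunct2, THEN conjunct1, rule_format]
lemmas g_br_dd = g_br_spec[THEN conjunct2, THEN conjunct2, THEN conjunct1, rule_format]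
lemmas g_br_d'd' = g_br_spec[THEN conjunct2, THEN conjunct2, THEN conjunct2, THEN conjunct1, rule_format]
lemmas g_br_dd' = g_br_spec[THEN conjunct2, THEN conjunct2, THEN conjunct2, THEN conjunct2, THEN conjunct1, rule_format]
lemmas g_br_d_iota = g_br_spec[THEN conjunct2, THEN conjunct2, THEN conjunct2, THEN conjunct2, THEN conjunct2, THEN conjunct1, rule_format]
lemmas g_br_d'_iota = g_br_spec[THEN conjunct2, THEN conjunct2, THEN conjunct2, THEN conjunct2, THEN conjunct2, THEN conjunct2, THEN conjunct1, rule_format]
lemmas g_br_iota_Suc = g_br_spec[THEN conjunct2, THEN conjunct2, THEN conjunct2, THEN conjunct2, THEN conjunct2, THEN conjunct2, THEN conjunct2, THEN conjunct1, rule_format]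
lemmas g_br_iota = g_br_spec[THEN conjunct2, THEN conjunct2, THEN conjunct2, THEN conjunct2, THEN conjunct2, THEN conjunct2, THEN conjunct2, THEN conjunct2, rule_format]

lemma block_table: "block_table L g_H g_T g_P g_N"
proof (rule block_table.intro)
  note vs = P.vector_space_g_scale
  note tns = bilinear_add_left[OF P.tns_bilinear] bilinear_scale_left[OF P.tns_bilinear]
    bilinear_scale_right[OF P.tns_bilinear] bilinear_zero_right[OF P.tns_bilinear]
    bilinear_minus_left[OF P.tns_bilinear] bilinear_minus_right[OF P.tns_bilinear]
  have alg: "lie_scale L = g_scale S (S2 :: ('f, 'f \<times> 'f) calg)" "lie_space L = g_space S (S2 :: ('f, 'f \<times> 'f) calg)"
    "lie_br L = g_br S (S2 :: ('f, 'f \<times> 'f) calg)"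
    by (simp_all add: g_alg_def)
  show "(2::'f) \<noteq> 0" by (fact two)
  have linH: "Vector_Spaces.linear (fun_scale mat_scale) (lie_scale L) g_H"
    unfolding alg
    by (rule linearI, simp_all add: vs vector_space_fun_scale[OF vector_space_mat_scale] g_H_def
        linear_addD[OF linear_h] linear_scaleD[OF linear_h])
      (simp_all add: g_scale_def prod_scale_def fun_scale_def fun_eq_iff P.B.scale_zero_right)
  have linT: "Vector_Spaces.linear (fun_scale (*)) (lie_scale L) g_T"
    unfolding alg
    by (rule linearI, simp_all add: vs vector_space_fun_scale[OF vector_space_field] g_T_def)
      (simp_all add: g_scale_def prod_scale_def tri2_def S2_simps fun_scale_def fun_eq_iff scale_zero_right algebra_simps)
  have linP: "Vector_Spaces.linear mat_scale (lie_scale L) (g_P k)"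
    and linN: "Vector_Spaces.linear mat_scale (lie_scale L) (g_N k)" for k
    unfolding alg
    by (rule linearI; simp add: vs vector_space_mat_scale g_P_def g_N_def linear_addD[OF linear_j] linear_scaleD[OF linear_j] tns g_iota_linear)+
  show "Vector_Spaces.linear (fun_scale mat_scale) (lie_scale L) g_H"
    "Vector_Spaces.linear (fun_scale (*)) (lie_scale L) g_T"
    "Vector_Spaces.linear mat_scale (lie_scale L) (g_P k)"
    "Vector_Spaces.linear mat_scale (lie_scale L) (g_N k)" for k
    by (fact linH linT linP linN)+
  show "module.subspace (lie_scale L) (lie_space L)"
    unfolding alg by (fact P.subspace_g_space)
  show "g_H A \<in> lie_space L" if "\<forall>i. trace (A i) = 0" for A
    unfolding alg g_H_def by (intro P.g_space_intros h_tri that)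
  show "g_T \<alpha> \<in> lie_space L" if "\<alpha> \<in> t2" for \<alpha>
    unfolding alg g_T_def by (intro P.g_space_intros tri2_in_tri that)
  show "g_P k a \<in> lie_space L" "g_N k a \<in> lie_space L" for k a
    unfolding alg g_P_def g_N_def by (intro P.g_space_intros)+
  show "A = 0 \<and> \<alpha> = 0 \<and> f = 0 \<and> g = 0" if "\<forall>i. trace (A i) = 0" "\<alpha> \<in> t2"
    "g_H A + g_T \<alpha> + (\<Sum>k\<in>UNIV. g_P k (f k)) + (\<Sum>k\<in>UNIV. g_N k (g k)) = 0" for A \<alpha> f g
  proof -
    have comp: "fst (\<Sum>k\<in>UNIV. F k) = (\<Sum>k\<in>UNIV. fst (F k))" "snd (\<Sum>k\<in>UNIV. F k) = (\<Sum>k\<in>UNIV. snd (F k))"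
      for F :: "3 \<Rightarrow> 'x::comm_monoid_add \<times> 'y::comm_monoid_add"
      by (simp_all add: fst_sum snd_sum)
    have "h A = 0"
      using arg_cong[OF that(3), of fst] by (simp add: comp g_H_def g_T_def g_P_def g_N_def g_iota_def)
    \<comment> \<open>If \<open>h A\<close> vanishes, then A (i + 2) a = a A (i + 1) for all a. The
      choice a = 1 identifies the two matrices, so every A i is central, and a central matrix of
      trace 0 is 0.\<close>
    have "A (i + 2) = A (i + 1)" and A_comm: "A (i + 2) ** a = a ** A (i + 2)" for i a
    proof -
      have *: "A (i + 2) ** a - a ** A (i + 1) = 0" for a
        by (rule j_eq_0) (simp add: \<open>h A = 0\<close> flip: h_j)
      from *[of "mat 1"] show "A (i + 2) = A (i + 1)" by simp
      with *[of a] show "A (i + 2) ** a = a ** A (i + 2)" by simp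
    qed
    have "A i = 0" for i
    proof -
      have c: "A i ** a = a ** A i" for a
        using A_comm[of "i + 1" a] by (simp add: three_add)
      have tr: "trace (A i) = 0" using that(1) by blast
      from c[of "\<chi> r s. if r = 1 \<and> s = 2 then 1 else 0"] c[of "\<chi> r s. if r = 2 \<and> s = 1 then 1 else 0"] tr two
      show ?thesis by (auto simp: mat2_simps simp flip: mult_2)
    qed
    then have "A = 0" by (simp add: fun_eq_iff)
    have "tri2 \<alpha> = 0"
      using arg_cong[OF that(3), of "\<lambda>x. fst (snd x)"] by (simp add: comp g_H_def g_T_def g_P_def g_N_def g_iota_def)
    then have "fst (tri2 \<alpha> i (1, 0)) = 0" for i by simp
    then have "\<alpha> = 0" by (simp add: tri2_def fun_eq_iff)
    have "j (f k) = 0 \<and> j (g k) = 0" for k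
    proof -
      have "snd (snd (g_H A + g_T \<alpha> + (\<Sum>k\<in>UNIV. g_P k (f k)) + (\<Sum>k\<in>UNIV. g_N k (g k)))) (k + 2) = 0"
        unfolding that(3) by simp
      then have 0: "P.tns (j (f k)) (1, 0) + P.tns (j (g k)) (0, 1) = 0"
        by (simp add: comp g_H_def g_T_def g_P_def g_N_def g_iota_def sum_fun_apply cong: if_cong)
      have c: "crd p (j (f k)) * crd2 q (1, 0) + crd p (j (g k)) * crd2 q (0, 1) = 0" for p q
        using arg_cong[OF 0, of "P.tc (p, q)"] by (simp add: P.T.c_simps P.tc_tensor)
      have "crd p (j (f k)) = 0" "crd p (j (g k)) = 0" for p
        using c[of p 1] c[of p 2] by (simp_all add: crd2_def)
      then show ?thesis
        using frame[of "j (f k)"] frame[of "j (g k)"] by (simp add: scale_zero_left)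
    qed
    then have "f = 0" "g = 0" using j_eq_0 by (simp_all add: fun_eq_iff)
    with \<open>A = 0\<close> \<open>\<alpha> = 0\<close> show ?thesis by blast
  qed
  show "lie_br L (x + y) z = lie_br L x z + lie_br L y z" for x y z :: "('f, 's, 'f \<times> 'f) g_elem"
    unfolding alg by (rule bilinear_add_left[OF g_br_bilinear])
  show "lie_br L x y = - lie_br L y x" for x y :: "('f, 's, 'f \<times> 'f) g_elem"
    unfolding alg by (rule g_br_anti)
  show "lie_br L (g_H A) (g_H B) = g_H (\<lambda>i. A i ** B i - B i ** A i)"
    if "\<forall>i. trace (A i) = 0" "\<forall>i. trace (B i) = 0" for A B
    unfolding alg g_H_def using that by (simp add: g_br_dd h_tri h_comm)
  show "lie_br L (g_H A) (g_T \<alpha>) = 0" if "\<forall>i. trace (A i) = 0" "\<alpha> \<in> t2" for A \<alpha>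
    unfolding alg g_H_def g_T_def using that by (simp add: g_br_dd' h_tri tri2_in_tri)
  show "lie_br L (g_T \<alpha>) (g_T \<beta>) = 0" if "\<alpha> \<in> t2" "\<beta> \<in> t2" for \<alpha> \<beta>
    unfolding alg g_T_def using that by (simp add: g_br_d'd' tri2_in_tri)
      (simp add: commutator_def tri2_def fun_eq_iff zero_prod_def)
  show "lie_br L (g_H A) (g_P k a) = g_P k (A (k + 1) ** a - a ** A k)"
    "lie_br L (g_H A) (g_N k a) = g_N k (A (k + 1) ** a - a ** A k)" if "\<forall>i. trace (A i) = 0" for A k a
    unfolding alg g_H_def g_P_def g_N_def using that by (simp_all add: g_br_d_iota h_tri h_j three_add)
  have tri2_e: "tri2 \<alpha> i (1, 0) = ca_scale S2 (\<alpha> i) (1, 0)" "tri2 \<alpha> i (0, 1) = ca_scale S2 (- \<alpha> i) (0, 1)" for \<alpha> :: "3 \<Rightarrow> 'f" and i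
    by (simp_all add: tri2_def S2_simps prod_scale_def)
  have tns_swap: "P.tns (ca_scale S c x) y = P.tns x (ca_scale S2 c y)" for c x y
    by (simp add: tns)
  show "lie_br L (g_T \<alpha>) (g_P k a) = g_P k (mat_scale (\<alpha> (k - 1)) a)"
    "lie_br L (g_T \<alpha>) (g_N k a) = g_N k (mat_scale (- \<alpha> (k - 1)) a)" if "\<alpha> \<in> t2" for \<alpha> k a
    unfolding alg g_T_def g_P_def g_N_def using that
    by (simp_all add: g_br_d'_iota tri2_in_tri tri2_e three_add linear_scaleD[OF linear_j] tns_swap
        bilinear_minus_left[OF P.tns_bilinear] bilinear_minus_right[OF P.tns_bilinear])
  show "lie_br L (g_P k a) (g_P k b) = 0" "lie_br L (g_N k a) (g_N k b) = 0" for k a b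
    unfolding alg g_P_def g_N_def
    by (simp_all add: g_br_iota mult_S2_e t_elem_S2_e two theta_pow_def g_scale_def prod_scale_def)
      (simp_all add: fun_scale_def fun_eq_iff zero_prod_def scale_zero_right
        P.B.scale_zero_right[unfolded zero_prod_def])
  have iota_Suc: "g_br S S2 (g_iota (k + 2) (P.tns x z)) (g_iota (k + 1 + 2) (P.tns y w)) =
      g_iota (k + 2 + 2) (P.tns (ca_mult S x y) (ca_mult S2 z w))" for k x y and z w :: "'f \<times> 'f"
    using g_br_iota_Suc[of "k + 2" x z y w] by (simp add: three_add add.assoc add.commute[of 1 2])
  show "lie_br L (g_P k a) (g_P (k + 1) b) = g_N (k + 2) (mat_bar a ** mat_bar b)"
    "lie_br L (g_N k a) (g_N (k + 1) b) = g_P (k + 2) (mat_bar a ** mat_bar b)" for k a b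
    unfolding alg g_P_def g_N_def iota_Suc by (simp_all add: mult_S2_e mult_j)
  show "lie_br L (g_P k a) (g_N k c) = g_H (PN_H k a c) + g_T (PN_T k a c)" for k a c
  proof -
    \<comment> \<open>The triple of e+ and e- in S2 is (-1, 1/2, 1/2) on e+. The power k + 2 of
      \<theta> moves the entry -1 to position k - 1, and the polar form of a and c is the factor;
      the S-part has factor q(e+, e-) = 1.\<close>
    have "fun_scale (fun_scale (ca_scale S2)) (trace (mat_bar a ** c)) (theta_pow (k + 2) (tri2 (\<lambda>i. if i = 0 then - 1 else 1 / 2))) =
        tri2 (PN_T k a c)"
      by (auto simp: fun_eq_iff fun_scale_def theta_pow_def tri2_def PN_T_def S2_simps prod_scale_def three_add)
    moreover have "fun_scale (fun_scale (ca_scale S)) 1 (h (PN_H k a c)) = h (PN_H k a c)"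
      by (simp add: fun_scale_def)
    ultimately show ?thesis
      unfolding alg g_P_def g_N_def
      by (simp add: g_br_iota mult_S2_e t_elem_S2_e two polar_j t_j three_add g_scale_def prod_scale_def g_H_def g_T_def)
        (simp add: fun_eq_iff fun_scale_def scale_zero_right P.B.scale_zero_right)
  qed
  show "lie_br L (g_P k a) (g_N i c) = 0" if "i \<noteq> k" for i k a c
  proof -
    have "i = k + 1 \<or> k = i + 1"
      using that three_cases[of i] three_cases[of k] by (elim disjE) (simp_all add: three_eq_0 four_eq_1)
    then show ?thesis
    proof
      assume "i = k + 1"
      then show ?thesis
        unfolding alg g_P_def g_N_def by (simp only: iota_Suc mult_S2_e tns g_iota_linear)
    next
      assume "k = i + 1"
      then show ?thesis
        unfolding alg g_P_def g_N_def
        by (subst g_br_anti) (simp only: iota_Suc mult_S2_e tns g_iota_linear minus_zero)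
    qed
  qed
qed

end

section \<open>\<open>\<gg>(S\<^sub>4, S\<^sub>2)\<close> and its inclusion in \<open>\<gg>(S\<^sub>8, S\<^sub>2)\<close>\<close>

definition h4 :: "(3 \<Rightarrow> 'f::field^2^2) \<Rightarrow> 3 \<Rightarrow> 'f^2^2 \<Rightarrow> 'f^2^2" where
  "h4 A = (\<lambda>i a. A (i + 2) ** a - a ** A (i + 1))"

text \<open>The second summand involves \<open>A i\<close>, the one matrix that
  \<open>h4 A i\<close> leaves out. Side and sign are read off from the triple t of (a, 0) and (c,
  0), as \<open>t_elem_S8\<close> confirms.\<close>

definition h8 :: "(3 \<Rightarrow> 'f::field^2^2) \<Rightarrow> 3 \<Rightarrow> ('f^2^2) \<times> ('f^2^2) \<Rightarrow> ('f^2^2) \<times> ('f^2^2)" where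
  "h8 A = (\<lambda>i x. (h4 A i (fst x), - (snd x ** A i)))"

lemma mat_bar_traceless: "trace A = 0 \<Longrightarrow> mat_bar A = - (A :: 'f::field^2^2)"
  by (simp add: mat_bar_def mat2_simps)

lemmas mat_ring = mat_mult_linear mat_bar_linear mat_scale_linear mat2_minus mat_bar_mult mat_bar_bar
  matrix_mul_assoc

lemma h4_linear: "Vector_Spaces.linear mat_scale mat_scale (h4 A i)"
  by (rule linearI) (simp_all add: h4_def vector_space_mat_scale mat_ring)

lemma h8_linear: "Vector_Spaces.linear (prod_scale mat_scale mat_scale) (prod_scale mat_scale mat_scale) (h8 A i)"
  by (rule linearI)
    (simp_all add: h8_def h4_def vector_space_mat_scale vector_space_prod_scale mat_ring prod_scale_def)

text \<open>A matrix of trace 0 is minus its adjoint, so left and right multiplications by it are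
  skew for the polar form of the determinant; the right ones need cyclicity of the trace.\<close>

lemma trace_h4:
  assumes "\<forall>i. trace (A i) = 0"
  shows "trace (mat_bar (h4 A i x) ** y) + trace (mat_bar x ** h4 A i y) = 0"
proof -
  have "trace (A (i + 1) ** (mat_bar x ** y)) = trace (mat_bar x ** y ** A (i + 1))"
    by (rule trace_mul_sym)
  then show ?thesis
    using assms by (simp add: h4_def mat_ring mat_bar_traceless)
qed

lemma trace_h8:
  assumes "trace (A :: 'f::field^2^2) = 0"
  shows "trace (mat_bar (x ** A) ** y) + trace (mat_bar x ** (y ** A)) = 0"
proof -
  have "trace (A ** (mat_bar x ** y)) = trace (mat_bar x ** y ** A)"
    by (rule trace_mul_sym)
  then show ?thesis
    using assms by (simp add: mat_ring mat_bar_traceless)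
qed

lemma h4_tri: "\<forall>i. trace (A i) = 0 \<Longrightarrow> h4 A \<in> tri S4"
  by (auto simp: tri_def orth_def S4_simps h4_linear polar_S4 trace_h4)
    (simp add: h4_def three_eq_0 four_eq_1 mat_ring mat_bar_traceless)

lemma h8_tri: "\<forall>i. trace (A i) = 0 \<Longrightarrow> h8 A \<in> tri S8"
proof -
  assume A: "\<forall>i. trace (A i) = 0"
  have "polar S8 (h8 A i x) y + polar S8 x (h8 A i y) = 0" for i x y
  proof -
    have "polar S8 (h8 A i x) y + polar S8 x (h8 A i y) =
        (trace (mat_bar (h4 A i (fst x)) ** fst y) + trace (mat_bar (fst x) ** h4 A i (fst y))) +
        (trace (mat_bar (snd x ** A i) ** snd y) + trace (mat_bar (snd x) ** (snd y ** A i)))"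
      by (simp add: polar_S8 h8_def mat_mult_linear mat_bar_linear)
    then show ?thesis
      using trace_h4[OF A, of i "fst x" "fst y"] trace_h8[of "A i" "snd x" "snd y"] A by simp
  qed
  moreover have "h8 A 0 (ca_mult S8 x y) = ca_mult S8 (h8 A 1 x) y + ca_mult S8 x (h8 A 2 y)" for x y
    using A by (simp add: S8_simps cayley_mult_def cayley_bar_def h8_def h4_def prod_eq_iff three_eq_0 four_eq_1)
      (simp add: mat_ring mat_bar_traceless)
  ultimately show ?thesis
    using h8_linear[of A] by (simp add: tri_def orth_def S8_simps(1) del: split_paired_All)
qed

lemma all_three_fun_eq: "f = g \<longleftrightarrow> f k = g k \<and> f (k + 1) = g (k + 1) \<and> f (k + 2 :: 3) = g (k + 2)"
  unfolding fun_eq_iff[of f g] by (rule all_three)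

lemma mat_scale_half:
  "(2::'f::field) \<noteq> 0 \<Longrightarrow> mat_scale (r / 2) a + mat_scale (r / 2) a = mat_scale r (a :: 'f^2^2)"
  by (simp add: mat2_simps flip: distrib_right add_divide_distrib)

lemma t_elem_S4:
  fixes a c :: "'f::field^2^2"
  assumes two: "(2::'f) \<noteq> 0"
  shows "theta_pow i (t_elem S4 a c) = h4 (PN_H (i + 1) a c)"
  unfolding all_three_fun_eq[of _ _ i]
proof (intro conjI ext)
  fix z :: "'f^2^2"
  show "theta_pow i (t_elem S4 a c) i z = h4 (PN_H (i + 1) a c) i z"
  proof -
    let ?r = "trace (mat_bar a ** c)"
    \<comment> \<open>Entry i uses both nonzero matrices of \<open>PN_H\<close>, so their two half
      traces add up to a full trace. The remaining identity is a polarized form of the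
      Cayley-Hamilton relation and gives the map sigma of a and c.\<close>
    have "h4 (PN_H (i + 1) a c) i z =
        (c ** mat_bar a) ** z + z ** (mat_bar a ** c) - (mat_scale (?r / 2) z + mat_scale (?r / 2) z)"
      by (simp add: h4_def PN_H_def three_add mat_mult_linear mat_mult_mat)
    also have "\<dots> = mat_scale (trace (mat_bar a ** z)) c - mat_scale (trace (mat_bar c ** z)) a"
      unfolding mat_scale_half[OF two] by (simp add: mat2_simps algebra_simps)
    finally show ?thesis
      by (simp add: theta_pow_def t_elem_def S4_simps polar_S4)
  qed
  show "theta_pow i (t_elem S4 a c) (i + 1) z = h4 (PN_H (i + 1) a c) (i + 1) z"
    "theta_pow i (t_elem S4 a c) (i + 2) z = h4 (PN_H (i + 1) a c) (i + 2) z"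
    by (simp_all add: theta_pow_def t_elem_def h4_def PN_H_def S4_simps polar_S4 three_add mat_mult_mat mat_ring)
qed

lemma m2_calg_S4:
  assumes two: "(2::'f::field) \<noteq> 0"
  shows "m2_calg (S4 :: ('f, _) calg) fr4 crd4 (\<lambda>a. a) h4"
proof (intro m2_calg.intro framed_calg_S4[OF two] m2_calg_axioms.intro)
  show "Vector_Spaces.linear mat_scale (ca_scale (S4 :: ('f, _) calg)) (\<lambda>a. a)"
    by (rule linearI) (simp_all add: S4_simps vector_space_mat_scale)
  show "Vector_Spaces.linear (fun_scale mat_scale) (fun_scale (fun_scale (ca_scale (S4 :: ('f, _) calg)))) h4"
    by (rule linearI)
      (simp_all add: S4_simps vector_space_mat_scale vector_space_fun_scale h4_def fun_eq_iff fun_scale_def mat_ring)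
  show "commutator (h4 A i) (h4 B i) = h4 (\<lambda>i. A i ** B i - B i ** A i) i" for A B :: "3 \<Rightarrow> 'f^2^2" and i
    by (simp add: commutator_def h4_def fun_eq_iff mat_ring)
  show "h4 A i a = A (i + 2) ** a - a ** A (i + 1)" for A :: "3 \<Rightarrow> 'f^2^2" and i a
    by (simp add: h4_def)
qed (simp_all add: two h4_tri S4_simps polar_S4 t_elem_S4[OF two])

lemma t_elem_S8:
  fixes a c :: "'f::field^2^2"
  assumes two: "(2::'f) \<noteq> 0"
  shows "theta_pow i (t_elem S8 (a, 0) (c, 0)) = h8 (PN_H (i + 1) a c)"
proof -
  have z: "mat_bar 0 = (0 :: 'f^2^2)" "0 ** y = (0 :: 'f^2^2)" "y ** 0 = (0 :: 'f^2^2)" "mat_scale r 0 = (0 :: 'f^2^2)"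
    "trace (0 :: 'f^2^2) = 0" for y r
    by (simp_all add: mat2_simps)
  have 1: "fst (theta_pow i (t_elem S8 (a, 0) (c, 0)) m x) = theta_pow i (t_elem S4 a c) m (fst x)" for m x
    by (simp add: theta_pow_def t_elem_def S8_simps S4_simps polar_S8 polar_S4 cayley_mult_def cayley_bar_def prod_scale_def z)
  \<comment> \<open>The polarized norm identity: \<open>mat_bar a ** c + mat_bar c ** a\<close> is
    the scalar \<open>trace (mat_bar a ** c)\<close>.\<close>
  have key: "mat_scale (trace (mat_bar a ** c) / 2) y + mat_scale (trace (mat_bar a ** c) / 2) y =
      y ** mat_bar a ** c + y ** mat_bar c ** a" for y
    unfolding mat_scale_half[OF two] by (simp add: mat2_simps algebra_simps)
  have "snd (theta_pow i (t_elem S8 (a, 0) (c, 0)) m x) = - (snd x ** PN_H (i + 1) a c m)" for m x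
  proof -
    have "\<forall>m. snd (theta_pow i (t_elem S8 (a, 0) (c, 0)) m x) = - (snd x ** PN_H (i + 1) a c m)"
      unfolding all_three[of _ i] using key[of "snd x"]
      by (simp add: diff_eq_eq theta_pow_def t_elem_def PN_H_def S8_simps polar_S8 cayley_mult_def cayley_bar_def prod_scale_def z
          three_add mat_mult_mat mat_ring)
    then show ?thesis by blast
  qed
  with 1 show ?thesis
    unfolding t_elem_S4[OF two] by (simp add: fun_eq_iff h8_def prod_eq_iff del: split_paired_All)
qed

lemma m2_calg_S8:
  assumes two: "(2::'f::field) \<noteq> 0"
  shows "m2_calg (S8 :: ('f, _) calg) fr8 crd8 (\<lambda>a. (a, 0)) h8"
proof (intro m2_calg.intro framed_calg_S8[OF two] m2_calg_axioms.intro)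
  have z: "mat_bar 0 = (0 :: 'f^2^2)" "0 ** y = (0 :: 'f^2^2)" "y ** 0 = (0 :: 'f^2^2)" "mat_scale r 0 = (0 :: 'f^2^2)"
    "trace (0 :: 'f^2^2) = 0" for y r
    by (simp_all add: mat2_simps)
  show "Vector_Spaces.linear mat_scale (ca_scale (S8 :: ('f, _) calg)) (\<lambda>a. (a, 0))"
    by (rule linearI) (simp_all add: S8_simps vector_space_mat_scale vector_space_prod_scale, simp add: prod_scale_def z)
  show "Vector_Spaces.linear (fun_scale mat_scale) (fun_scale (fun_scale (ca_scale (S8 :: ('f, _) calg)))) h8"
    by (rule linearI, simp_all add: S8_simps vector_space_mat_scale vector_space_fun_scale vector_space_prod_scale)
      (simp_all add: h8_def h4_def fun_eq_iff fun_scale_def prod_scale_def mat_ring)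
  show "commutator (h8 A i) (h8 B i) = h8 (\<lambda>i. A i ** B i - B i ** A i) i" for A B :: "3 \<Rightarrow> 'f^2^2" and i
    by (simp add: commutator_def h8_def h4_def fun_eq_iff mat_ring)
  show "h8 A i (a, 0) = (A (i + 2) ** a - a ** A (i + 1), 0)" for A :: "3 \<Rightarrow> 'f^2^2" and i a
    by (simp add: h8_def h4_def z)
  show "ca_mult S8 (a, 0) (b, 0) = (mat_bar a ** mat_bar b, 0)" for a b :: "'f^2^2"
    by (simp add: S8_simps cayley_mult_def cayley_bar_def z)
  show "polar S8 (a, 0) (b, 0) = trace (mat_bar a ** b)" for a b :: "'f^2^2"
    by (simp add: polar_S8 z)
qed (simp_all add: two h8_tri t_elem_S8[OF two] zero_prod_def)

text \<open>The classical splitting of o(4) for the determinant form into left and right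
  multiplications by sl2, obtained by solving the skewness equations on matrix units.\<close>

lemma orth_S4:
  fixes d :: "'f::field^2^2 \<Rightarrow> 'f^2^2"
  assumes two: "(2::'f) \<noteq> 0" and d: "d \<in> orth S4"
  shows "\<exists>A B. trace A = 0 \<and> trace B = 0 \<and> d = (\<lambda>a. A ** a - a ** B)"
proof -
  interpret framed_space "mat_scale :: 'f \<Rightarrow> _" fr4 crd4
    using framed_space_S4[where 'f = 'f] unfolding S4_simps .
  have lin: "Vector_Spaces.linear mat_scale mat_scale d"
    and pol: "polar S4 (d x) y + polar S4 x (d y) = 0" for x y
    using d by (simp_all add: orth_def S4_simps)
  define m where "m p q = d (fr4 p) $ fst q $ snd q" for p q
  have dm: "d (fr4 p) = (\<chi> i j. m p (i, j))" for p
    by (simp add: m_def vec_eq_iff)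
  have P: "polar S4 (d (fr4 p)) (fr4 q) + polar S4 (fr4 p) (d (fr4 q)) = 0" for p q
    by (rule pol)
  note P' = P[unfolded dm polar_S4]
  have e: "m (1,1) (2,2) = 0" "m (2,2) (1,1) = 0" "m (1,2) (2,1) = 0" "m (2,1) (1,2) = 0"
    "m (2,2) (2,2) = - m (1,1) (1,1)" "m (2,1) (2,1) = - m (1,2) (1,2)"
    "m (1,2) (2,2) = m (1,1) (2,1)" "m (2,1) (2,2) = m (1,1) (1,2)"
    "m (1,2) (1,1) = m (2,2) (2,1)" "m (2,1) (1,1) = m (2,2) (1,2)"
    using P'[of "(1,1)" "(1,1)"] P'[of "(2,2)" "(2,2)"] P'[of "(1,2)" "(1,2)"] P'[of "(2,1)" "(2,1)"]
      P'[of "(1,1)" "(2,2)"] P'[of "(1,2)" "(2,1)"] P'[of "(1,1)" "(1,2)"] P'[of "(1,1)" "(2,1)"]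
      P'[of "(2,2)" "(1,2)"] P'[of "(2,2)" "(2,1)"] two
    by (simp_all add: mat2_simps fr4_def eq_neg_iff_add_eq_0 add.commute flip: mult_2)
  \<comment> \<open>If d(a) = A a - a B, the images of the two diagonal units show the off-diagonal
    entries of A and B. The first of them also gives A11 - B11, and the image of the unit at (1, 2)
    gives A11 - B22 = A11 + B11, whence the halves.\<close>
  define A :: "'f^2^2" where "A = (\<chi> i j. if i = 1 then if j = 1 then (m (1,1) (1,1) + m (1,2) (1,2)) / 2 else m (2,2) (1,2)
    else if j = 1 then m (1,1) (2,1) else - (m (1,1) (1,1) + m (1,2) (1,2)) / 2)"
  define B :: "'f^2^2" where "B = (\<chi> i j. if i = 1 then if j = 1 then (m (1,2) (1,2) - m (1,1) (1,1)) / 2 else - m (1,1) (1,2)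
    else if j = 1 then - m (2,2) (2,1) else (m (1,1) (1,1) - m (1,2) (1,2)) / 2)"
  have basis: "d (fr4 p) = A ** fr4 p - fr4 p ** B" for p
  proof -
    obtain i j where p: "p = (i, j)" by fastforce
    show ?thesis
      using exhaust_2[of i] exhaust_2[of j] two unfolding dm p
      by (elim disjE) (simp_all add: mat2_simps fr4_def A_def B_def e field_simps)
  qed
  have "d a = A ** a - a ** B" for a
  proof -
    have "Vector_Spaces.linear mat_scale mat_scale (\<lambda>a. A ** a - a ** B)"
      by (rule linearI) (simp_all add: vector_space_mat_scale mat_ring)
    from lin_ext_eq[OF this, of a] lin_ext_eq[OF lin, of a] show ?thesis
      unfolding basis by simp
  qed
  moreover have "trace A = 0" "trace B = 0"
    by (simp_all add: A_def B_def mat2_simps flip: add_divide_distrib)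
  ultimately show ?thesis by blast
qed

lemma mat2_central:
  fixes M :: "'f::field^2^2"
  assumes two: "(2::'f) \<noteq> 0" and c: "\<And>a. M ** a = a ** M" and tr: "trace M = 0"
  shows "M = 0"
  using c[of "\<chi> r s. if r = 1 \<and> s = 2 then 1 else 0"] c[of "\<chi> r s. if r = 2 \<and> s = 1 then 1 else 0"] tr two
  by (auto simp: mat2_simps simp flip: mult_2)

text \<open>Each entry of the triple is a pair (A i, B i) of traceless matrices, and the triality
  relation identifies these six in pairs: B (i + 1) = A i.\<close>

lemma tri_S4:
  fixes d :: "3 \<Rightarrow> 'f::field^2^2 \<Rightarrow> 'f^2^2"
  assumes two: "(2::'f) \<noteq> 0" and d: "d \<in> tri S4"
  shows "\<exists>A. (\<forall>i. trace (A i) = 0) \<and> d = h4 A"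
proof -
  have "\<forall>i. \<exists>A B. trace A = 0 \<and> trace B = 0 \<and> d i = (\<lambda>a. A ** a - a ** B)"
    using d orth_S4[OF two] by (simp add: tri_def)
  then obtain A B where tr: "\<And>i. trace (A i) = 0" "\<And>i. trace (B i) = 0"
    and d_eq: "\<And>i. d i = (\<lambda>a. A i ** a - a ** B i)"
    by metis
  have bar: "mat_bar (A i) = - A i" "mat_bar (B i) = - B i" for i
    using tr by (simp_all add: mat_bar_traceless)
  have *: "(A 0 - B 1) ** (x ** y) + x ** (A 1 - B 2) ** y + x ** y ** (A 2 - B 0) = 0" for x y
  proof -
    \<comment> \<open>Evaluation at adjoints turns the para-quaternion product into the ordinary
      matrix product.\<close>
    have "d 0 (ca_mult S4 (mat_bar x) (mat_bar y)) =
        ca_mult S4 (d 1 (mat_bar x)) (mat_bar y) + ca_mult S4 (mat_bar x) (d 2 (mat_bar y))"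
      using d by (simp add: tri_def)
    then show ?thesis
      unfolding d_eq by (simp add: S4_simps mat_ring bar algebra_simps)
  qed
  have 0: "A 0 - B 1 + (A 1 - B 2) + (A 2 - B 0) = 0"
    using *[of "mat 1" "mat 1"] by simp
  \<comment> \<open>With y = 1 the relation turns left multiplication by A 0 - B 1 into a right
    multiplication, and at x = y = 1 the two multipliers agree. So the matrix is central, and being
    traceless it is 0.\<close>
  have "(A 0 - B 1) ** a = a ** (A 0 - B 1)" for a
  proof -
    have "(A 0 - B 1) ** a = - (a ** (A 1 - B 2 + (A 2 - B 0)))"
      unfolding eq_neg_iff_add_eq_0 using *[of a "mat 1"] by (simp add: mat_ring add.assoc)
    moreover have "A 1 - B 2 + (A 2 - B 0) = - (A 0 - B 1)"
      using 0 by (simp add: algebra_simps eq_neg_iff_add_eq_0)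
    ultimately show ?thesis by (simp only: mat2_minus minus_minus)
  qed
  then have 1: "A 0 - B 1 = 0"
    by (rule mat2_central[OF two]) (simp add: mat_mult_linear tr)
  have "(A 2 - B 0) ** a = a ** (A 2 - B 0)" for a
  proof -
    have "a ** (A 2 - B 0) = - ((A 1 - B 2) ** a)"
      unfolding eq_neg_iff_add_eq_0 using *[of "mat 1" a] 1 by (simp add: mat_ring add.commute)
    moreover have "A 1 - B 2 = - (A 2 - B 0)"
      using 0 1 by (simp add: algebra_simps eq_neg_iff_add_eq_0)
    ultimately show ?thesis by (simp only: mat2_minus minus_minus)
  qed
  then have 2: "A 2 - B 0 = 0"
    by (rule mat2_central[OF two]) (simp add: mat_mult_linear tr)
  have 3: "A 1 - B 2 = 0" using 0 1 2 by simp
  have "d = h4 (\<lambda>i. A (i + 1))"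
  proof
    fix i show "d i = h4 (\<lambda>i. A (i + 1)) i"
      using three_cases[of i] 1 2 3
      by (elim disjE) (simp_all add: d_eq h4_def three_eq_0 four_eq_1)
  qed
  with tr show ?thesis by (intro exI[of _ "\<lambda>i. A (i + 1)"]) simp
qed

lemma tensor_space_E:
  fixes s :: "'f::field \<Rightarrow> 'a::ab_group_add \<Rightarrow> 'a"
  assumes s: "vector_space s" and X: "module.subspace s X"
    and u: "u \<in> tensor_space s E_scale X UNIV"
  shows "\<exists>x\<in>X. \<exists>y\<in>X. u = tensor s E_scale x (1, 0) + tensor s E_scale y (0, 1)"
proof -
  interpret s: vector_space s by fact
  interpret F: vector_space "fun_scale (*) :: 'f \<Rightarrow> (('a \<Rightarrow> 'f \<times> 'f \<Rightarrow> 'f) \<Rightarrow> 'f) \<Rightarrow> _"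
    by (intro vector_space_fun_scale vector_space_field)
  have E: "vector_space (E_scale :: 'f \<Rightarrow> _)"
    by (intro vector_space_prod_scale vector_space_field)
  note b = tensor_bilinear[OF s E]
  note bl = bilinear_add_left[OF b] bilinear_scale_left[OF b]
  let ?W = "{tensor s E_scale x (1, 0) + tensor s E_scale y (0, 1) | x y. x \<in> X \<and> y \<in> X}"
  have "F.subspace ?W"
  proof (rule F.subspaceI)
    show "0 \<in> ?W"
      using s.subspace_0[OF X] bilinear_zero_left[OF b] by (intro CollectI exI[of _ 0]) simp
    fix v w assume "v \<in> ?W" "w \<in> ?W"
    then obtain x y x' y' where xy: "v = tensor s E_scale x (1, 0) + tensor s E_scale y (0, 1)"
      "w = tensor s E_scale x' (1, 0) + tensor s E_scale y' (0, 1)" "x \<in> X" "y \<in> X" "x' \<in> X" "y' \<in> X" by blast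
    then show "v + w \<in> ?W"
      using s.subspace_add[OF X] by (intro CollectI exI[of _ "x + x'"] exI[of _ "y + y'"]) (simp add: bl)
    show "fun_scale (*) c v \<in> ?W" for c
      using xy s.subspace_scale[OF X]
      by (intro CollectI exI[of _ "s c x"] exI[of _ "s c y"]) (simp add: bl F.scale_right_distrib)
  qed
  moreover have "tensor s E_scale x z \<in> ?W" if "x \<in> X" for x z
  proof -
    have z: "z = E_scale (fst z) (1, 0) + E_scale (snd z) (0, 1)"
      by (simp add: prod_scale_def prod_eq_iff)
    have "tensor s E_scale x z = tensor s E_scale x (E_scale (fst z) (1, 0) + E_scale (snd z) (0, 1))"
      using z by simp
    also have "\<dots> = tensor s E_scale (s (fst z) x) (1, 0) + tensor s E_scale (s (snd z) x) (0, 1)"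
      by (simp only: bl bilinear_add_right[OF b] bilinear_scale_right[OF b])
    finally show ?thesis
      using s.subspace_scale[OF X that] by blast
  qed
  ultimately have "tensor_space s E_scale X UNIV \<subseteq> ?W"
    unfolding tensor_space_def by (intro F.span_minimal) auto
  with u show ?thesis by blast
qed

lemma (in m2_calg) g_iota_split:
  "g_iota i (P.tns (j a) x) = g_P (i + 1) (mat_scale (fst x) a) + g_N (i + 1) (mat_scale (snd x) a)"
proof -
  have "P.tns (j a) x = P.tns (j a) (ca_scale S2 (fst x) (1, 0) + ca_scale S2 (snd x) (0, 1))"
    by (simp add: S2_simps prod_scale_def)
  then show ?thesis
    unfolding g_P_def g_N_def
    by (simp add: three_add linear_scaleD[OF linear_j] bilinear_add_right[OF P.tns_bilinear]
        bilinear_scale_right[OF P.tns_bilinear] bilinear_scale_left[OF P.tns_bilinear] g_iota_linear)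
qed

section \<open>The presentation of g(S4, S2) and the natural inclusion\<close>

locale table_S4 =
  fixes F :: "'f::field itself"
  assumes two_neq_0: "(2::'f) \<noteq> 0"
begin

sublocale Q4: m2_calg "S4 :: ('f, 'f^2^2) calg" fr4 crd4 "\<lambda>a. a" h4
  by (rule m2_calg_S4[OF two_neq_0])

sublocale Q8: m2_calg "S8 :: ('f, _) calg" fr8 crd8 "\<lambda>a. (a, 0)" h8
  by (rule m2_calg_S8[OF two_neq_0])

sublocale T8: block_table "g_alg (S8 :: ('f, _) calg) (S2 :: ('f, _) calg)" Q8.g_H Q8.g_T Q8.g_P Q8.g_N
  by (rule Q8.block_table)

lemma block_table_onto: "block_table_onto (g_alg (S4 :: ('f, _) calg) (S2 :: ('f, _) calg)) Q4.g_H Q4.g_T Q4.g_P Q4.g_N"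
proof (intro block_table_onto.intro Q4.block_table block_table_onto_axioms.intro)
  fix x assume "x \<in> lie_space (g_alg (S4 :: ('f, _) calg) (S2 :: ('f, _) calg))"
  then obtain d d' u where x: "x = (d, d', u)" and d: "d \<in> tri S4" and d': "d' \<in> tri S2"
    and u: "\<And>i. u i \<in> tensor_space (ca_scale S4) (ca_scale S2) UNIV UNIV"
    by (auto simp: g_alg_def g_space_def)
  obtain A where A: "\<forall>i. trace (A i) = 0" "d = h4 A" using tri_S4[OF two_neq_0 d] by blast
  obtain \<alpha> where \<alpha>: "\<alpha> \<in> t2" "d' = tri2 \<alpha>" using tri_S2[OF two_neq_0 d'] by blast
  have "\<exists>f g. u i = Q4.P.tns f (1, 0) + Q4.P.tns g (0, 1)" for i
    using tensor_space_E[OF vector_space_mat_scale Q4.subspace_UNIV[unfolded S4_simps], of "u i"] u[of i]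
    by (simp add: S4_simps S2_simps)
  then obtain f g where fg: "\<And>i. u i = Q4.P.tns (f i) (1, 0) + Q4.P.tns (g i) (0, 1)" by metis
  let ?y = "Q4.g_H A + Q4.g_T \<alpha> + (\<Sum>k\<in>UNIV. Q4.g_P k (f (k + 2))) + (\<Sum>k\<in>UNIV. Q4.g_N k (g (k + 2)))"
  have "fst ?y = d" "fst (snd ?y) = d'"
    by (simp_all add: A \<alpha> Q4.g_H_def Q4.g_T_def Q4.g_P_def Q4.g_N_def g_iota_def fst_sum snd_sum)
  moreover have "snd (snd ?y) = u"
  proof
    fix i :: 3
    have "\<And>k. i = k + 2 \<longleftrightarrow> k = i + 1"
      using three_cases[of i] three_cases by (metis three_add(2,4))
    then show "snd (snd ?y) i = u i"
      by (simp add: fg Q4.g_H_def Q4.g_T_def Q4.g_P_def Q4.g_N_def g_iota_def fst_sum snd_sum sum_fun_apply three_add cong: if_cong)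
  qed
  ultimately have "x = ?y" by (simp add: x prod_eq_iff)
  with A(1) \<alpha>(1) show "\<exists>A \<alpha> f g. (\<forall>i. trace (A i) = 0) \<and> \<alpha> \<in> t2 \<and> x = Q4.g_H A + Q4.g_T \<alpha> +
      (\<Sum>k\<in>UNIV. Q4.g_P k (f k)) + (\<Sum>k\<in>UNIV. Q4.g_N k (g k))"
    by (intro exI[of _ A] exI[of _ \<alpha>] exI[of _ "\<lambda>k. f (k + 2)"] exI[of _ "\<lambda>k. g (k + 2)"] conjI)
qed

sublocale T4: block_table_onto "g_alg (S4 :: ('f, _) calg) (S2 :: ('f, _) calg)" Q4.g_H Q4.g_T Q4.g_P Q4.g_N
  by (rule block_table_onto)

text \<open>The embedding matches the two block presentations. Its value on a generator is found
  from a matrix having exactly that generator as its component, so it carries each table entry for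
  S4 to the same entry for S8.\<close>

lemma natural_inclusion_exists:
  "\<exists>f :: ('f, 'f^2^2, 'f \<times> 'f) g_elem \<Rightarrow> ('f, ('f^2^2) \<times> ('f^2^2), 'f \<times> 'f) g_elem. natural_inclusion f"
proof -
  obtain F where F: "lie_embedding F (g_alg (S4 :: ('f, _) calg) (S2 :: ('f, _) calg)) (g_alg S8 S2)" "\<And>X. F (T4.psi X) = T8.psi X"
    using T4.embedding_exists[OF T8.pgl_map_axioms] by blast
  have F_table: "F (Q4.g_H A + Q4.g_T \<alpha> + T4.PS f + T4.NS g) = Q8.g_H A + Q8.g_T \<alpha> + T8.PS f + T8.NS g"
    if A\<alpha>: "\<forall>i. trace (A i) = 0" "\<alpha> \<in> t2" for A \<alpha> f g
  proof -
    obtain X where X: "blk_H X = A" "blk_T X = \<alpha>" "blk_P X = f" "blk_N X = g"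
      "T4.psi X = Q4.g_H A + Q4.g_T \<alpha> + T4.PS f + T4.NS g"
      using T4.psi_components[OF A\<alpha>, of f g] by blast
    then show ?thesis using F(2)[of X] by (simp add: T8.psi_def)
  qed
  have z: "0 \<in> (t2 :: (3 \<Rightarrow> 'f) set)" "\<forall>i::3. trace (0 :: 'f^2^2) = 0" "\<forall>i::3. trace ((0 :: 3 \<Rightarrow> 'f^2^2) i) = 0"
    by (simp_all add: t2_def trace_def)
  have zero: "Q4.g_H 0 = 0" "Q8.g_H 0 = 0" "Q4.g_T 0 = 0" "Q8.g_T 0 = 0" "T4.PS 0 = 0" "T8.PS 0 = 0" "T4.NS 0 = 0" "T8.NS 0 = 0"
    by (simp_all add: T4.H.zero T8.H.zero T4.T.zero T8.T.zero T4.PS_def T8.PS_def T4.NS_def T8.NS_def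
        T4.P.zero T8.P.zero T4.N.zero T8.N.zero)
  note zero = zero zero[unfolded zero_fun_def]
  have single: "T4.PS (\<lambda>m. if m = k then a else 0) = Q4.g_P k a" "T8.PS (\<lambda>m. if m = k then a else 0) = Q8.g_P k a"
    "T4.NS (\<lambda>m. if m = k then a else 0) = Q4.g_N k a" "T8.NS (\<lambda>m. if m = k then a else 0) = Q8.g_N k a" for k a
    by (simp_all add: T4.PS_def T8.PS_def T4.NS_def T8.NS_def if_distrib[of "Q4.g_P _"] if_distrib[of "Q8.g_P _"]
        if_distrib[of "Q4.g_N _"] if_distrib[of "Q8.g_N _"] T4.P.zero T8.P.zero T4.N.zero T8.N.zero cong: if_cong)
  have F_H: "F (Q4.g_H A) = Q8.g_H A" if "\<forall>i. trace (A i) = 0" for A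
    using F_table[OF that z(1), of 0 0] by (simp add: zero)
  have F_T: "F (Q4.g_T \<alpha>) = Q8.g_T \<alpha>" if "\<alpha> \<in> t2" for \<alpha>
    using F_table[OF z(3) that, of 0 0] by (simp add: zero)
  have F_P: "F (Q4.g_P k a + Q4.g_N k c) = Q8.g_P k a + Q8.g_N k c" for k a c
    using F_table[OF z(3,1), of "\<lambda>m. if m = k then a else 0" "\<lambda>m. if m = k then c else 0"]
    by (simp add: zero single)
  have split4: "g_iota i (Q4.P.tns a x) = Q4.g_P (i + 1) (mat_scale (fst x) a) + Q4.g_N (i + 1) (mat_scale (snd x) a)" for i a x
    by (rule Q4.g_iota_split)
  have split8: "g_iota i (Q8.P.tns (a, 0) x) = Q8.g_P (i + 1) (mat_scale (fst x) a) + Q8.g_N (i + 1) (mat_scale (snd x) a)" for i a x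
    by (rule Q8.g_iota_split)
  have "natural_inclusion F"
    unfolding natural_inclusion_def
  proof (intro conjI allI ballI F(1))
    show "F (g_iota i (Q4.P.tns a x)) = g_iota i (Q8.P.tns (a, 0) x)" for i a x
      unfolding split4 split8 by (rule F_P)
    show "\<exists>e\<in>tri S8. F (d, 0, 0) = (e, 0, 0) \<and> (\<forall>i a. e i (a, 0) = (d i a, 0))" if d: "d \<in> tri S4" for d
    proof -
      obtain A where A: "\<forall>i. trace (A i) = 0" "d = h4 A" using tri_S4[OF two_neq_0 d] by blast
      have "F (d, 0, 0) = (h8 A, 0, 0)" using F_H[OF A(1)] by (simp add: A(2) Q4.g_H_def Q8.g_H_def)
      moreover have "h8 A i (a, 0) = (d i a, 0)" for i a
        using Q8.h_j[of A i a] by (simp add: A(2) h4_def)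
      ultimately show ?thesis using h8_tri[OF A(1)] by blast
    qed
    show "F (0, d, 0) = (0, d, 0)" if d: "d \<in> tri S2" for d
    proof -
      obtain \<alpha> where "\<alpha> \<in> t2" "d = tri2 \<alpha>" using tri_S2[OF two_neq_0 d] by blast
      then show ?thesis using F_T[of \<alpha>] by (simp add: Q4.g_T_def Q8.g_T_def)
    qed
  qed
  then show ?thesis by blast
qed

lemma split_simple_S4:
  assumes "(3::'f) \<noteq> 0"
  shows "split_simple_type_A 5 (g_alg (S4 :: ('f, _) calg) (S2 :: ('f, _) calg))"
proof (rule T4.split_simple_type_A[OF two_neq_0])
  show "(of_nat (Suc 5) :: 'f) \<noteq> 0" using no_zero_divisors[OF two_neq_0 assms] by simp
qed simp_all

end

section \<open>A two-dimensional symplectic space\<close>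

lemma bilinear_eq_on_span:
  assumes "bilinear_map s1 s2 s3 f" "bilinear_map s1 s2 s3 g"
    and "\<And>x y. x \<in> A \<Longrightarrow> y \<in> B \<Longrightarrow> f x y = g x y"
    and "x \<in> module.span s1 A" "y \<in> module.span s2 B"
  shows "f x y = g x y"
proof (rule linear_eq_on_span[of s1 s3 "\<lambda>x. f x y" "\<lambda>x. g x y" A])
  show "f x' y = g x' y" if "x' \<in> A" for x'
    by (rule linear_eq_on_span[of s2 s3 "f x'" "g x'" B])
      (use assms that in \<open>auto simp: bilinear_map_def\<close>)
qed (use assms in \<open>auto simp: bilinear_map_def\<close>)

section \<open>The nonempty index sets as edges of a triangle\<close>

definition edge :: "3 \<Rightarrow> 3 set" where "edge k = {k, k + 1}"

lemma edge_simps: "edge 1 = {1, 2}" "edge 2 = {2, 3}" "edge 0 = {1, 3}"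
  by (auto simp: edge_def three_eq_0)

lemma S_c3_eq: "S_c3 = insert {} (range edge)"
proof -
  have U: "(UNIV :: 3 set) = {1, 2, 0}"
    using three_cases by auto
  have "range edge = {edge 1, edge 2, edge 0}"
    unfolding U by simp
  then show ?thesis by (simp add: S_c3_def edge_simps)
qed

lemma edge_neq_empty: "edge k \<noteq> {}" by (simp add: edge_def)

lemma edge_eq_iff: "edge k = edge l \<longleftrightarrow> k = l"
proof
  assume e: "edge k = edge l"
  have "k = l \<or> k = l + 1" "k + 1 = l \<or> k + 1 = l + 1"
    using e unfolding edge_def by blast+
  then show "k = l"
    using three_neq[of l] by (auto simp: three_add)
qed simp

lemma edge_Int: "edge k \<inter> edge (k + 1) = {k + 1}" "edge (k + 1) \<inter> edge k = {k + 1}"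
  using three_neq[of k] by (auto simp: edge_def three_add)

text \<open>Two sides of a triangle add up to the third. In cyclic notation this replaces a
  distinction between the listed sets.\<close>

lemma edge_sym_diff: "sym_diff (edge k) (edge (k + 1)) = edge (k + 2)" "sym_diff (edge (k + 1)) (edge k) = edge (k + 2)"
  using three_neq[of k] by (auto simp: edge_def three_add)

text \<open>The entry of t2 that acts on an edge is the vertex opposite to it, the same position as
  for \<open>g_P\<close>.\<close>

lemma t2_index_edge: "t2_index (edge k) = k - 1"
proof -
  have "t2_index (edge 1) = 0" "t2_index (edge 2) = 1" "t2_index (edge 0) = 2"
    using edge_eq_iff[of 0 1] edge_eq_iff[of 0 2] edge_eq_iff[of 1 2] by (simp_all add: t2_index_def flip: edge_simps)
  then show ?thesis
    using three_cases[of k] by auto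
qed

lemma multilinear_form_cong:
  assumes "multilinear_form s \<sigma> B" "\<forall>i\<in>\<sigma>. v i = w i"
  shows "B v = B w"
  using assms(1)[unfolded multilinear_form_def, THEN conjunct1, THEN spec, THEN spec, THEN mp, OF assms(2)] .

text \<open>\<open>plane\<close> states that p and q form a basis, with coordinates
  \<open>b v q\<close> and \<open>b p v\<close>; this is how the dimension of V enters.\<close>

locale symplectic_plane = vector_space s
  for s :: "'f::field \<Rightarrow> 'v::ab_group_add \<Rightarrow> 'v" +
  fixes b :: "'v \<Rightarrow> 'v \<Rightarrow> 'f" and p q :: 'v
  assumes two: "(2::'f) \<noteq> 0"
    and b_bilinear: "bilinear_map s s (*) b"
    and b_anti: "b x y = - b y x"
    and b_pq: "b p q = 1"
    and plane: "s (b v q) p + s (b p v) q = v"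
begin

lemma b_self: "b x x = 0"
  using b_anti[of x x] two by (simp add: eq_neg_iff_add_eq_0 flip: mult_2)

lemma b_qp: "b q p = - 1" using b_anti[of q p] b_pq by simp

lemmas b_simps = bilinear_add_left[OF b_bilinear] bilinear_add_right[OF b_bilinear]
  bilinear_scale_left[OF b_bilinear] bilinear_scale_right[OF b_bilinear]
  bilinear_minus_left[OF b_bilinear] bilinear_minus_right[OF b_bilinear]
  bilinear_zero_left[OF b_bilinear] bilinear_zero_right[OF b_bilinear] b_self b_pq b_qp

definition fr :: "2 \<Rightarrow> 'v" where "fr r = (if r = 1 then p else q)"
definition crd :: "2 \<Rightarrow> 'v \<Rightarrow> 'f" where "crd r v = (if r = 1 then b v q else b p v)"

lemma linear_crd: "Vector_Spaces.linear s (*) (crd r)"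
  by (rule linearI) (simp_all add: crd_def vector_space_axioms vector_space_field b_simps)

sublocale V: framed_space s fr crd
proof (intro framed_space.intro framed_space_axioms.intro vector_space_axioms)
  show "Vector_Spaces.linear s (*) (crd r)" for r by (fact linear_crd)
  show "(\<Sum>k\<in>UNIV. s (crd k x) (fr k)) = x" for x
    by (simp add: sum_2 crd_def fr_def plane)
qed

lemma crd_fr: "crd r (fr t) = (if r = t then 1 else 0)"
  using exhaust_2[of r] exhaust_2[of t] by (auto simp: crd_def fr_def b_simps)

lemma b_crd: "b x y = crd 1 x * crd 2 y - crd 2 x * crd 1 y"
proof -
  have "b x y = b (s (b x q) p + s (b p x) q) (s (b y q) p + s (b p y) q)" by (simp only: plane)
  also have "\<dots> = crd 1 x * crd 2 y - crd 2 x * crd 1 y"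
    by (simp add: b_simps crd_def)
  finally show ?thesis .
qed

lemma vec_eqI:
  assumes "\<And>r. crd r x = crd r y"
  shows "x = y"
proof -
  have "(\<Sum>r\<in>UNIV. s (crd r x) (fr r)) = (\<Sum>r\<in>UNIV. s (crd r y) (fr r))"
    by (simp only: assms)
  then show ?thesis by (simp only: V.frame)
qed

definition of_mat :: "'f^2^2 \<Rightarrow> 'v \<Rightarrow> 'v" where
  "of_mat M v = (\<Sum>r\<in>UNIV. s (\<Sum>t\<in>UNIV. M $ r $ t * crd t v) (fr r))"

lemma crd_of_mat: "crd r (of_mat M v) = (\<Sum>t\<in>UNIV. M $ r $ t * crd t v)"
  using exhaust_2[of r]
  by (auto simp: of_mat_def sum_2 V.c_simps crd_fr)

lemma of_mat_linear: "Vector_Spaces.linear s s (of_mat M)"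
  by (rule linearI; (rule vec_eqI)?)
    (simp_all add: vector_space_axioms crd_of_mat V.c_simps sum_2 algebra_simps)

lemma of_mat_linear_mat: "Vector_Spaces.linear mat_scale (fun_scale s) of_mat"
  by (rule linearI; (rule ext, rule vec_eqI)?)
    (simp_all add: vector_space_axioms vector_space_fun_scale vector_space_mat_scale crd_of_mat V.c_simps fun_scale_apply
      mat_scale_def sum_2 algebra_simps)

lemma of_mat_mult: "of_mat (M ** N) v = of_mat M (of_mat N v)"
  by (rule vec_eqI) (simp add: crd_of_mat matrix_matrix_mult_def sum_2 algebra_simps)

lemma of_mat_eq_0: "of_mat M = 0 \<Longrightarrow> M = 0"
proof -
  assume 0: "of_mat M = 0"
  have "M $ r $ t = 0" for r t
    using arg_cong[OF fun_cong[OF 0, of "fr t"], of "crd r"] exhaust_2[of t]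
    by (auto simp: crd_of_mat crd_fr V.c_simps sum_2)
  then show ?thesis by (simp add: vec_eq_iff)
qed

text \<open>In dimension two the only nontrivial skewness condition is the one for the pair (p, q),
  and its left side is the trace.\<close>

lemma sp_eq: "sp s b = {of_mat M | M. trace M = 0}"
proof (intro equalityI subsetI)
  fix f assume "f \<in> sp s b"
  then have lin: "Vector_Spaces.linear s s f" and sk: "\<And>x y. b (f x) y + b x (f y) = 0"
    by (auto simp: sp_def)
  define M where "M = (\<chi> r t. crd r (f (fr t)))"
  have "f v = of_mat M v" for v
  proof -
    have "f v = (\<Sum>t\<in>UNIV. s (crd t v) (f (fr t)))"
      using V.lin_ext_eq[OF lin, of v] by (simp add: lin_ext_def)
    also have "\<dots> = of_mat M v"
      by (rule vec_eqI) (simp add: crd_of_mat M_def sum_2 V.c_simps mult.commute)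
    finally show ?thesis .
  qed
  moreover have "trace M = 0"
    using sk[of "fr 1" "fr 2"] by (simp add: trace_def sum_2 M_def b_crd crd_fr)
  ultimately show "f \<in> {of_mat M | M. trace M = 0}" by blast
next
  fix f assume "f \<in> {of_mat M | M. trace M = 0}"
  then obtain M where M: "f = of_mat M" "M $ 2 $ 2 = - M $ 1 $ 1"
    by (auto simp: trace_def sum_2 eq_neg_iff_add_eq_0 add.commute)
  then show "f \<in> sp s b"
    by (simp add: sp_def of_mat_linear b_crd crd_of_mat sum_2 algebra_simps)
qed

text \<open>\<open>v \<otimes> w\<close> is identified with the matrix of \<open>x \<mapsto> \<langle>v|x\<rangle> w\<close>.\<close>

definition mm :: "'v \<Rightarrow> 'v \<Rightarrow> 'f^2^2" where
  "mm v w = (\<chi> r t. crd r w * b v (fr t))"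

lemma mm_crd: "mm v w = (\<chi> r t. if t = 1 then - crd r w * crd 2 v else crd r w * crd 1 v)"
  by (simp add: mm_def vec_eq_iff forall_2 b_crd crd_fr)

text \<open>A matrix of trace 0 is skew for b, so it leaves the first argument of the form <v|x> as
  minus a multiplication on the right. The second factor is the output and receives A from the
  left.\<close>

lemma mm_of_mat: "trace A = 0 \<Longrightarrow> mm (of_mat A v) w = - (mm v w ** A)" "mm v (of_mat A w) = A ** mm v w"
proof -
  assume "trace A = 0"
  then have "A $ 2 $ 2 = - A $ 1 $ 1"
    by (simp add: trace_def sum_2 eq_neg_iff_add_eq_0 add.commute)
  then show "mm (of_mat A v) w = - (mm v w ** A)"
    by (simp add: mm_crd mat2_simps crd_of_mat algebra_simps)
qed (simp add: mm_crd mat2_simps crd_of_mat algebra_simps)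

text \<open>Factors in cyclic order, x at k and y at k + 1. For \<open>edge 0\<close> the first
  factor carries the index 3; as factors are labelled, this differs from increasing order in
  notation only.\<close>

definition it :: "3 \<Rightarrow> 'v \<Rightarrow> 'v \<Rightarrow> ('f, 'v) vs" where
  "it k x y = itensor s (edge k) (\<lambda>i. if i = k then x else y)"

lemma multilinear_form_crd: "multilinear_form s (edge k) (\<lambda>v. crd r (v k) * crd t (v (k + 1)))"
  unfolding multilinear_form_def
proof (intro conjI ballI allI)
  show "Vector_Spaces.linear s (*) (\<lambda>x. crd r ((v(i := x)) k) * crd t ((v(i := x)) (k + 1)))" if "i \<in> edge k" for i v
    by (rule linearI) (use that in \<open>auto simp: edge_def vector_space_axioms vector_space_field V.c_simps algebra_simps\<close>)
qed (auto simp: edge_def)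

lemma itensor_eq_it: "itensor s (edge k) v = it k (v k) (v (k + 1))"
proof -
  have "B v = B (\<lambda>i. if i = k then v k else v (k + 1))" if "multilinear_form s (edge k) B" for B
  proof -
    have "\<forall>i\<in>edge k. v i = (if i = k then v k else v (k + 1))" by (auto simp: edge_def)
    with that show ?thesis by (rule multilinear_form_cong)
  qed
  then show ?thesis by (auto simp: it_def itensor_def fun_eq_iff)
qed

lemma it_bilinear: "bilinear_map s s (fun_scale (*)) (it k)"
proof -
  have upd: "(\<lambda>i. if i = k then x else y) = (\<lambda>i. y)(k := x)" for x y :: 'v
    by auto
  have upd': "B (\<lambda>i. if i = k then x else y) = B ((\<lambda>i. x)(k + 1 := y))" if "multilinear_form s (edge k) B" for B and x y :: 'v
  proof -
    have "\<forall>i\<in>edge k. (if i = k then x else y) = ((\<lambda>i. x)(k + 1 := y)) i" by (auto simp: edge_def)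
    with that show ?thesis by (rule multilinear_form_cong)
  qed
  have lin: "Vector_Spaces.linear s (*) (\<lambda>x. B (\<lambda>i. if i = k then x else y))" if "multilinear_form s (edge k) B" for B y
    unfolding upd using that by (auto simp: multilinear_form_def edge_def)
  have lin': "Vector_Spaces.linear s (*) (\<lambda>y. B (\<lambda>i. if i = k then x else y))" if "multilinear_form s (edge k) B" for B x
    unfolding upd'[OF that] using that by (auto simp: multilinear_form_def edge_def)
  show ?thesis
    by (rule bilinear_mapI)
      (auto simp: vector_space_axioms vector_space_fun_scale vector_space_field it_def itensor_def fun_eq_iff fun_scale_apply
        linear_addD[OF lin] linear_addD[OF lin'] linear_scaleD[OF lin] linear_scaleD[OF lin'])
qed

lemmas it_simps = bilinear_add_left[OF it_bilinear] bilinear_add_right[OF it_bilinear]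
  bilinear_scale_left[OF it_bilinear] bilinear_scale_right[OF it_bilinear]

text \<open>The inverse of the identification \<open>mm\<close>, read off by evaluating the
  functional at products of coordinates and therefore linear on the whole type. The sign in column 1
  is that of \<open>b v p\<close>, which is minus the second coordinate of v.\<close>

definition mc :: "3 \<Rightarrow> ('f, 'v) vs \<Rightarrow> 'f^2^2" where
  "mc k u = (\<chi> r t. if t = 1 then - u (\<lambda>v. crd 2 (v k) * crd r (v (k + 1))) else u (\<lambda>v. crd 1 (v k) * crd r (v (k + 1))))"

lemma mc_linear: "Vector_Spaces.linear (fun_scale (*)) mat_scale (mc k)"
  by (rule linearI)
    (auto simp: vector_space_fun_scale vector_space_field vector_space_mat_scale mc_def vec_eq_iff fun_scale_def mat_scale_def)

lemma mc_it: "mc k (it k x y) = mm x y"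
  by (simp add: mc_def it_def itensor_def multilinear_form_crd mm_crd vec_eq_iff forall_2)

text \<open>A matrix unit in column 1 is \<open>mm\<close> of -q and a basis vector, one in column 2
  is \<open>mm\<close> of p and a basis vector.\<close>

definition ten :: "3 \<Rightarrow> 'f^2^2 \<Rightarrow> ('f, 'v) vs" where
  "ten k M = (\<Sum>r\<in>UNIV. fun_scale (*) (- M $ r $ 1) (it k q (fr r)) + fun_scale (*) (M $ r $ 2) (it k p (fr r)))"

lemma vector_space_vs: "vector_space (fun_scale (*) :: 'f \<Rightarrow> ('f, 'v) vs \<Rightarrow> _)"
  by (intro vector_space_fun_scale vector_space_field)

sublocale VS: vector_space "fun_scale (*) :: 'f \<Rightarrow> ('f, 'v) vs \<Rightarrow> _"
  by (fact vector_space_vs)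

lemma ten_linear: "Vector_Spaces.linear mat_scale (fun_scale (*)) (ten k)"
  by (rule linearI)
    (simp_all add: vector_space_mat_scale vector_space_vs ten_def sum_2 mat_scale_def VS.scale_left_distrib
      VS.scale_right_distrib VS.scale_left_diff_distrib VS.scale_right_diff_distrib)

lemma ten_mm: "ten k (mm x y) = it k x y"
proof -
  have "it k x y = it k (s (crd 1 x) p + s (crd 2 x) q) (s (crd 1 y) p + s (crd 2 y) q)"
    using plane by (simp add: crd_def)
  also have "\<dots> = ten k (mm x y)"
    by (simp add: ten_def sum_2 mm_crd fr_def it_simps VS.scale_right_distrib mult.commute add_ac)
  finally show ?thesis by simp
qed

lemma mc_ten: "mc k (ten k M) = M"
  by (simp add: ten_def linear_addD[OF mc_linear] linear_diffD[OF mc_linear] linear_sumD[OF mc_linear] linear_scaleD[OF mc_linear] mc_it sum_2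
      mc_it)
    (simp add: mm_crd mat2_simps crd_fr, simp add: crd_def b_simps)

lemma itensor_space_eq: "itensor_space s (edge k) = range (ten k)"
proof
  have "VS.subspace (range (ten k))"
  proof -
    interpret l: Vector_Spaces.linear mat_scale "fun_scale (*)" "ten k" by (rule ten_linear)
    show ?thesis by (rule l.subspace_image) (simp add: l.vs1.subspace_UNIV)
  qed
  moreover have "itensor s (edge k) v \<in> range (ten k)" for v
    unfolding itensor_eq_it ten_mm[symmetric] by blast
  ultimately show "itensor_space s (edge k) \<subseteq> range (ten k)"
    unfolding itensor_space_def by (intro VS.span_minimal) auto
  have "it k x y \<in> itensor_space s (edge k)" for x y
    unfolding itensor_space_def it_def by (intro VS.span_base) blast
  then show "range (ten k) \<subseteq> itensor_space s (edge k)"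
    unfolding ten_def itensor_space_def
    by (auto intro!: VS.span_sum VS.span_add VS.span_diff VS.span_scale)
qed

text \<open>The adjugate is the adjoint for b, so \<open>mat_bar (mm v w) = - mm w v\<close>.
  Composing x -> <w2|x> w1 with x -> <v1|x> v0 then contracts v1 with w1. The result belongs to the
  edge {k + 2, k}, again in cyclic order.\<close>

lemma mm_contract: "mat_scale (b v1 w1) (mm w2 v0) = mat_bar (mm v0 v1) ** mat_bar (mm w1 w2)"
  by (simp add: mm_crd mat2_simps b_crd algebra_simps)

lemma mm_polar: "trace (mat_bar (mm v0 v1) ** mm w0 w1) = b v0 w0 * b v1 w1"
  by (simp add: mm_crd mat2_simps b_crd algebra_simps)

text \<open>Contractions of tensors are products of the corresponding matrices.\<close>

lemma phi_off_edge:
  fixes k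
  defines "F \<equiv> \<lambda>u w. ten (k + 2) (mat_bar (mc k u) ** mat_bar (mc (k + 1) w))"
  assumes u: "u \<in> itensor_space s (edge k)" and w: "w \<in> itensor_space s (edge (k + 1))"
  shows "phi_off s b (edge k) (edge (k + 1)) u w = F u w"
    "phi_off s b (edge (k + 1)) (edge k) w u = - F u w"
proof -
  have F: "bilinear_map (fun_scale (*)) (fun_scale (*)) (fun_scale (*)) F"
    unfolding F_def
    by (rule bilinear_mapI)
      (simp_all add: vector_space_vs linear_addD[OF mc_linear] linear_scaleD[OF mc_linear] mat_ring
        linear_addD[OF ten_linear] linear_scaleD[OF ten_linear])
  \<comment> \<open>In the opposite order b receives the contracted vectors interchanged, which
    costs a sign.\<close>
  have F': "bilinear_map (fun_scale (*)) (fun_scale (*)) (fun_scale (*)) (\<lambda>w u. - F u w)"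
    by (rule bilinear_mapI) (simp_all add: vector_space_vs bilinear_add_left[OF F] bilinear_add_right[OF F]
        bilinear_scale_left[OF F] bilinear_scale_right[OF F])
  have F_it: "F (itensor s (edge k) v) (itensor s (edge (k + 1)) w) = fun_scale (*) (b (v (k + 1)) (w (k + 1))) (it (k + 2) (w (k + 2)) (v k))" for v w
    by (simp add: F_def itensor_eq_it mc_it mm_contract[symmetric] linear_scaleD[OF ten_linear] ten_mm three_add)
  let ?P = "\<lambda>f. bilinear_map (fun_scale (*)) (fun_scale (*)) (fun_scale (*)) f \<and>
     (\<forall>v w. f (itensor s (edge k) v) (itensor s (edge (k + 1)) w) =
        fun_scale (*) (\<Prod>i\<in>edge k \<inter> edge (k + 1). b (v i) (w i))
          (itensor s (sym_diff (edge k) (edge (k + 1))) (\<lambda>i. if i \<in> edge k then v i else w i)))"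
  let ?P' = "\<lambda>f. bilinear_map (fun_scale (*)) (fun_scale (*)) (fun_scale (*)) f \<and>
     (\<forall>v w. f (itensor s (edge (k + 1)) v) (itensor s (edge k) w) =
        fun_scale (*) (\<Prod>i\<in>edge (k + 1) \<inter> edge k. b (v i) (w i))
          (itensor s (sym_diff (edge (k + 1)) (edge k)) (\<lambda>i. if i \<in> edge (k + 1) then v i else w i)))"
  have "?P F"
    unfolding edge_Int edge_sym_diff itensor_eq_it[of "k + 2"] using F F_it three_neq[of k]
    by (simp add: three_add) (simp add: edge_def)
  then have f: "?P (phi_off s b (edge k) (edge (k + 1)))"
    unfolding phi_off_def by (rule someI[of ?P])
  have "?P' (\<lambda>w u. - F u w)"
    unfolding edge_Int edge_sym_diff itensor_eq_it[of "k + 2"] using F' F_it three_neq[of k]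
    by (simp add: three_add, subst b_anti) (simp add: edge_def three_add)
  then have f': "?P' (phi_off s b (edge (k + 1)) (edge k))"
    unfolding phi_off_def by (rule someI[of ?P'])
  show "phi_off s b (edge k) (edge (k + 1)) u w = F u w"
    by (rule bilinear_eq_on_span[OF conjunct1[OF f] F _ u[unfolded itensor_space_def] w[unfolded itensor_space_def]])
      (use f \<open>?P F\<close> in auto)
  show "phi_off s b (edge (k + 1)) (edge k) w u = - F u w"
    by (rule bilinear_eq_on_span[OF conjunct1[OF f'] F' _ w[unfolded itensor_space_def] u[unfolded itensor_space_def]])
      (use f' \<open>?P' (\<lambda>w u. - F u w)\<close> in auto)
qed

text \<open>The map x -> <w|x> v is one half of \<open>gam s b v w\<close> plus a scalar. The factor
  -1/2 in \<open>phi_diag\<close> therefore produces exactly the traceless parts of the two products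
  in \<open>PN_H\<close>, up to sign.\<close>

lemma phi_diag_itensor:
  "phi_diag s b (edge k) (itensor s (edge k) v) (itensor s (edge k) w) =
    (\<lambda>i. - of_mat (PN_H k (mm (v k) (v (k + 1))) (mm (w k) (w (k + 1))) i))"
proof -
  define F where "F u w = (\<lambda>i. - of_mat (PN_H k (mc k u) (mc k w) i))" for u w
  have F: "bilinear_map (fun_scale (*)) (fun_scale (*)) (fun_scale (fun_scale s)) F"
  proof -
    have PN: "PN_H k (a + a') c = PN_H k a c + PN_H k a' c" "PN_H k a (c + c') = PN_H k a c + PN_H k a c'"
      "PN_H k (mat_scale r a) c = fun_scale mat_scale r (PN_H k a c)" "PN_H k a (mat_scale r c) = fun_scale mat_scale r (PN_H k a c)"
      for a a' c c' :: "'f^2^2" and r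
      by (auto simp: PN_H_def fun_eq_iff fun_scale_def) (simp_all add: mat2_simps algebra_simps add_divide_distrib diff_divide_distrib)
    show ?thesis
      unfolding F_def
      by (rule bilinear_mapI)
        (simp_all add: vector_space_vs vector_space_fun_scale vector_space_axioms linear_addD[OF mc_linear] linear_scaleD[OF mc_linear]
          PN linear_addD[OF of_mat_linear_mat] linear_scaleD[OF of_mat_linear_mat] fun_eq_iff fun_scale_apply scale_minus_right)
  qed
  let ?P = "\<lambda>f. bilinear_map (fun_scale (*)) (fun_scale (*)) (fun_scale (fun_scale s)) f \<and>
     (\<forall>v w. f (itensor s (edge k) v) (itensor s (edge k) w) =
        fun_scale (fun_scale s) (- 1 / 2)
          (\<Sum>i\<in>edge k. fun_scale (fun_scale s) (\<Prod>j\<in>edge k - {i}. b (v j) (w j))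
             (nu_inc i (gam s b (v i) (w i)))))"
  have "?P F"
  proof (intro conjI allI F)
    fix v w
    have diff: "edge k - {k} = {k + 1}" "edge k - {k + 1} = {k}" using three_neq[of k] by (auto simp: edge_def)
    have sum: "(\<Sum>i\<in>edge k. G i) = G k + G (k + 1)" for G :: "3 \<Rightarrow> 3 \<Rightarrow> 'v \<Rightarrow> 'v"
      by (simp add: edge_def)
    show "F (itensor s (edge k) v) (itensor s (edge k) w) =
        fun_scale (fun_scale s) (- 1 / 2)
          (\<Sum>i\<in>edge k. fun_scale (fun_scale s) (\<Prod>j\<in>edge k - {i}. b (v j) (w j))
             (nu_inc i (gam s b (v i) (w i))))" (is "?l = ?r")
    proof (intro ext vec_eqI)
      fix i x r
      have "i = k \<or> i = k + 1 \<or> i = k + 2"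
        using three_cases[of i] three_cases[of k] by (elim disjE) (simp_all add: three_eq_0 four_eq_1)
      moreover have "(4::'f) \<noteq> 0" using no_zero_divisors[OF two two] by simp
      ultimately show "crd r (?l i x) = crd r (?r i x)"
        using exhaust_2[of r] two
        by (elim disjE)
          (simp_all add: sum diff diff[unfolded add.commute[of k 1]] F_def itensor_eq_it mc_it PN_H_def nu_inc_def gam_def fun_scale_apply V.c_simps crd_of_mat
            mm_crd mat2_simps b_crd field_simps)
    qed
  qed
  then have "?P (phi_diag s b (edge k))"
    unfolding phi_diag_def by (rule someI[of ?P])
  with \<open>?P F\<close> have "phi_diag s b (edge k) (itensor s (edge k) v) (itensor s (edge k) w) = F (itensor s (edge k) v) (itensor s (edge k) w)"
    by auto
  then show ?thesis by (simp add: F_def itensor_eq_it mc_it)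
qed

end

section \<open>The spaces V(sigma) tensor E and the maps on them\<close>

context symplectic_plane
begin

lemma vector_space_vse: "vector_space (fun_scale (*) :: 'f \<Rightarrow> ('f, 'v) vse \<Rightarrow> _)"
  by (intro vector_space_fun_scale vector_space_field)

lemma vector_space_E: "vector_space (E_scale :: 'f \<Rightarrow> _)"
  by (intro vector_space_prod_scale vector_space_field)

sublocale VSE: vector_space "fun_scale (*) :: 'f \<Rightarrow> ('f, 'v) vse \<Rightarrow> _"
  by (fact vector_space_vse)

lemmas VE_bilinear = tensor_bilinear[OF vector_space_vs vector_space_E]
lemmas VE_simps = bilinear_add_left[OF VE_bilinear] bilinear_add_right[OF VE_bilinear]
  bilinear_scale_left[OF VE_bilinear] bilinear_scale_right[OF VE_bilinear]

definition VEP :: "3 \<Rightarrow> 'f^2^2 \<Rightarrow> ('f, 'v) vse" where "VEP k a = VE_tensor (ten k a) (1, 0)"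
definition VEN :: "3 \<Rightarrow> 'f^2^2 \<Rightarrow> ('f, 'v) vse" where "VEN k a = VE_tensor (ten k a) (0, 1)"

lemma VEP_linear: "Vector_Spaces.linear mat_scale (fun_scale (*)) (VEP k)"
  and VEN_linear: "Vector_Spaces.linear mat_scale (fun_scale (*)) (VEN k)"
  unfolding VEP_def[abs_def] VEN_def[abs_def]
  by (rule linearI; simp add: vector_space_mat_scale vector_space_vse linear_addD[OF ten_linear] linear_scaleD[OF ten_linear] VE_simps)+

lemmas VEP_simps = linear_addD[OF VEP_linear] linear_scaleD[OF VEP_linear] linear_minusD[OF VEP_linear]
  linear_diffD[OF VEP_linear] linear_zeroD[OF VEP_linear]
  linear_addD[OF VEN_linear] linear_scaleD[OF VEN_linear] linear_minusD[OF VEN_linear]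
  linear_diffD[OF VEN_linear] linear_zeroD[OF VEN_linear]

text \<open>\<open>mcP k\<close> and \<open>mcN k\<close> extract the coefficients of \<open>e\<^sup>+\<close> and \<open>e\<^sup>-\<close>, as matrices.\<close>

definition mcP :: "3 \<Rightarrow> ('f, 'v) vse \<Rightarrow> 'f^2^2" where
  "mcP k U = (\<chi> r t. U (\<lambda>x z. mc k x $ r $ t * fst z))"
definition mcN :: "3 \<Rightarrow> ('f, 'v) vse \<Rightarrow> 'f^2^2" where
  "mcN k U = (\<chi> r t. U (\<lambda>x z. mc k x $ r $ t * snd z))"

lemma mcP_linear: "Vector_Spaces.linear (fun_scale (*)) mat_scale (mcP k)"
  and mcN_linear: "Vector_Spaces.linear (fun_scale (*)) mat_scale (mcN k)"
  by (rule linearI; simp add: vector_space_mat_scale vector_space_vse mcP_def mcN_def vec_eq_iff fun_scale_def mat_scale_def)+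

lemmas mcP_simps = linear_addD[OF mcP_linear] linear_scaleD[OF mcP_linear] linear_minusD[OF mcP_linear]
  linear_diffD[OF mcP_linear] linear_zeroD[OF mcP_linear]
  linear_addD[OF mcN_linear] linear_scaleD[OF mcN_linear] linear_minusD[OF mcN_linear]
  linear_diffD[OF mcN_linear] linear_zeroD[OF mcN_linear]

lemma mcP_VE: "mcP k (VE_tensor x z) = mat_scale (fst z) (mc k x)"
  and mcN_VE: "mcN k (VE_tensor x z) = mat_scale (snd z) (mc k x)"
proof -
  have "bilinear_map (fun_scale (*)) E_scale (*) (\<lambda>x z. mc k x $ r $ t * fst z)"
    "bilinear_map (fun_scale (*)) E_scale (*) (\<lambda>x z. mc k x $ r $ t * snd z)" for r t
    by (rule bilinear_mapI; simp add: vector_space_vs vector_space_E vector_space_field linear_addD[OF mc_linear]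
        linear_scaleD[OF mc_linear] mat_scale_def prod_scale_def algebra_simps)+
  then show "mcP k (VE_tensor x z) = mat_scale (fst z) (mc k x)" "mcN k (VE_tensor x z) = mat_scale (snd z) (mc k x)"
    by (simp_all add: mcP_def mcN_def tensor_def vec_eq_iff mat_scale_def mult.commute)
qed

lemma mat_scale_0_1: "mat_scale 0 a = 0" "mat_scale 1 a = (a :: 'f^2^2)"
  by (simp_all add: mat_scale_def vec_eq_iff)

lemma mc_VEP: "mcP k (VEP k a) = a" "mcN k (VEP k a) = 0" "mcP k (VEN k a) = 0" "mcN k (VEN k a) = a"
  by (simp_all add: VEP_def VEN_def mcP_VE mcN_VE mc_ten mat_scale_0_1)

definition W :: "3 \<Rightarrow> ('f, 'v) vse set" where
  "W k = tensor_space (fun_scale (*)) E_scale (itensor_space s (edge k)) UNIV"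

lemma W_eq: "W k = {VEP k a + VEN k c | a c. True}"
proof
  have "module.subspace (fun_scale (*)) (itensor_space s (edge k))"
    unfolding itensor_space_def by (rule VS.subspace_span)
  from tensor_space_E[OF vector_space_vs this] show "W k \<subseteq> {VEP k a + VEN k c | a c. True}"
    unfolding W_def VEP_def VEN_def itensor_space_eq by fastforce
  have "VEP k a \<in> W k" "VEN k a \<in> W k" for a
    unfolding W_def VEP_def VEN_def itensor_space_eq by (auto intro!: tensor_in_space)
  then show "{VEP k a + VEN k c | a c. True} \<subseteq> W k"
    unfolding W_def by (auto intro!: VSE.subspace_add[OF subspace_tensor_space])
qed

lemma W_subspace: "VSE.subspace (W k)"
  unfolding W_def by (rule subspace_tensor_space)

lemma VEP_in_W: "VEP k a \<in> W k" "VEN k a \<in> W k"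
  unfolding W_def VEP_def VEN_def itensor_space_eq by (auto intro!: tensor_in_space)

definition gens :: "3 \<Rightarrow> ('f, 'v) vse set" where
  "gens k = {VE_tensor (itensor s (edge k) v) (e_sgn \<nu>) | v \<nu>. \<nu> \<in> {1, - 1}}"

lemma VE_itensor: "VE_tensor (itensor s (edge k) v) (1, 0) = VEP k (mm (v k) (v (k + 1)))"
  "VE_tensor (itensor s (edge k) v) (0, 1) = VEN k (mm (v k) (v (k + 1)))"
  by (simp_all add: VEP_def VEN_def ten_mm itensor_eq_it)

lemma VE_itensor_z: "VE_tensor (itensor s (edge k) v) z =
    VEP k (mat_scale (fst z) (mm (v k) (v (k + 1)))) + VEN k (mat_scale (snd z) (mm (v k) (v (k + 1))))"
proof -
  have "z = E_scale (fst z) (1, 0) + E_scale (snd z) (0, 1)" by (simp add: prod_scale_def)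
  then have "VE_tensor (itensor s (edge k) v) z = VE_tensor (itensor s (edge k) v) (E_scale (fst z) (1, 0) + E_scale (snd z) (0, 1))"
    by simp
  then show ?thesis by (simp only: VE_simps VE_itensor VEP_simps)
qed

lemma e_sgn_simps: "e_sgn 1 = (1, 0)" "e_sgn (- 1) = (0, 1)"
  by (simp_all add: e_sgn_def)

lemma W_span: "W k = VSE.span (gens k)"
proof
  have g: "VE_tensor (it k x y) (1, 0) \<in> gens k" "VE_tensor (it k x y) (0, 1) \<in> gens k" for x y
    unfolding gens_def it_def e_sgn_simps(1,2)[symmetric] by blast+
  have "VEP k a \<in> VSE.span (gens k)" "VEN k a \<in> VSE.span (gens k)" for a
    unfolding VEP_def VEN_def ten_def sum_2 VE_simps
    by (intro VSE.span_add VSE.span_scale VSE.span_base g)+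
  then show "W k \<subseteq> VSE.span (gens k)"
    unfolding W_eq by (auto intro!: VSE.span_add)
  show "VSE.span (gens k) \<subseteq> W k"
    by (rule VSE.span_minimal[OF _ W_subspace]) (auto simp: gens_def e_sgn_simps VE_itensor VEP_in_W)
qed

lemma W_bilinear_eq:
  assumes "bilinear_map (fun_scale (*)) (fun_scale (*)) s3 f" "bilinear_map (fun_scale (*)) (fun_scale (*)) s3 g"
    and "\<And>v w \<nu> \<nu>'. \<nu> \<in> {1, - 1} \<Longrightarrow> \<nu>' \<in> {1, - 1} \<Longrightarrow>
      f (VE_tensor (itensor s (edge k) v) (e_sgn \<nu>)) (VE_tensor (itensor s (edge l) w) (e_sgn \<nu>')) =
      g (VE_tensor (itensor s (edge k) v) (e_sgn \<nu>)) (VE_tensor (itensor s (edge l) w) (e_sgn \<nu>'))"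
    and "U \<in> W k" "U' \<in> W l"
  shows "f U U' = g U U'"
  by (rule bilinear_eq_on_span[OF assms(1,2) _ assms(4,5)[unfolded W_span]]) (use assms(3) in \<open>auto simp: gens_def\<close>)

lemma VE_act_eq:
  assumes A: "\<forall>i. trace (A i) = 0" and U: "U \<in> W k"
  shows "VE_act s (edge k) (\<lambda>i. of_mat (A i)) \<alpha> U =
    VEP k (A (k + 1) ** mcP k U - mcP k U ** A k + mat_scale (\<alpha> (k - 1)) (mcP k U)) +
    VEN k (A (k + 1) ** mcN k U - mcN k U ** A k - mat_scale (\<alpha> (k - 1)) (mcN k U))"
proof -
  define F where "F U = VEP k (A (k + 1) ** mcP k U - mcP k U ** A k + mat_scale (\<alpha> (k - 1)) (mcP k U)) +
    VEN k (A (k + 1) ** mcN k U - mcN k U ** A k - mat_scale (\<alpha> (k - 1)) (mcN k U))" for U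
  let ?P = "\<lambda>f. Vector_Spaces.linear (fun_scale (*)) (fun_scale (*)) f \<and>
     (\<forall>v z. f (VE_tensor (itensor s (edge k) v) z) =
        VE_tensor (\<Sum>i\<in>edge k. itensor s (edge k) (v(i := of_mat (A i) (v i)))) z +
        VE_tensor (itensor s (edge k) v) (E_act (edge k) \<alpha> z))"
  have mat_scale_comm: "mat_scale x (mat_scale y a) = mat_scale y (mat_scale x a)" for x y and a :: "'f^2^2"
    by (simp add: mat_scale_def vec_eq_iff)
  have lin: "Vector_Spaces.linear (fun_scale (*)) (fun_scale (*)) F"
    unfolding F_def
    by (rule linearI)
      (simp_all add: vector_space_vse mcP_simps mat_ring VEP_simps VSE.scale_right_distrib VSE.scale_right_diff_distrib
        mat_scale_comm[of "\<alpha> _"] mult.commute)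
  have "F (VE_tensor (itensor s (edge k) v) z) =
        VE_tensor (\<Sum>i\<in>edge k. itensor s (edge k) (v(i := of_mat (A i) (v i)))) z +
        VE_tensor (itensor s (edge k) v) (E_act (edge k) \<alpha> z)" for v z
  proof -
    let ?m = "mm (v k) (v (k + 1))"
    have sum: "(\<Sum>i\<in>edge k. G i) = G k + G (k + 1)" for G :: "3 \<Rightarrow> ('f, 'v) vs"
      by (simp add: edge_def)
    have "(\<Sum>i\<in>edge k. itensor s (edge k) (v(i := of_mat (A i) (v i)))) = ten k (A (k + 1) ** ?m - ?m ** A k)"
      unfolding sum itensor_eq_it using A
      by (simp add: ten_mm[symmetric] mm_of_mat linear_diffD[OF ten_linear] linear_minusD[OF ten_linear])
    moreover have "VE_tensor (ten k M) z = VEP k (mat_scale (fst z) M) + VEN k (mat_scale (snd z) M)" for M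
    proof -
      have "VE_tensor (ten k M) z = VE_tensor (ten k M) (E_scale (fst z) (1, 0) + E_scale (snd z) (0, 1))"
        by (simp add: prod_scale_def)
      then show ?thesis by (simp only: VE_simps VEP_def VEN_def linear_scaleD[OF ten_linear])
    qed
    moreover have "fst (E_act (edge k) \<alpha> z) = \<alpha> (k - 1) * fst z" "snd (E_act (edge k) \<alpha> z) = - (\<alpha> (k - 1) * snd z)"
      by (simp_all add: E_act_def t2_index_edge)
    moreover have "mat_scale x (mat_scale y a) = mat_scale (x * y) a" for x y and a :: "'f^2^2"
      by (simp add: mat_scale_def vec_eq_iff mult.assoc)
    moreover have "mcP k (VE_tensor (itensor s (edge k) v) z) = mat_scale (fst z) ?m"
      "mcN k (VE_tensor (itensor s (edge k) v) z) = mat_scale (snd z) ?m"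
      by (simp_all add: mcP_VE mcN_VE itensor_eq_it mc_it)
    ultimately show ?thesis
      by (simp add: F_def VE_itensor_z mat_mult_linear(5,6) mat_scale_linear VEP_simps mat_scale_minus
        VSE.scale_right_distrib VSE.scale_right_diff_distrib VSE.scale_minus_right)
  qed
  then have PF: "?P F" using lin by blast
  then have P: "?P (VE_act s (edge k) (\<lambda>i. of_mat (A i)) \<alpha>)"
    unfolding VE_act_def by (rule someI[of ?P])
  have "VE_act s (edge k) (\<lambda>i. of_mat (A i)) \<alpha> (VE_tensor (itensor s (edge k) v) z) =
      F (VE_tensor (itensor s (edge k) v) z)" for v z
    by (simp only: conjunct2[OF P, rule_format] conjunct2[OF PF, rule_format])
  then have "VE_act s (edge k) (\<lambda>i. of_mat (A i)) \<alpha> U = F U"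
    by (intro linear_eq_on_span[OF conjunct1[OF P] lin _ U[unfolded W_span]]) (auto simp: gens_def e_sgn_simps)
  then show ?thesis by (simp add: F_def)
qed

text \<open>\<open>PN_H\<close> is antisymmetric and \<open>PN_T\<close> symmetric in the two
  matrices. Interchanging e+ and e- thus affects the sign of the t2-part alone, which accounts for
  the coefficient \<nu>. The overall minus sign is later absorbed by \<open>eps_a5\<close>.\<close>

lemma tphi_diag_eq:
  assumes U: "U \<in> W k" "U' \<in> W k"
  shows "tphi_diag s b (edge k) U U' =
    (\<lambda>i. - of_mat ((PN_H k (mcP k U) (mcN k U') - PN_H k (mcP k U') (mcN k U)) i),
     - (PN_T k (mcP k U) (mcN k U') - PN_T k (mcP k U') (mcN k U)))"
proof -
  define F where "F U U' = (\<lambda>i. - of_mat ((PN_H k (mcP k U) (mcN k U') - PN_H k (mcP k U') (mcN k U)) i),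
     - (PN_T k (mcP k U) (mcN k U') - PN_T k (mcP k U') (mcN k U)))" for U U'
  let ?s3 = "prod_scale (fun_scale (fun_scale s)) (fun_scale (*)) :: 'f \<Rightarrow> (3 \<Rightarrow> 'v \<Rightarrow> 'v) \<times> (3 \<Rightarrow> 'f) \<Rightarrow> _"
  let ?P = "\<lambda>f. bilinear_map (fun_scale (*)) (fun_scale (*)) ?s3 f \<and>
     (\<forall>v w. \<forall>\<nu>\<in>{1, - 1}. \<forall>\<nu>'\<in>{1, - 1}.
        f (VE_tensor (itensor s (edge k) v) (e_sgn \<nu>)) (VE_tensor (itensor s (edge k) w) (e_sgn \<nu>')) =
          (if \<nu> = - \<nu>'
           then (phi_diag s b (edge k) (itensor s (edge k) v) (itensor s (edge k) w),
                 fun_scale (*) (of_int \<nu> * (\<Prod>i\<in>edge k. b (v i) (w i))) (a_elem (edge k)))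
           else 0))"
  have PN: "PN_H k (a + a') c = PN_H k a c + PN_H k a' c" "PN_H k a (c + c') = PN_H k a c + PN_H k a c'"
      "PN_H k (mat_scale r a) c = fun_scale mat_scale r (PN_H k a c)" "PN_H k a (mat_scale r c) = fun_scale mat_scale r (PN_H k a c)"
      "PN_H k 0 c = 0" "PN_H k a 0 = 0"
      "PN_T k (a + a') c = PN_T k a c + PN_T k a' c" "PN_T k a (c + c') = PN_T k a c + PN_T k a c'"
      "PN_T k (mat_scale r a) c = fun_scale (*) r (PN_T k a c)" "PN_T k a (mat_scale r c) = fun_scale (*) r (PN_T k a c)"
      "PN_T k 0 c = 0" "PN_T k a 0 = 0"
    for a a' c c' :: "'f^2^2" and r
    by (auto simp: PN_H_def PN_T_def fun_eq_iff fun_scale_def) (simp_all add: mat2_simps algebra_simps add_divide_distrib diff_divide_distrib)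
  have ofm: "of_mat (a + a') = of_mat a + of_mat a'" "of_mat (a - a') = of_mat a - of_mat a'" "of_mat (- a) = - of_mat a"
    "of_mat (mat_scale r a) = fun_scale s r (of_mat a)" "of_mat 0 = 0" for a a' r
    using linear_addD[OF of_mat_linear_mat] linear_diffD[OF of_mat_linear_mat] linear_minusD[OF of_mat_linear_mat]
      linear_scaleD[OF of_mat_linear_mat] linear_zeroD[OF of_mat_linear_mat] by auto
  have lin: "bilinear_map (fun_scale (*)) (fun_scale (*)) ?s3 F"
    unfolding F_def
    by (rule bilinear_mapI)
      (simp_all add: vector_space_vse vector_space_prod_scale vector_space_fun_scale vector_space_axioms vector_space_field
        mcP_simps PN ofm prod_scale_def fun_eq_iff fun_scale_apply scale_right_diff_distrib scale_minus_right algebra_simps)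
  have PF: "?P F"
  proof (intro conjI allI ballI lin)
    fix v w :: "3 \<Rightarrow> 'v" and \<nu> \<nu>' :: int assume \<nu>: "\<nu> \<in> {1, - 1}" "\<nu>' \<in> {1, - 1}"
    let ?m = "mm (v k) (v (k + 1))" and ?n = "mm (w k) (w (k + 1))"
    have prod: "(\<Prod>i\<in>edge k. b (v i) (w i)) = trace (mat_bar ?m ** ?n)"
      by (simp add: edge_def mm_polar)
    have a: "a_elem (edge k) i = (if i = k - 1 then 1 else - 1 / 2 :: 'f)" for i
      by (simp add: a_elem_def t2_index_edge)
    have sym: "trace (mat_bar ?n ** ?m) = trace (mat_bar ?m ** ?n)"
      by (simp add: mat2_simps algebra_simps)
    \<comment> \<open>Antisymmetry is the polarized norm identity again: the product of one adjoint
      with the other matrix, plus the same with roles exchanged, is the scalar given by the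
      trace.\<close>
    have anti: "of_mat (PN_H k ?n ?m i) = - of_mat (PN_H k ?m ?n i)" for i
    proof -
      have "PN_H k ?n ?m i = - PN_H k ?m ?n i"
        using two unfolding PN_H_def sym by (auto) (simp_all add: mat2_simps field_simps)
      then show ?thesis by (simp add: ofm)
    qed
    show "F (VE_tensor (itensor s (edge k) v) (e_sgn \<nu>)) (VE_tensor (itensor s (edge k) w) (e_sgn \<nu>')) =
          (if \<nu> = - \<nu>'
           then (phi_diag s b (edge k) (itensor s (edge k) v) (itensor s (edge k) w),
                 fun_scale (*) (of_int \<nu> * (\<Prod>i\<in>edge k. b (v i) (w i))) (a_elem (edge k)))
           else 0)"
      unfolding prod phi_diag_itensor
    proof -
      have T: "- PN_T k ?m ?n = fun_scale (*) (of_int 1 * trace (mat_bar ?m ** ?n)) (a_elem (edge k))"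
        "PN_T k ?n ?m = fun_scale (*) (of_int (- 1) * trace (mat_bar ?m ** ?n)) (a_elem (edge k))"
        by (simp_all add: PN_T_def a fun_scale_def fun_eq_iff sym)
      have H: "(\<lambda>i. of_mat (PN_H k ?n ?m i)) = (\<lambda>i. - of_mat (PN_H k ?m ?n i))"
        using anti by blast
      have "F (VEP k ?m) (VEN k ?n) = (\<lambda>i. - of_mat (PN_H k ?m ?n i), - PN_T k ?m ?n)"
        "F (VEN k ?m) (VEP k ?n) = (\<lambda>i. of_mat (PN_H k ?n ?m i), PN_T k ?n ?m)"
        "F (VEP k ?m) (VEP k ?n) = 0" "F (VEN k ?m) (VEN k ?n) = 0"
        by (simp_all add: F_def mc_VEP PN ofm) (simp_all add: fun_eq_iff zero_prod_def)
      then show "F (VE_tensor (itensor s (edge k) v) (e_sgn \<nu>)) (VE_tensor (itensor s (edge k) w) (e_sgn \<nu>')) =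
          (if \<nu> = - \<nu>' then (\<lambda>i. - of_mat (PN_H k ?m ?n i),
             fun_scale (*) (of_int \<nu> * trace (mat_bar ?m ** ?n)) (a_elem (edge k))) else 0)"
        using \<nu> unfolding H T by (auto simp: e_sgn_simps VE_itensor)
    qed
  qed
  then have P: "?P (tphi_diag s b (edge k))"
    unfolding tphi_diag_def by (rule someI[of ?P])
  have "tphi_diag s b (edge k) U U' = F U U'"
    by (rule W_bilinear_eq[OF conjunct1[OF P] lin _ U]) (use P PF in auto)
  then show ?thesis by (simp add: F_def)
qed

text \<open>Equal signs multiply into the opposite sign, so the e- coefficients feed
  \<open>VEP\<close> and the e+ coefficients feed \<open>VEN\<close>; the matrix part is the
  contraction computed in \<open>phi_off_edge\<close>.\<close>

lemma tphi_off_eq: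
  assumes U: "U \<in> W k" and U': "U' \<in> W (k + 1)"
  defines "V \<equiv> VEP (k + 2) (mat_bar (mcN k U) ** mat_bar (mcN (k + 1) U')) + VEN (k + 2) (mat_bar (mcP k U) ** mat_bar (mcP (k + 1) U'))"
  shows "tphi_off s b (edge k) (edge (k + 1)) U U' = V"
    "tphi_off s b (edge (k + 1)) (edge k) U' U = - V"
proof -
  define F where "F U U' = VEP (k + 2) (mat_bar (mcN k U) ** mat_bar (mcN (k + 1) U')) +
    VEN (k + 2) (mat_bar (mcP k U) ** mat_bar (mcP (k + 1) U'))" for U U'
  let ?P = "\<lambda>\<sigma> \<tau> f. bilinear_map (fun_scale (*)) (fun_scale (*)) (fun_scale (*)) f \<and>
     (\<forall>x\<in>itensor_space s \<sigma>. \<forall>y\<in>itensor_space s \<tau>. \<forall>\<nu>\<in>{1, - 1}. \<forall>\<nu>'\<in>{1, - 1}.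
        f (VE_tensor x (e_sgn \<nu>)) (VE_tensor y (e_sgn \<nu>')) =
          (if \<nu> = \<nu>' then VE_tensor (phi_off s b \<sigma> \<tau> x y) (e_sgn (- \<nu>)) else 0))"
  have F: "bilinear_map (fun_scale (*)) (fun_scale (*)) (fun_scale (*)) F"
    unfolding F_def
    by (rule bilinear_mapI)
      (simp_all add: vector_space_vse mcP_simps mat_ring VEP_simps VSE.scale_right_distrib)
  have F': "bilinear_map (fun_scale (*)) (fun_scale (*)) (fun_scale (*)) (\<lambda>w u. - F u w)"
    by (rule bilinear_mapI) (simp_all add: vector_space_vse bilinear_add_left[OF F] bilinear_add_right[OF F]
        bilinear_scale_left[OF F] bilinear_scale_right[OF F])
  have mz: "mat_bar 0 = (0 :: 'f^2^2)" "0 ** y = (0 :: 'f^2^2)" "y ** 0 = (0 :: 'f^2^2)" for y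
    by (simp_all add: mat2_simps)
  have val: "F (VE_tensor x (e_sgn \<nu>)) (VE_tensor y (e_sgn \<nu>')) =
          (if \<nu> = \<nu>' then VE_tensor (ten (k + 2) (mat_bar (mc k x) ** mat_bar (mc (k + 1) y))) (e_sgn (- \<nu>)) else 0)"
    if "\<nu> \<in> {1, - 1}" "\<nu>' \<in> {1, - 1}" for x y \<nu> \<nu>'
    using that by (auto simp: F_def e_sgn_simps mcP_VE mcN_VE mat_scale_0_1 mz VEP_simps) (simp_all add: VEP_def VEN_def)
  have PF: "?P (edge k) (edge (k + 1)) F"
    using F val by (simp add: phi_off_edge)
  have minus: "VE_tensor (- x) z = - VE_tensor x z" for x :: "('f, 'v) vs" and z by (rule bilinear_minus_left[OF VE_bilinear])
  have PF': "?P (edge (k + 1)) (edge k) (\<lambda>w u. - F u w)"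
    using F' val by (simp add: phi_off_edge minus)
  have P: "?P (edge k) (edge (k + 1)) (tphi_off s b (edge k) (edge (k + 1)))"
    unfolding tphi_off_def using PF by (rule someI[of "?P (edge k) (edge (k + 1))"])
  have P': "?P (edge (k + 1)) (edge k) (tphi_off s b (edge (k + 1)) (edge k))"
    unfolding tphi_off_def using PF' by (rule someI[of "?P (edge (k + 1)) (edge k)"])
  have it: "itensor s (edge i) v \<in> itensor_space s (edge i)" for i v
    unfolding itensor_space_def by (intro VS.span_base) blast
  have "tphi_off s b (edge k) (edge (k + 1)) U U' = F U U'"
    by (rule W_bilinear_eq[OF conjunct1[OF P] F _ U U']) (use P PF it in auto)
  then show "tphi_off s b (edge k) (edge (k + 1)) U U' = V" by (simp add: F_def V_def)
  have "tphi_off s b (edge (k + 1)) (edge k) U' U = - F U U'"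
    by (rule W_bilinear_eq[OF conjunct1[OF P'] F' _ U' U]) (use P' PF' it in auto)
  then show "tphi_off s b (edge (k + 1)) (edge k) U' U = - V" by (simp add: F_def V_def)
qed

end

section \<open>The table of the algebra built from the plane\<close>

lemma t2_iff_sum: "\<alpha> \<in> t2 \<longleftrightarrow> (\<Sum>i\<in>UNIV. \<alpha> i) = 0"
  by (simp add: t2_def sum_three_0)

context symplectic_plane
begin

definition aH :: "(3 \<Rightarrow> 'f^2^2) \<Rightarrow> ('f, 'v) a5_elem" where "aH A = (\<lambda>i. of_mat (A i), 0, 0)"
definition aT :: "(3 \<Rightarrow> 'f) \<Rightarrow> ('f, 'v) a5_elem" where "aT \<alpha> = (0, \<alpha>, 0)"
definition aP :: "3 \<Rightarrow> 'f^2^2 \<Rightarrow> ('f, 'v) a5_elem" where "aP k a = a5_inj (edge k) (VEP k a)"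
definition aN :: "3 \<Rightarrow> 'f^2^2 \<Rightarrow> ('f, 'v) a5_elem" where "aN k a = a5_inj (edge k) (VEN k a)"

lemma vector_space_a5: "vector_space (a5_scale s)"
  unfolding a5_scale_def
  by (intro vector_space_prod_scale vector_space_fun_scale vector_space_field vector_space_axioms)

sublocale A5: vector_space "a5_scale s" by (fact vector_space_a5)

lemma of_mat_simps: "of_mat (a + a') = of_mat a + of_mat a'" "of_mat (a - a') = of_mat a - of_mat a'"
  "of_mat (- a) = - of_mat a" "of_mat (mat_scale r a) = fun_scale s r (of_mat a)" "of_mat 0 = 0"
  using linear_addD[OF of_mat_linear_mat] linear_diffD[OF of_mat_linear_mat] linear_minusD[OF of_mat_linear_mat]
    linear_scaleD[OF of_mat_linear_mat] linear_zeroD[OF of_mat_linear_mat] by auto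

lemma a5_inj_simps: "a5_inj \<sigma> (u + w) = a5_inj \<sigma> u + a5_inj \<sigma> w" "a5_inj \<sigma> (- u) = - a5_inj \<sigma> u"
  "a5_inj \<sigma> (u - w) = a5_inj \<sigma> u - a5_inj \<sigma> w" "a5_inj \<sigma> 0 = 0"
  "a5_inj \<sigma> (fun_scale (*) c u) = a5_scale s c (a5_inj \<sigma> u)" for u w :: "('f, 'v) vse"
  by (auto simp: a5_inj_def a5_scale_def prod_scale_def fun_scale_def fun_eq_iff zero_prod_def)

lemma aH_linear: "Vector_Spaces.linear (fun_scale mat_scale) (a5_scale s) aH"
  by (rule linearI, simp_all add: vector_space_fun_scale vector_space_mat_scale vector_space_a5)
    (auto simp: aH_def of_mat_simps a5_scale_def prod_scale_def fun_scale_def fun_eq_iff)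

lemma aT_linear: "Vector_Spaces.linear (fun_scale (*)) (a5_scale s) aT"
  by (rule linearI, simp_all add: vector_space_fun_scale vector_space_field vector_space_a5)
    (auto simp: aT_def a5_scale_def prod_scale_def fun_scale_def fun_eq_iff)

lemma aP_linear: "Vector_Spaces.linear mat_scale (a5_scale s) (aP k)"
  and aN_linear: "Vector_Spaces.linear mat_scale (a5_scale s) (aN k)"
  by (rule linearI; simp add: vector_space_mat_scale vector_space_a5 aP_def aN_def VEP_simps a5_inj_simps)+

lemma V_hat_empty: "V_hat s b {} = {aH A + aT \<alpha> | A \<alpha>. (\<forall>i. trace (A i) = 0) \<and> \<alpha> \<in> t2}"
proof (intro equalityI subsetI)
  fix x assume "x \<in> V_hat s b {}"
  then obtain f \<alpha> where x: "x = (f, \<alpha>, 0)" "\<And>i. f i \<in> sp s b" "\<alpha> \<in> t2"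
    by (auto simp: V_hat_def)
  then have "\<forall>i. \<exists>M. f i = of_mat M \<and> trace M = 0" by (auto simp: sp_eq)
  then obtain A where A: "\<And>i. f i = of_mat (A i)" "\<And>i. trace (A i) = 0" by metis
  then have "x = aH A + aT \<alpha>" by (simp add: x aH_def aT_def fun_eq_iff)
  with A(2) x(3) show "x \<in> {aH A + aT \<alpha> | A \<alpha>. (\<forall>i. trace (A i) = 0) \<and> \<alpha> \<in> t2}" by blast
next
  fix x assume "x \<in> {aH A + aT \<alpha> | A \<alpha>. (\<forall>i. trace (A i) = 0) \<and> \<alpha> \<in> t2}"
  then obtain A \<alpha> where "\<forall>i. trace (A i) = 0" "\<alpha> \<in> t2" "x = aH A + aT \<alpha>" by blast
  then show "x \<in> V_hat s b {}"
    by (auto simp: V_hat_def sp_eq aH_def aT_def)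
qed

lemma V_hat_edge: "V_hat s b (edge k) = a5_inj (edge k) ` W k"
  by (simp add: V_hat_def W_def edge_neq_empty)

lemma V_hat_edge_eq: "V_hat s b (edge k) = {aP k a + aN k c | a c. True}"
  unfolding V_hat_edge W_eq aP_def aN_def a5_inj_simps(1)[symmetric] by blast

lemma V_hat_0: "\<sigma> \<in> S_c3 \<Longrightarrow> 0 \<in> V_hat s b \<sigma>"
proof -
  have 0: "0 = aH 0 + aT 0" "0 = aP k 0 + aN k 0" for k
    by (simp_all add: linear_zeroD[OF aH_linear] linear_zeroD[OF aT_linear] linear_zeroD[OF aP_linear] linear_zeroD[OF aN_linear])
  have tr: "\<forall>i::3. trace ((0 :: 3 \<Rightarrow> 'f^2^2) i) = 0" and t: "0 \<in> (t2 :: (3 \<Rightarrow> 'f) set)"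
    by (simp_all add: t2_def trace_def)
  have "0 \<in> V_hat s b {}"
    unfolding V_hat_empty by (intro CollectI exI[of _ 0] conjI; fact 0 tr t)
  moreover have "0 \<in> V_hat s b (edge k)" for k
    unfolding V_hat_edge_eq by (intro CollectI exI[of _ 0] conjI TrueI) (fact 0)
  ultimately show "\<sigma> \<in> S_c3 \<Longrightarrow> 0 \<in> V_hat s b \<sigma>"
    unfolding S_c3_eq by auto
qed

subsection \<open>Values of the product on the components\<close>

definition act_VE :: "(3 \<Rightarrow> 'f^2^2) \<Rightarrow> (3 \<Rightarrow> 'f) \<Rightarrow> 3 \<Rightarrow> ('f, 'v) vse \<Rightarrow> ('f, 'v) vse" where
  "act_VE A \<alpha> k U = VEP k (A (k + 1) ** mcP k U - mcP k U ** A k + mat_scale (\<alpha> (k - 1)) (mcP k U)) +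
    VEN k (A (k + 1) ** mcN k U - mcN k U ** A k - mat_scale (\<alpha> (k - 1)) (mcN k U))"

definition off_VE :: "3 \<Rightarrow> ('f, 'v) vse \<Rightarrow> ('f, 'v) vse \<Rightarrow> ('f, 'v) vse" where
  "off_VE k U U' = VEP (k + 2) (mat_bar (mcN k U) ** mat_bar (mcN (k + 1) U')) +
    VEN (k + 2) (mat_bar (mcP k U) ** mat_bar (mcP (k + 1) U'))"

lemma act_VE_add: "act_VE (A + A') (\<alpha> + \<alpha>') k U = act_VE A \<alpha> k U + act_VE A' \<alpha>' k U"
  "act_VE A \<alpha> k (U + U') = act_VE A \<alpha> k U + act_VE A \<alpha> k U'"
  by (simp_all add: act_VE_def mcP_simps mat_ring VEP_simps VSE.scale_left_distrib VSE.scale_right_distrib)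

lemma off_VE_add: "off_VE k (U + V) U' = off_VE k U U' + off_VE k V U'" "off_VE k U (U' + V) = off_VE k U U' + off_VE k U V"
  by (simp_all add: off_VE_def mcP_simps mat_ring VEP_simps)

lemma commutator_of_mat: "commutator (of_mat A) (of_mat B) = of_mat (A ** B - B ** A)"
  by (simp add: commutator_def of_mat_simps fun_eq_iff of_mat_mult)

lemma tphi_empty_empty: "tphi s b {} {} (aH A + aT \<alpha>) (aH B + aT \<beta>) = aH (\<lambda>i. A i ** B i - B i ** A i)"
  by (simp add: tphi_def aH_def aT_def commutator_of_mat)

lemma tphi_empty_edge:
  assumes "\<forall>i. trace (A i) = 0" "U \<in> W k"
  shows "tphi s b {} (edge k) (aH A + aT \<alpha>) (a5_inj (edge k) U) = a5_inj (edge k) (act_VE A \<alpha> k U)"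
    "tphi s b (edge k) {} (a5_inj (edge k) U) (aH A + aT \<alpha>) = - a5_inj (edge k) (act_VE A \<alpha> k U)"
proof -
  have "a5_inj (edge k) U = (0, 0, \<lambda>\<rho>. if \<rho> = edge k then U else 0)"
    "aH A + aT \<alpha> = (\<lambda>i. of_mat (A i), \<alpha>, 0)"
    by (simp_all add: a5_inj_def aH_def aT_def)
  then show "tphi s b {} (edge k) (aH A + aT \<alpha>) (a5_inj (edge k) U) = a5_inj (edge k) (act_VE A \<alpha> k U)"
    "tphi s b (edge k) {} (a5_inj (edge k) U) (aH A + aT \<alpha>) = - a5_inj (edge k) (act_VE A \<alpha> k U)"
    using VE_act_eq[OF assms, of \<alpha>] edge_neq_empty[of k] by (simp_all add: tphi_def act_VE_def)
qed

lemma tphi_edge_edge: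
  assumes "U \<in> W k" "U' \<in> W k"
  shows "tphi s b (edge k) (edge k) (a5_inj (edge k) U) (a5_inj (edge k) U') =
    - (aH (PN_H k (mcP k U) (mcN k U') - PN_H k (mcP k U') (mcN k U)) +
       aT (PN_T k (mcP k U) (mcN k U') - PN_T k (mcP k U') (mcN k U)))"
  using edge_neq_empty[of k]
  by (simp add: tphi_def a5_inj_def tphi_diag_eq[OF assms] aH_def aT_def) (simp add: fun_eq_iff)

lemma tphi_edge_Suc:
  assumes "U \<in> W k" "U' \<in> W (k + 1)"
  shows "tphi s b (edge k) (edge (k + 1)) (a5_inj (edge k) U) (a5_inj (edge (k + 1)) U') = a5_inj (edge (k + 2)) (off_VE k U U')"
    "tphi s b (edge (k + 1)) (edge k) (a5_inj (edge (k + 1)) U') (a5_inj (edge k) U) = - a5_inj (edge (k + 2)) (off_VE k U U')"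
proof -
  have "edge k \<noteq> edge (k + 1)" "edge (k + 1) \<noteq> edge k" by (simp_all add: edge_eq_iff)
  then show "tphi s b (edge k) (edge (k + 1)) (a5_inj (edge k) U) (a5_inj (edge (k + 1)) U') = a5_inj (edge (k + 2)) (off_VE k U U')"
    "tphi s b (edge (k + 1)) (edge k) (a5_inj (edge (k + 1)) U') (a5_inj (edge k) U) = - a5_inj (edge (k + 2)) (off_VE k U U')"
    using tphi_off_eq[OF assms] edge_neq_empty[of k] edge_neq_empty[of "k + 1"]
    unfolding tphi_def a5_inj_def prod.case edge_sym_diff off_VE_def by (auto simp: fun_eq_iff)
qed

lemma PN_linear:
  "PN_H k (a + a') c = PN_H k a c + PN_H k a' c" "PN_H k a (c + c') = PN_H k a c + PN_H k a c'"
  "PN_T k (a + a') c = PN_T k a c + PN_T k a' c" "PN_T k a (c + c') = PN_T k a c + PN_T k a c'"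
  "PN_H k 0 c = 0" "PN_H k a 0 = 0" "PN_T k 0 c = 0" "PN_T k a 0 = 0"
  for a a' c c' :: "'f^2^2"
  by (auto simp: PN_H_def PN_T_def fun_eq_iff) (simp_all add: mat2_simps algebra_simps add_divide_distrib diff_divide_distrib)

lemma trace_PN_H: "trace (PN_H k a c i) = 0" for a c :: "'f^2^2"
proof -
  have "trace (mat (r / 2) :: 'f^2^2) = r" for r
    using two by (simp add: trace_def mat_def sum_2)
  moreover have "trace (c ** mat_bar a) = trace (mat_bar a ** c)" by (rule trace_mul_sym)
  ultimately show ?thesis by (simp add: PN_H_def mat_mult_linear) (simp add: trace_def)
qed

lemma PN_T_in_t2: "PN_T k a c \<in> t2" for a c :: "'f^2^2"
proof -
  have "(\<Sum>i\<in>UNIV. PN_T k a c i) = 0"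
    unfolding sum_three[of _ "k - 1"] using two
    by (simp add: PN_T_def three_add)
  then show ?thesis by (simp add: t2_def sum_three_0)
qed

text \<open>Two different edges of a triangle are consecutive in one of the two orders, so two
  off-diagonal cases are enough.\<close>

lemma S_c3_cases:
  assumes "\<sigma> \<in> S_c3" "\<tau> \<in> S_c3"
  obtains (ee) "\<sigma> = {}" "\<tau> = {}" | (e) k where "\<sigma> = {}" "\<tau> = edge k" | (e') k where "\<sigma> = edge k" "\<tau> = {}"
    | (diag) k where "\<sigma> = edge k" "\<tau> = edge k" | (off) k where "\<sigma> = edge k" "\<tau> = edge (k + 1)"
    | (off') k where "\<sigma> = edge (k + 1)" "\<tau> = edge k"
proof -
  have "l = k \<or> l = k + 1 \<or> k = l + 1" for k l :: 3
    using three_cases[of l] three_cases[of k] by (elim disjE) (simp_all add: three_eq_0 four_eq_1)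
  note tri = this
  consider "\<sigma> = {}" | k where "\<sigma> = edge k" using assms(1) unfolding S_c3_eq by blast
  then show ?thesis
  proof cases
    case 1
    then show ?thesis using assms(2) ee e unfolding S_c3_eq by blast
  next
    case (2 k)
    consider "\<tau> = {}" | l where "\<tau> = edge l" using assms(2) unfolding S_c3_eq by blast
    then show ?thesis
    proof cases
      case 1
      then show ?thesis using e' 2 by simp
    next
      case l: (2 l)
      then show ?thesis using tri[of l k] diag off off' 2 by auto
    qed
  qed
qed

lemma tphi_anti:
  assumes "\<sigma> \<in> S_c3" "\<tau> \<in> S_c3" "x \<in> V_hat s b \<sigma>" "y \<in> V_hat s b \<tau>"
  shows "tphi s b \<sigma> \<tau> x y = - tphi s b \<tau> \<sigma> y x"
  using assms(1,2)
proof (cases rule: S_c3_cases)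
  case ee
  then obtain A \<alpha> B \<beta> where *: "x = aH A + aT \<alpha>" "y = aH B + aT \<beta>"
    using assms(3,4) by (auto simp: V_hat_empty)
  have "(\<lambda>i. B i ** A i - A i ** B i) = - (\<lambda>i. A i ** B i - B i ** A i)" by (simp add: fun_eq_iff)
  then show ?thesis unfolding ee * tphi_empty_empty by (simp add: linear_minusD[OF aH_linear])
next
  case (e k)
  then show ?thesis using assms(3,4) by (auto simp: V_hat_empty V_hat_edge tphi_empty_edge)
next
  case (e' k)
  then show ?thesis using assms(3,4) by (auto simp: V_hat_empty V_hat_edge tphi_empty_edge)
next
  case (diag k)
  then obtain U U' where U: "U \<in> W k" "U' \<in> W k" "x = a5_inj (edge k) U" "y = a5_inj (edge k) U'"
    using assms(3,4) by (auto simp: V_hat_edge)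
  show ?thesis unfolding diag U(3,4) tphi_edge_edge[OF U(1,2)] tphi_edge_edge[OF U(2,1)]
    by (simp add: linear_diffD[OF aH_linear] linear_diffD[OF aT_linear])
next
  case (off k)
  then show ?thesis using assms(3,4) by (auto simp: V_hat_edge tphi_edge_Suc)
next
  case (off' k)
  then show ?thesis using assms(3,4) by (auto simp: V_hat_edge tphi_edge_Suc)
qed

lemma W_add: "U \<in> W k \<Longrightarrow> U' \<in> W k \<Longrightarrow> U + U' \<in> W k"
  by (rule VSE.subspace_add[OF W_subspace])

text \<open>Additivity in the argument from sp(V)^3 and t2 is no part of the specification of
  \<open>VE_act\<close>, which is chosen separately for every pair of them. It follows from the
  explicit matrix formula, valid on \<open>V_hat\<close>.\<close>

lemma tphi_add_left:
  assumes "\<sigma> \<in> S_c3" "\<tau> \<in> S_c3" "x \<in> V_hat s b \<sigma>" "x' \<in> V_hat s b \<sigma>" "y \<in> V_hat s b \<tau>"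
  shows "tphi s b \<sigma> \<tau> (x + x') y = tphi s b \<sigma> \<tau> x y + tphi s b \<sigma> \<tau> x' y"
  using assms(1,2)
proof (cases rule: S_c3_cases)
  case ee
  then obtain A \<alpha> A' \<alpha>' B \<beta> where *: "x = aH A + aT \<alpha>" "x' = aH A' + aT \<alpha>'" "y = aH B + aT \<beta>"
    using assms(3-5) by (auto simp: V_hat_empty)
  have "x + x' = aH (A + A') + aT (\<alpha> + \<alpha>')"
    by (simp add: * linear_addD[OF aH_linear] linear_addD[OF aT_linear] algebra_simps)
  moreover have "(\<lambda>i. (A + A') i ** B i - B i ** (A + A') i) = (\<lambda>i. A i ** B i - B i ** A i) + (\<lambda>i. A' i ** B i - B i ** A' i)"
    by (simp add: fun_eq_iff mat_ring)
  ultimately show ?thesis unfolding ee by (simp only: tphi_empty_empty *(3)) (simp add: * tphi_empty_empty linear_addD[OF aH_linear])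
next
  case (e k)
  then obtain A \<alpha> A' \<alpha>' U where *: "x = aH A + aT \<alpha>" "x' = aH A' + aT \<alpha>'" "\<forall>i. trace (A i) = 0" "\<forall>i. trace (A' i) = 0"
    "y = a5_inj (edge k) U" "U \<in> W k"
    using assms(3-5) by (auto simp: V_hat_empty V_hat_edge)
  have eq: "x + x' = aH (A + A') + aT (\<alpha> + \<alpha>')"
    by (simp add: * linear_addD[OF aH_linear] linear_addD[OF aT_linear] algebra_simps)
  have tr: "\<forall>i. trace ((A + A') i) = 0" using *(3,4) by (simp add: trace_add)
  show ?thesis
    unfolding e eq *(5) tphi_empty_edge[OF tr *(6)] unfolding *(1,2) tphi_empty_edge[OF *(3,6)] tphi_empty_edge[OF *(4,6)]
    by (simp add: act_VE_add a5_inj_simps)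
next
  case (e' k)
  then obtain A \<alpha> U U' where *: "y = aH A + aT \<alpha>" "\<forall>i. trace (A i) = 0"
    "x = a5_inj (edge k) U" "U \<in> W k" "x' = a5_inj (edge k) U'" "U' \<in> W k"
    using assms(3-5) by (auto simp: V_hat_empty V_hat_edge)
  show ?thesis
    unfolding e' *(1,3,5) a5_inj_simps(1)[symmetric] tphi_empty_edge(2)[OF *(2) W_add[OF *(4,6)]]
      tphi_empty_edge(2)[OF *(2,4)] tphi_empty_edge(2)[OF *(2,6)]
    by (simp add: act_VE_add a5_inj_simps)
next
  case (diag k)
  then obtain U V U' where U: "U \<in> W k" "V \<in> W k" "U' \<in> W k"
    "x = a5_inj (edge k) U" "x' = a5_inj (edge k) V" "y = a5_inj (edge k) U'"
    using assms(3-5) by (auto simp: V_hat_edge)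
  show ?thesis
    unfolding diag U(4-6) a5_inj_simps(1)[symmetric] tphi_edge_edge[OF W_add[OF U(1,2)] U(3)]
      tphi_edge_edge[OF U(1,3)] tphi_edge_edge[OF U(2,3)]
    by (simp add: mcP_simps PN_linear linear_diffD[OF aH_linear] linear_diffD[OF aT_linear]
        linear_addD[OF aH_linear] linear_addD[OF aT_linear] algebra_simps)
next
  case (off k)
  then obtain U V U' where U: "U \<in> W k" "V \<in> W k" "U' \<in> W (k + 1)"
    "x = a5_inj (edge k) U" "x' = a5_inj (edge k) V" "y = a5_inj (edge (k + 1)) U'"
    using assms(3-5) by (auto simp: V_hat_edge)
  show ?thesis
    unfolding off U(4-6) a5_inj_simps(1)[symmetric] tphi_edge_Suc(1)[OF W_add[OF U(1,2)] U(3)]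
      tphi_edge_Suc(1)[OF U(1,3)] tphi_edge_Suc(1)[OF U(2,3)]
    by (simp add: off_VE_add a5_inj_simps)
next
  case (off' k)
  then obtain U V U' where U: "U \<in> W (k + 1)" "V \<in> W (k + 1)" "U' \<in> W k"
    "x = a5_inj (edge (k + 1)) U" "x' = a5_inj (edge (k + 1)) V" "y = a5_inj (edge k) U'"
    using assms(3-5) by (auto simp: V_hat_edge)
  show ?thesis
    unfolding off' U(4-6) a5_inj_simps(1)[symmetric] tphi_edge_Suc(2)[OF U(3) W_add[OF U(1,2)]]
      tphi_edge_Suc(2)[OF U(3,1)] tphi_edge_Suc(2)[OF U(3,2)]
    by (simp add: off_VE_add a5_inj_simps)
qed

lemma t2_diff: "\<alpha> \<in> t2 \<Longrightarrow> \<beta> \<in> t2 \<Longrightarrow> \<beta> - \<alpha> \<in> (t2 :: (3 \<Rightarrow> 'f) set)"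
  by (simp add: t2_iff_sum sum_subtractf)

lemma act_VE_in_W: "act_VE A \<alpha> k U \<in> W k" and off_VE_in_W: "off_VE k U U' \<in> W (k + 2)"
  by (simp_all add: act_VE_def off_VE_def W_add VEP_in_W)

lemma minus_a5_inj_in: "U \<in> W k \<Longrightarrow> - a5_inj \<sigma> U \<in> a5_inj \<sigma> ` W k"
  unfolding a5_inj_simps(2)[symmetric] by (intro imageI VSE.subspace_neg[OF W_subspace])

lemma tphi_in_V_hat:
  assumes "\<sigma> \<in> S_c3" "\<tau> \<in> S_c3" "x \<in> V_hat s b \<sigma>" "y \<in> V_hat s b \<tau>"
  shows "tphi s b \<sigma> \<tau> x y \<in> V_hat s b (sym_diff \<sigma> \<tau>)"
  using assms(1,2)
proof (cases rule: S_c3_cases)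
  case ee
  then obtain A \<alpha> B \<beta> where *: "x = aH A + aT \<alpha>" "y = aH B + aT \<beta>"
    using assms(3,4) by (auto simp: V_hat_empty)
  have "aH (\<lambda>i. A i ** B i - B i ** A i) = aH (\<lambda>i. A i ** B i - B i ** A i) + aT 0"
    by (simp add: linear_zeroD[OF aT_linear])
  moreover have "\<forall>i. trace (A i ** B i - B i ** A i) = 0"
    using trace_mul_sym by (metis (no_types, lifting) mat_mult_linear(12) cancel_comm_monoid_add_class.diff_cancel)
  moreover have "0 \<in> (t2 :: (3 \<Rightarrow> 'f) set)" by (simp add: t2_def)
  ultimately have "aH (\<lambda>i. A i ** B i - B i ** A i) \<in> V_hat s b {}"
    unfolding V_hat_empty by (intro CollectI exI conjI)
  then show ?thesis unfolding ee * tphi_empty_empty by simp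
next
  case (e k)
  then show ?thesis using assms(3,4)
    by (auto simp: V_hat_empty V_hat_edge tphi_empty_edge act_VE_in_W)
next
  case (e' k)
  then show ?thesis using assms(3,4)
    by (auto simp: V_hat_empty V_hat_edge tphi_empty_edge minus_a5_inj_in act_VE_in_W)
next
  case (diag k)
  then obtain U U' where U: "U \<in> W k" "U' \<in> W k" "x = a5_inj (edge k) U" "y = a5_inj (edge k) U'"
    using assms(3,4) by (auto simp: V_hat_edge)
  let ?H = "PN_H k (mcP k U') (mcN k U) - PN_H k (mcP k U) (mcN k U')"
  let ?T = "PN_T k (mcP k U') (mcN k U) - PN_T k (mcP k U) (mcN k U')"
  have "tphi s b \<sigma> \<tau> x y = aH ?H + aT ?T"
    unfolding diag U(3,4) tphi_edge_edge[OF U(1,2)]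
    by (simp add: linear_diffD[OF aH_linear] linear_diffD[OF aT_linear])
  moreover have "\<forall>i. trace (?H i) = 0" by (simp add: mat_mult_linear trace_PN_H)
  moreover have "?T \<in> t2" by (intro t2_diff PN_T_in_t2)
  ultimately have "tphi s b \<sigma> \<tau> x y \<in> V_hat s b {}"
    unfolding V_hat_empty by (intro CollectI exI conjI)
  then show ?thesis by (simp add: diag)
next
  case (off k)
  then show ?thesis using assms(3,4) unfolding off edge_sym_diff
    by (auto simp: V_hat_edge tphi_edge_Suc off_VE_in_W)
next
  case (off' k)
  then show ?thesis using assms(3,4) unfolding off' edge_sym_diff
    by (auto simp: V_hat_edge tphi_edge_Suc minus_a5_inj_in off_VE_in_W)
qed

end

section \<open>The graded bracket and its table\<close>

context symplectic_plane
begin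

lemma a5_simps: "lie_scale (a5 s b) = a5_scale s"
  "lie_space (a5 s b) = {\<Sum>\<sigma>\<in>S_c3. z \<sigma> | z. \<forall>\<sigma>\<in>S_c3. z \<sigma> \<in> V_hat s b \<sigma>}"
  "lie_br (a5 s b) x y = (\<Sum>\<sigma>\<in>S_c3. \<Sum>\<tau>\<in>S_c3.
        a5_scale s (eps_a5 \<sigma> \<tau>) (tphi s b \<sigma> \<tau> (a5_comp \<sigma> x) (a5_comp \<tau> y)))"
  by (simp_all add: a5_def)

lemma finite_S_c3: "finite S_c3" by (simp add: S_c3_eq)

lemma edge_in_S_c3: "edge k \<in> S_c3" "{} \<in> S_c3" by (auto simp: S_c3_eq)

lemma sum_S_c3: "(\<Sum>\<sigma>\<in>S_c3. z \<sigma>) = z {} + (\<Sum>k\<in>UNIV. z (edge k))" for z :: "3 set \<Rightarrow> 'x::comm_monoid_add"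
proof -
  have "inj edge" by (simp add: inj_def edge_eq_iff)
  moreover have "{} \<notin> range edge" using edge_neq_empty by blast
  ultimately show ?thesis by (simp add: S_c3_eq sum.reindex)
qed

lemma a5_comp_add: "a5_comp \<sigma> (x + y) = a5_comp \<sigma> x + (a5_comp \<sigma> y :: ('f, 'v) a5_elem)"
  by (cases x; cases y) (auto simp: a5_comp_def a5_inj_def fun_eq_iff)

lemma a5_comp_0: "a5_comp \<sigma> 0 = (0 :: ('f, 'v) a5_elem)"
  using a5_comp_add[of \<sigma> 0 0] by simp

lemma a5_comp_sum: "a5_comp \<sigma> (\<Sum>i\<in>I. f i) = (\<Sum>i\<in>I. a5_comp \<sigma> (f i) :: ('f, 'v) a5_elem)"
  by (induction I rule: infinite_finite_induct) (simp_all add: a5_comp_0 a5_comp_add)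

lemma a5_comp_V_hat:
  assumes "\<sigma> \<in> S_c3" "\<tau> \<in> S_c3" "x \<in> V_hat s b \<sigma>"
  shows "a5_comp \<tau> x = (if \<tau> = \<sigma> then x else 0)"
proof (cases "\<sigma> = {}")
  case True
  then obtain f \<alpha> where "x = (f, \<alpha>, 0)" using assms(3) by (auto simp: V_hat_def)
  then show ?thesis using True by (auto simp: a5_comp_def a5_inj_def fun_eq_iff zero_prod_def)
next
  case False
  then obtain U where "x = a5_inj \<sigma> U" using assms(3) by (auto simp: V_hat_def)
  then show ?thesis using False by (auto simp: a5_comp_def a5_inj_def fun_eq_iff zero_prod_def)
qed

lemma a5_comp_sum_V_hat:
  assumes "\<forall>\<sigma>\<in>S_c3. z \<sigma> \<in> V_hat s b \<sigma>" "\<tau> \<in> S_c3"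
  shows "a5_comp \<tau> (\<Sum>\<sigma>\<in>S_c3. z \<sigma>) = z \<tau>"
proof -
  have "a5_comp \<tau> (\<Sum>\<sigma>\<in>S_c3. z \<sigma>) = (\<Sum>\<sigma>\<in>S_c3. if \<sigma> = \<tau> then z \<sigma> else 0)"
    unfolding a5_comp_sum using assms by (intro sum.cong refl) (auto simp: a5_comp_V_hat)
  then show ?thesis using assms(2) finite_S_c3 by simp
qed

lemma a5_comp_in:
  assumes "x \<in> lie_space (a5 s b)" "\<tau> \<in> S_c3"
  shows "a5_comp \<tau> x \<in> V_hat s b \<tau>"
  using assms a5_comp_sum_V_hat unfolding a5_simps by auto

lemma tphi_0:
  assumes "\<sigma> \<in> S_c3" "\<tau> \<in> S_c3"
  shows "y \<in> V_hat s b \<tau> \<Longrightarrow> tphi s b \<sigma> \<tau> 0 y = 0" "x \<in> V_hat s b \<sigma> \<Longrightarrow> tphi s b \<sigma> \<tau> x 0 = 0"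
proof -
  have 1: "tphi s b \<sigma> \<tau> 0 y = 0" if "y \<in> V_hat s b \<tau>" "\<sigma> \<in> S_c3" "\<tau> \<in> S_c3" for y \<sigma> \<tau>
    using tphi_add_left[OF that(2,3) V_hat_0[OF that(2)] V_hat_0[OF that(2)] that(1)] by simp
  show "y \<in> V_hat s b \<tau> \<Longrightarrow> tphi s b \<sigma> \<tau> 0 y = 0" using 1 assms by blast
  show "x \<in> V_hat s b \<sigma> \<Longrightarrow> tphi s b \<sigma> \<tau> x 0 = 0"
    using tphi_anti[OF assms _ V_hat_0[OF assms(2)]] 1[OF _ assms(2,1)] by simp
qed

text \<open>On homogeneous elements the projections leave one of the sixteen summands. The others
  have a zero argument, and \<open>tphi\<close> vanishes there by additivity.\<close>

lemma a5_br_V_hat: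
  assumes \<sigma>: "\<sigma> \<in> S_c3" and \<tau>: "\<tau> \<in> S_c3" and x: "x \<in> V_hat s b \<sigma>" and y: "y \<in> V_hat s b \<tau>"
  shows "lie_br (a5 s b) x y = a5_scale s (eps_a5 \<sigma> \<tau>) (tphi s b \<sigma> \<tau> x y)"
proof -
  have "lie_br (a5 s b) x y = (\<Sum>\<sigma>'\<in>S_c3. \<Sum>\<tau>'\<in>S_c3.
      if \<tau>' = \<tau> then if \<sigma>' = \<sigma> then a5_scale s (eps_a5 \<sigma> \<tau>) (tphi s b \<sigma> \<tau> x y) else 0 else 0)"
    unfolding a5_simps
  proof (intro sum.cong refl)
    fix \<sigma>' \<tau>' :: "3 set" assume "\<sigma>' \<in> S_c3" "\<tau>' \<in> S_c3"
    then show "a5_scale s (eps_a5 \<sigma>' \<tau>') (tphi s b \<sigma>' \<tau>' (a5_comp \<sigma>' x) (a5_comp \<tau>' y)) =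
      (if \<tau>' = \<tau> then if \<sigma>' = \<sigma> then a5_scale s (eps_a5 \<sigma> \<tau>) (tphi s b \<sigma> \<tau> x y) else 0 else 0)"
      using assms by (auto simp: a5_comp_V_hat tphi_0 V_hat_0)
  qed
  then show ?thesis
    using \<sigma> \<tau> finite_S_c3 by simp
qed

lemma eps_a5_simps: "eps_a5 (edge k) (edge k) = (- 1 :: 'f)" "\<sigma> \<noteq> \<tau> \<or> \<sigma> = {} \<Longrightarrow> eps_a5 \<sigma> \<tau> = (1 :: 'f)"
  "eps_a5 \<sigma> \<tau> = (eps_a5 \<tau> \<sigma> :: 'f)"
  using two by (auto simp: eps_a5_def eps_c3_def edge_neq_empty)

lemma a5_br_add:
  assumes "x \<in> lie_space (a5 s b)" "y \<in> lie_space (a5 s b)" "z \<in> lie_space (a5 s b)"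
  shows "lie_br (a5 s b) (x + y) z = lie_br (a5 s b) x z + lie_br (a5 s b) y z"
  unfolding a5_simps(3) sum.distrib[symmetric]
  by (intro sum.cong refl) (simp add: a5_comp_add tphi_add_left a5_comp_in assms A5.scale_right_distrib)

lemma a5_br_anti:
  assumes "x \<in> lie_space (a5 s b)" "y \<in> lie_space (a5 s b)"
  shows "lie_br (a5 s b) x y = - lie_br (a5 s b) y x"
proof -
  have "lie_br (a5 s b) x y = (\<Sum>\<sigma>\<in>S_c3. \<Sum>\<tau>\<in>S_c3.
      - a5_scale s (eps_a5 \<tau> \<sigma>) (tphi s b \<tau> \<sigma> (a5_comp \<tau> y) (a5_comp \<sigma> x)))"
    unfolding a5_simps(3)
  proof (intro sum.cong refl)
    fix \<sigma> \<tau> :: "3 set" assume st: "\<sigma> \<in> S_c3" "\<tau> \<in> S_c3"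
    have "tphi s b \<sigma> \<tau> (a5_comp \<sigma> x) (a5_comp \<tau> y) = - tphi s b \<tau> \<sigma> (a5_comp \<tau> y) (a5_comp \<sigma> x)"
      by (intro tphi_anti st a5_comp_in assms)
    then show "a5_scale s (eps_a5 \<sigma> \<tau>) (tphi s b \<sigma> \<tau> (a5_comp \<sigma> x) (a5_comp \<tau> y)) =
      - a5_scale s (eps_a5 \<tau> \<sigma>) (tphi s b \<tau> \<sigma> (a5_comp \<tau> y) (a5_comp \<sigma> x))"
      by (simp add: eps_a5_simps(3)[of \<sigma> \<tau>])
  qed
  also have "\<dots> = - lie_br (a5 s b) y x"
    unfolding a5_simps(3) sum_negf by (subst sum.swap) (rule refl)
  finally show ?thesis .
qed

lemma a5_space_eq: "lie_space (a5 s b) = {aH A + aT \<alpha> + (\<Sum>k\<in>UNIV. aP k (f k)) + (\<Sum>k\<in>UNIV. aN k (g k)) | A \<alpha> f g.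
    (\<forall>i. trace (A i) = 0) \<and> \<alpha> \<in> t2}"
proof (intro equalityI subsetI)
  fix x assume "x \<in> lie_space (a5 s b)"
  then obtain z where z: "x = (\<Sum>\<sigma>\<in>S_c3. z \<sigma>)" "\<And>\<sigma>. \<sigma> \<in> S_c3 \<Longrightarrow> z \<sigma> \<in> V_hat s b \<sigma>"
    unfolding a5_simps by blast
  obtain A \<alpha> where A: "z {} = aH A + aT \<alpha>" "\<forall>i. trace (A i) = 0" "\<alpha> \<in> t2"
    using z(2)[OF edge_in_S_c3(2)] by (auto simp: V_hat_empty)
  have "\<exists>f g. z (edge k) = aP k f + aN k g" for k
    using z(2)[OF edge_in_S_c3(1)[of k]] by (auto simp: V_hat_edge_eq)
  then obtain f g where fg: "\<And>k. z (edge k) = aP k (f k) + aN k (g k)" by metis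
  have "x = aH A + aT \<alpha> + (\<Sum>k\<in>UNIV. aP k (f k)) + (\<Sum>k\<in>UNIV. aN k (g k))"
    by (simp add: z(1) sum_S_c3 A(1) fg sum.distrib add.assoc)
  with A(2,3) show "x \<in> {aH A + aT \<alpha> + (\<Sum>k\<in>UNIV. aP k (f k)) + (\<Sum>k\<in>UNIV. aN k (g k)) | A \<alpha> f g.
    (\<forall>i. trace (A i) = 0) \<and> \<alpha> \<in> t2}" by blast
next
  fix x assume "x \<in> {aH A + aT \<alpha> + (\<Sum>k\<in>UNIV. aP k (f k)) + (\<Sum>k\<in>UNIV. aN k (g k)) | A \<alpha> f g.
    (\<forall>i. trace (A i) = 0) \<and> \<alpha> \<in> t2}"
  then obtain A \<alpha> f g where x: "x = aH A + aT \<alpha> + (\<Sum>k\<in>UNIV. aP k (f k)) + (\<Sum>k\<in>UNIV. aN k (g k))"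
    and A: "\<forall>i. trace (A i) = 0" "\<alpha> \<in> t2" by blast
  \<comment> \<open>A family over \<open>S_c3\<close> is indexed by sets; \<open>inv edge\<close>
    transports the cyclic indexing to it.\<close>
  define z where "z \<sigma> = (if \<sigma> = {} then aH A + aT \<alpha> else aP (inv edge \<sigma>) (f (inv edge \<sigma>)) + aN (inv edge \<sigma>) (g (inv edge \<sigma>)))" for \<sigma>
  have "inj edge" by (simp add: inj_def edge_eq_iff)
  then have z_edge: "z (edge k) = aP k (f k) + aN k (g k)" for k
    by (simp add: z_def edge_neq_empty)
  have "x = (\<Sum>\<sigma>\<in>S_c3. z \<sigma>)"
    unfolding sum_S_c3 z_edge by (simp add: z_def x sum.distrib add.assoc)
  moreover have "z {} \<in> V_hat s b {}" using A by (auto simp: z_def V_hat_empty)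
  moreover have "z (edge k) \<in> V_hat s b (edge k)" for k unfolding V_hat_edge_eq z_edge by blast
  ultimately show "x \<in> lie_space (a5 s b)"
    unfolding a5_simps S_c3_eq by auto
qed

lemma table_in_V_hat:
  "\<forall>i. trace (A i) = 0 \<Longrightarrow> aH A \<in> V_hat s b {}" "\<alpha> \<in> t2 \<Longrightarrow> aT \<alpha> \<in> V_hat s b {}"
  "aP k a \<in> V_hat s b (edge k)" "aN k a \<in> V_hat s b (edge k)"
proof -
  have z: "\<forall>i::3. trace ((0 :: 3 \<Rightarrow> 'f^2^2) i) = 0" "0 \<in> (t2 :: (3 \<Rightarrow> 'f) set)"
    by (simp_all add: t2_def trace_def)
  have *: "aH A + aT \<alpha> \<in> V_hat s b {}" if "\<forall>i. trace (A i) = 0" "\<alpha> \<in> t2" for A \<alpha>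
    using that by (auto simp: V_hat_empty)
  show "\<forall>i. trace (A i) = 0 \<Longrightarrow> aH A \<in> V_hat s b {}" using *[of A 0] z by (simp add: linear_zeroD[OF aT_linear])
  show "\<alpha> \<in> t2 \<Longrightarrow> aT \<alpha> \<in> V_hat s b {}" using *[of 0 \<alpha>, OF z(1)] by (simp add: linear_zeroD[OF aH_linear] del: zero_fun_apply)
  show "aP k a \<in> V_hat s b (edge k)" "aN k a \<in> V_hat s b (edge k)"
    by (simp_all add: V_hat_edge aP_def aN_def VEP_in_W)
qed

lemma V_hat_in_space: "\<sigma> \<in> S_c3 \<Longrightarrow> x \<in> V_hat s b \<sigma> \<Longrightarrow> x \<in> lie_space (a5 s b)"
proof -
  assume \<sigma>: "\<sigma> \<in> S_c3" and x: "x \<in> V_hat s b \<sigma>"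
  have "x = (\<Sum>\<tau>\<in>S_c3. if \<tau> = \<sigma> then x else 0)" using \<sigma> finite_S_c3 by simp
  moreover have "\<forall>\<tau>\<in>S_c3. (if \<tau> = \<sigma> then x else 0) \<in> V_hat s b \<tau>" using x V_hat_0 by auto
  ultimately show ?thesis unfolding a5_simps by blast
qed

lemma block_table_onto_a5: "block_table_onto (a5 s b) aH aT aP aN"
proof (rule block_table_onto.intro)
  have z: "\<forall>i::3. trace ((0 :: 3 \<Rightarrow> 'f^2^2) i) = 0" "0 \<in> (t2 :: (3 \<Rightarrow> 'f) set)"
    by (simp_all add: t2_def trace_def)
  have H0: "aH A = aH A + aT 0" for A by (simp add: linear_zeroD[OF aT_linear])
  have T0: "aT \<alpha> = aH 0 + aT \<alpha>" for \<alpha> by (simp add: linear_zeroD[OF aH_linear])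
  note V = table_in_V_hat
  note S = edge_in_S_c3
  have br_e: "lie_br (a5 s b) x y = tphi s b {} \<tau> x y" if "x \<in> V_hat s b {}" "y \<in> V_hat s b \<tau>" "\<tau> \<in> S_c3" for x y \<tau>
    using a5_br_V_hat[OF S(2) that(3,1,2)] by (simp add: eps_a5_simps(2))
  \<comment> \<open>The value -1 of \<open>eps_a5\<close> on equal edges cancels the minus sign in
    \<open>tphi_edge_edge\<close>, so that the table has \<open>PN_H\<close> and \<open>PN_T\<close>
    without a sign.\<close>
  have br_kk: "lie_br (a5 s b) x y = - tphi s b (edge k) (edge k) x y" if "x \<in> V_hat s b (edge k)" "y \<in> V_hat s b (edge k)" for x y k
    using a5_br_V_hat[OF S(1) S(1) that] by (simp add: eps_a5_simps(1))
  have br_Suc: "lie_br (a5 s b) x y = tphi s b (edge k) (edge (k + 1)) x y" if "x \<in> V_hat s b (edge k)" "y \<in> V_hat s b (edge (k + 1))" for x y k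
    using a5_br_V_hat[OF S(1) S(1) that] by (simp add: eps_a5_simps(2) edge_eq_iff)
  have act0: "act_VE A 0 k U = VEP k (A (k + 1) ** mcP k U - mcP k U ** A k) + VEN k (A (k + 1) ** mcN k U - mcN k U ** A k)" for A k U
    by (simp add: act_VE_def mat_scale_0_1)
  have mz: "mat_bar 0 = (0 :: 'f^2^2)" "0 ** y = (0 :: 'f^2^2)" "y ** 0 = (0 :: 'f^2^2)" "mat_scale r 0 = (0 :: 'f^2^2)" for y r
    by (simp_all add: mat2_simps)
  show "block_table (a5 s b) aH aT aP aN"
  proof (rule block_table.intro; (unfold a5_simps(1))?)
    show "(2::'f) \<noteq> 0" by (fact two)
    show "Vector_Spaces.linear (fun_scale mat_scale) (a5_scale s) aH" by (fact aH_linear)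
    show "Vector_Spaces.linear (fun_scale (*)) (a5_scale s) aT" by (fact aT_linear)
    show "Vector_Spaces.linear mat_scale (a5_scale s) (aP k)" "Vector_Spaces.linear mat_scale (a5_scale s) (aN k)" for k
      by (fact aP_linear aN_linear)+
    show "A5.subspace (lie_space (a5 s b))"
    proof (rule A5.subspaceI)
      show "0 \<in> lie_space (a5 s b)" by (rule V_hat_in_space[OF S(2) V_hat_0[OF S(2)]])
      fix x assume "x \<in> lie_space (a5 s b)"
      then obtain A \<alpha> f g where x: "x = aH A + aT \<alpha> + (\<Sum>k\<in>UNIV. aP k (f k)) + (\<Sum>k\<in>UNIV. aN k (g k))"
        and A: "\<forall>i. trace (A i) = 0" "\<alpha> \<in> t2" unfolding a5_space_eq by blast
      show "a5_scale s c x \<in> lie_space (a5 s b)" for c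
      proof -
        have "a5_scale s c x = aH (fun_scale mat_scale c A) + aT (fun_scale (*) c \<alpha>) +
            (\<Sum>k\<in>UNIV. aP k (mat_scale c (f k))) + (\<Sum>k\<in>UNIV. aN k (mat_scale c (g k)))"
          by (simp add: x A5.scale_right_distrib A5.scale_sum_right linear_scaleD[OF aH_linear] linear_scaleD[OF aT_linear]
              linear_scaleD[OF aP_linear] linear_scaleD[OF aN_linear])
        moreover have "\<forall>i. trace (fun_scale mat_scale c A i) = 0" using A(1) by (simp add: fun_scale_apply mat_mult_linear)
        moreover have "fun_scale (*) c \<alpha> \<in> t2" using A(2) by (simp add: t2_iff_sum fun_scale_apply flip: sum_distrib_left)
        ultimately show ?thesis unfolding a5_space_eq by (intro CollectI exI conjI)
      qed
      fix y assume "y \<in> lie_space (a5 s b)"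
      then obtain B \<beta> f' g' where y: "y = aH B + aT \<beta> + (\<Sum>k\<in>UNIV. aP k (f' k)) + (\<Sum>k\<in>UNIV. aN k (g' k))"
        and B: "\<forall>i. trace (B i) = 0" "\<beta> \<in> t2" unfolding a5_space_eq by blast
      have "x + y = aH (A + B) + aT (\<alpha> + \<beta>) + (\<Sum>k\<in>UNIV. aP k (f k + f' k)) + (\<Sum>k\<in>UNIV. aN k (g k + g' k))"
        by (simp add: x y linear_addD[OF aH_linear] linear_addD[OF aT_linear] sum.distrib
            linear_addD[OF aP_linear] linear_addD[OF aN_linear] algebra_simps)
      moreover have "\<forall>i. trace ((A + B) i) = 0" using A(1) B(1) by (simp add: trace_add)
      moreover have "\<alpha> + \<beta> \<in> t2" using A(2) B(2) by (simp add: t2_iff_sum sum.distrib)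
      ultimately show "x + y \<in> lie_space (a5 s b)" unfolding a5_space_eq by (intro CollectI exI conjI)
    qed
    show "aH A \<in> lie_space (a5 s b)" if "\<forall>i. trace (A i) = 0" for A by (intro V_hat_in_space[OF S(2)] V that)
    show "aT \<alpha> \<in> lie_space (a5 s b)" if "\<alpha> \<in> t2" for \<alpha> by (intro V_hat_in_space[OF S(2)] V that)
    show "aP k a \<in> lie_space (a5 s b)" "aN k a \<in> lie_space (a5 s b)" for k a
      by (rule V_hat_in_space[OF S(1)], rule V)+
    show "A = 0 \<and> \<alpha> = 0 \<and> f = 0 \<and> g = 0" if "\<forall>i. trace (A i) = 0" "\<alpha> \<in> t2"
      "aH A + aT \<alpha> + (\<Sum>k\<in>UNIV. aP k (f k)) + (\<Sum>k\<in>UNIV. aN k (g k)) = 0" for A \<alpha> f g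
    proof -
      have "(\<lambda>i. of_mat (A i)) = 0" "\<alpha> = 0"
        using arg_cong[OF that(3), of fst] arg_cong[OF that(3), of "\<lambda>x. fst (snd x)"]
        by (simp_all add: aH_def aT_def aP_def aN_def a5_inj_def fst_sum snd_sum)
      then have "A = 0" using of_mat_eq_0 by (metis (no_types, lifting) ext zero_fun_apply)
      have "VEP k (f k) + VEN k (g k) = 0" for k
      proof -
        have "snd (snd (aH A + aT \<alpha> + (\<Sum>k\<in>UNIV. aP k (f k)) + (\<Sum>k\<in>UNIV. aN k (g k)))) (edge k) = 0"
          unfolding that(3) by simp
        then show ?thesis
          by (simp add: aH_def aT_def aP_def aN_def a5_inj_def snd_sum sum_fun_apply edge_eq_iff cong: if_cong)
      qed
      then have "mcP k (VEP k (f k) + VEN k (g k)) = 0" "mcN k (VEP k (f k) + VEN k (g k)) = 0" for k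
        by (simp_all add: mcP_simps)
      then have "f = 0" "g = 0" by (simp_all add: mcP_simps mc_VEP fun_eq_iff)
      with \<open>A = 0\<close> \<open>\<alpha> = 0\<close> show ?thesis by blast
    qed
    show "lie_br (a5 s b) (x + y) z = lie_br (a5 s b) x z + lie_br (a5 s b) y z"
      if "x \<in> lie_space (a5 s b)" "y \<in> lie_space (a5 s b)" "z \<in> lie_space (a5 s b)" for x y z
      using that by (rule a5_br_add)
    show "lie_br (a5 s b) x y = - lie_br (a5 s b) y x" if "x \<in> lie_space (a5 s b)" "y \<in> lie_space (a5 s b)" for x y
      using that by (rule a5_br_anti)
    show "lie_br (a5 s b) (aH A) (aH B) = aH (\<lambda>i. A i ** B i - B i ** A i)"
      if "\<forall>i. trace (A i) = 0" "\<forall>i. trace (B i) = 0" for A B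
      using tphi_empty_empty[of A 0 B 0] by (simp add: br_e[OF V(1)[OF that(1)] V(1)[OF that(2)] S(2)] linear_zeroD[OF aT_linear])
    have zz: "aH (\<lambda>i. 0) = 0" using linear_zeroD[OF aH_linear] by (simp add: zero_fun_def)
    show "lie_br (a5 s b) (aH A) (aT \<alpha>) = 0" if "\<forall>i. trace (A i) = 0" "\<alpha> \<in> t2" for A \<alpha>
      using tphi_empty_empty[of A 0 0 \<alpha>]
      by (simp add: br_e[OF V(1)[OF that(1)] V(2)[OF that(2)] S(2)] linear_zeroD[OF aT_linear] linear_zeroD[OF aH_linear] mz zz)
    show "lie_br (a5 s b) (aT \<alpha>) (aT \<beta>) = 0" if "\<alpha> \<in> t2" "\<beta> \<in> t2" for \<alpha> \<beta>
      using tphi_empty_empty[of 0 \<alpha> 0 \<beta>]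
      by (simp add: br_e[OF V(2)[OF that(1)] V(2)[OF that(2)] S(2)] linear_zeroD[OF aH_linear] mz zz)
    show "lie_br (a5 s b) (aH A) (aP k a) = aP k (A (k + 1) ** a - a ** A k)" if "\<forall>i. trace (A i) = 0" for A k a
      unfolding br_e[OF V(1)[OF that] V(3) S(1)] unfolding aP_def
      by (subst H0, subst tphi_empty_edge[OF that VEP_in_W(1)]) (simp add: act0 mc_VEP mz VEP_simps)
    show "lie_br (a5 s b) (aH A) (aN k a) = aN k (A (k + 1) ** a - a ** A k)" if "\<forall>i. trace (A i) = 0" for A k a
      unfolding br_e[OF V(1)[OF that] V(4) S(1)] unfolding aN_def
      by (subst H0, subst tphi_empty_edge[OF that VEP_in_W(2)]) (simp add: act0 mc_VEP mz VEP_simps)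
    show "lie_br (a5 s b) (aT \<alpha>) (aP k a) = aP k (mat_scale (\<alpha> (k - 1)) a)" if "\<alpha> \<in> t2" for \<alpha> k a
      unfolding br_e[OF V(2)[OF that] V(3) S(1)] unfolding aP_def
      by (subst T0, subst tphi_empty_edge[OF z(1) VEP_in_W(1)]) (simp add: act_VE_def mc_VEP mz VEP_simps)
    show "lie_br (a5 s b) (aT \<alpha>) (aN k a) = aN k (mat_scale (- \<alpha> (k - 1)) a)" if "\<alpha> \<in> t2" for \<alpha> k a
      unfolding br_e[OF V(2)[OF that] V(4) S(1)] unfolding aN_def
      by (subst T0, subst tphi_empty_edge[OF z(1) VEP_in_W(2)]) (simp add: act_VE_def mc_VEP mz VEP_simps mat_scale_minus)
    show "lie_br (a5 s b) (aP k a) (aP k c) = 0" "lie_br (a5 s b) (aN k a) (aN k c) = 0" for k a c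
      unfolding br_kk[OF V(3) V(3)] br_kk[OF V(4) V(4)] unfolding aP_def aN_def
      by (simp_all add: tphi_edge_edge VEP_in_W mc_VEP PN_linear linear_zeroD[OF aH_linear] linear_zeroD[OF aT_linear])
    show "lie_br (a5 s b) (aP k a) (aP (k + 1) c) = aN (k + 2) (mat_bar a ** mat_bar c)"
      "lie_br (a5 s b) (aN k a) (aN (k + 1) c) = aP (k + 2) (mat_bar a ** mat_bar c)" for k a c
      unfolding br_Suc[OF V(3) V(3)] br_Suc[OF V(4) V(4)] unfolding aP_def aN_def
      by (simp_all add: tphi_edge_Suc VEP_in_W off_VE_def mc_VEP mz VEP_simps)
    show "lie_br (a5 s b) (aP k a) (aN k c) = aH (PN_H k a c) + aT (PN_T k a c)" for k a c
      unfolding br_kk[OF V(3) V(4)] unfolding aP_def aN_def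
      by (simp add: tphi_edge_edge VEP_in_W mc_VEP PN_linear)
    show "lie_br (a5 s b) (aP k a) (aN l c) = 0" if "l \<noteq> k" for l k a c
    proof -
      have "l = k + 1 \<or> k = l + 1"
        using that three_cases[of l] three_cases[of k] by (elim disjE) (simp_all add: three_eq_0 four_eq_1)
      then show ?thesis
      proof
        assume l: "l = k + 1"
        show ?thesis
          unfolding l br_Suc[OF V(3) V(4)] unfolding aP_def aN_def
          by (simp add: tphi_edge_Suc VEP_in_W off_VE_def mc_VEP mz VEP_simps a5_inj_simps)
      next
        assume k: "k = l + 1"
        have "lie_br (a5 s b) (aN l c) (aP k a) = 0"
          unfolding k br_Suc[OF V(4) V(3)] unfolding aP_def aN_def
          by (simp add: tphi_edge_Suc VEP_in_W off_VE_def mc_VEP mz VEP_simps a5_inj_simps)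
        then show ?thesis
          using a5_br_anti[OF V_hat_in_space[OF S(1) V(3)] V_hat_in_space[OF S(1) V(4)], of k a l c] by simp
      qed
    qed
  qed
  show "block_table_onto_axioms (a5 s b) aH aT aP aN"
    by (rule block_table_onto_axioms.intro) (unfold a5_space_eq, blast)
qed

end

section \<open>A symplectic basis and the assembly of the theorem\<close>

lemma symplectic_basis:
  fixes s :: "'f::field \<Rightarrow> 'v::ab_group_add \<Rightarrow> 'v"
  assumes two: "(2::'f) \<noteq> 0" and s: "vector_space s" and dim: "vector_space.dim s UNIV = 2"
    and b: "bilinear_map s s (*) b" and anti: "\<And>x y. b x y = - b y x" and nz: "b x0 y0 \<noteq> 0"
  shows "\<exists>p q. symplectic_plane s b p q"
proof -
  interpret vector_space s by fact
  note bs = bilinear_add_left[OF b] bilinear_add_right[OF b] bilinear_scale_left[OF b] bilinear_scale_right[OF b]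
  have self: "b x x = 0" for x
    using anti[of x x] two by (simp add: eq_neg_iff_add_eq_0 flip: mult_2)
  define p where "p = x0"
  define q where "q = s (inverse (b x0 y0)) y0"
  have pq: "b p q = 1" using nz by (simp add: p_def q_def bs)
  have ind: "independent {p, q}"
  proof -
    have "p \<noteq> q" using pq self by auto
    moreover have "p \<notin> span {q}"
      using pq self by (auto simp: span_singleton bs)
    moreover have "q \<noteq> 0" using pq bilinear_zero_right[OF b] by auto
    ultimately show ?thesis by (simp add: independent_insert dependent_single)
  qed
  obtain B where B: "independent B" "span B = UNIV" "card B = 2"
    using basis_exists[of UNIV] dim by (metis top.extremum_uniqueI)
  have finB: "finite B" using B(3) by (simp add: card_ge_0_finite)
  \<comment> \<open>A vector outside the span would give three independent vectors in dimension
    two.\<close>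
  have "v \<in> span {p, q}" for v
  proof (rule ccontr)
    assume v: "v \<notin> span {p, q}"
    then have "independent {v, p, q}"
      using ind by (rule independent_insertI)
    then have "card {v, p, q} \<le> card B"
      using independent_span_bound[OF finB, of "{v, p, q}"] B(2) by simp
    moreover have "card {v, p, q} = 3"
    proof -
      have "v \<notin> {p, q}" using v span_base by blast
      moreover have "p \<noteq> q" using pq self by auto
      ultimately show ?thesis by auto
    qed
    ultimately show False using B(3) by simp
  qed
  have "s (b v q) p + s (b p v) q = v" for v
  proof -
    obtain x y where "v = s x p + s y q"
      using \<open>v \<in> span {p, q}\<close> by (auto simp: span_insert span_singleton diff_eq_eq add.commute)
    then show ?thesis by (simp add: bs pq self)
  qed
  then have "symplectic_plane s b p q"
    by (intro symplectic_plane.intro symplectic_plane_axioms.intro s two b anti pq)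
  then show ?thesis by blast
qed

theorem mainTheorem8:
  fixes s :: "'f::field \<Rightarrow> 'v::ab_group_add \<Rightarrow> 'v"
    and b :: "'v \<Rightarrow> 'v \<Rightarrow> 'f"
  assumes "CHAR('f) \<noteq> 2"
    and "vector_space s" and "vector_space.dim s UNIV = 2"
    and "bilinear_map s s (*) b" and "\<forall>x y. b x y = - b y x" and "\<exists>x y. b x y \<noteq> 0"
  shows "lie_algebra (a5 s b) \<and>
    (\<forall>\<sigma>\<in>S_c3. \<forall>\<tau>\<in>S_c3. \<forall>x\<in>V_hat s b \<sigma>. \<forall>y\<in>V_hat s b \<tau>.
       tphi s b \<sigma> \<tau> x y \<in> V_hat s b (sym_diff \<sigma> \<tau>) \<and>
       lie_br (a5 s b) x y = a5_scale s (eps_a5 \<sigma> \<tau>) (tphi s b \<sigma> \<tau> x y)) \<and>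
    lie_isomorphic (a5 s b) (g_alg (S4 :: ('f, 'f^2^2) calg) (S2 :: ('f, 'f \<times> 'f) calg)) \<and>
    (\<exists>f :: ('f, 'f^2^2, 'f \<times> 'f) g_elem \<Rightarrow> ('f, ('f^2^2) \<times> ('f^2^2), 'f \<times> 'f) g_elem.
       natural_inclusion f) \<and>
    (CHAR('f) \<noteq> 3 \<longrightarrow>
       split_simple_type_A 5 (g_alg (S4 :: ('f, 'f^2^2) calg) (S2 :: ('f, 'f \<times> 'f) calg)))"
proof -
  \<comment> \<open>If 2 = 0 in the field, the characteristic is a positive divisor of 2 other than
    1.\<close>
  have two: "(2::'f) \<noteq> 0"
  proof
    assume "(2::'f) = 0"
    then have "of_nat 2 = (0::'f)" by simp
    then have "CHAR('f) dvd 2" by (simp only: of_nat_eq_0_iff_char_dvd)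
    moreover have "CHAR('f) \<noteq> 0" using calculation by (metis dvd_0_left_iff zero_neq_numeral)
    moreover have "CHAR('f) \<le> 2" using calculation by (auto dest: dvd_imp_le)
    moreover have "CHAR('f) \<noteq> 1" by simp
    ultimately show False using assms(1) by linarith
  qed
  obtain x0 y0 where "b x0 y0 \<noteq> 0" using assms(6) by blast
  then obtain p q where "symplectic_plane s b p q"
    using symplectic_basis[OF two assms(2-4)] assms(5) by blast
  then interpret V: symplectic_plane s b p q .
  interpret G: table_S4 "TYPE('f)" by unfold_locales (fact two)
  interpret L: block_table_onto "a5 s b" V.aH V.aT V.aP V.aN by (rule V.block_table_onto_a5)
  have "split_simple_type_A 5 (g_alg (S4 :: ('f, 'f^2^2) calg) (S2 :: ('f, 'f \<times> 'f) calg))"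
    if "CHAR('f) \<noteq> 3"
  proof (rule G.split_simple_S4)
    show "(3::'f) \<noteq> 0"
    proof
      assume "(3::'f) = 0"
      then have "of_nat 3 = (0::'f)" by simp
      then have "CHAR('f) dvd 3" by (simp only: of_nat_eq_0_iff_char_dvd)
      moreover have "CHAR('f) \<noteq> 0" using calculation by (metis dvd_0_left_iff zero_neq_numeral)
      moreover have "CHAR('f) \<le> 3" using calculation by (auto dest: dvd_imp_le)
      moreover have "CHAR('f) \<noteq> 1" by simp
      ultimately show False using that assms(1) by linarith
    qed
  qed
  then show ?thesis
    using L.lie_algebra L.isomorphic[OF G.T4.pgl_presentation_axioms] G.natural_inclusion_exists
      V.tphi_in_V_hat V.a5_br_V_hat
    by blast
qed

end
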